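(* Let $P\in\wedge^\ell H^{(n)}$ (with $n\ge 2$, $\ell\ge 1$). If $\rho_+(P)=\rho_-(P)=0$, that is, if $$P(X_1,\dots,X_{\ell-1},x^{-1}|x_1,\dots,x_{n-2},x,-x)=0\quad\text{and}\quad P(X_1,\dots,X_{\ell-1},-x^{-1}|x_1,\dots,x_{n-2},x,-x)=0$$ identically (where $x=x_{n-1}$), then $$\operatorname{Res}_{\beta_n=\beta_{n-1}+\pi i}\psi_P=0,$$ where $\psi_P$ is the $V^{\otimes n}$-valued function of $\beta_1,\dots,\beta_n$ defined in the context.
   Context: $R_n$ is the ring of symmetric polynomials in $x_1,\dots,x_n$, $H^{(n)}=\bigoplus_{k=0}^{n-1}R_nX^k$, and $\wedge^\ell H^{(n)}$ (exterior power over $R_n$) is identified with the space of anti-symmetric polynomials $P(X_1,\dots,X_\ell|x_1,\dots,x_n)$ in $X_1,\dots,X_\ell$ of degree less than $n$ in each $X_a$ with coefficients in $R_n$, via $X^{i_1}\wedge\cdots\wedge X^{i_\ell}\mapsto\sum_{\sigma\in S_\ell}\operatorname{sgn}\sigma\,X_{\sigma(1)}^{i_1}\cdots X_{\sigma(\ell)}^{i_\ell}$. For such $P$, $\rho_\pm(P)=P(X_1,\dots,X_{\ell-1},\pm x^{-1}|x_1,\dots,x_{n-2},x,-x)$ with $x=x_{n-1}$. Throughout $X_a=e^{-\alpha_a}$, $x_j=e^{\beta_j}$. For $M=(m_1,\dots,m_\ell)$ with $1\le m_1<\cdots<m_\ell\le n$ put $$I_M(P)=\int_{C^\ell}\prod_{a=1}^\ell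 d\alpha_a\prod_{a=1}^\ell\phi_n(\alpha_a)\; g_M\;\frac{P(X_1,\dots,X_\ell|x_1,\dots,x_n)}{\prod_{a=1}^\ell\prod_{j=1}^n(1-X_ax_j)},$$ $$\phi_n(\alpha)=\prod_{j=1}^n\frac{\Gamma\big(\frac{\alpha-\beta_j+\pi i}{-2\pi i}\big)}{\Gamma\big(\frac{\alpha-\beta_j}{-2\pi i}\big)},\qquad g_M=\prod_{a=1}^\ell\Big(\frac{1}{\alpha_a-\beta_{m_a}}\prod_{j=1}^{m_a-1}\frac{\alpha_a-\beta_j+\pi i}{\alpha_a-\beta_j}\Big)\prod_{1\le a<b\le\ell}(\alpha_a-\alpha_b+\pi i).$$ The contour $C$ goes from $-\infty$ to $+\infty$, separating the two sets $\{\beta_j,\beta_j-2\pi i,\beta_j-4\pi i,\dots\mid 1\le j\le n\}$ and $\{\beta_j-\pi i,\beta_j+\pi i,\beta_j+3\pi i,\dots\mid1\le j\le n\}$. Let $V=\mathbb Cv_+\oplus\mathbb Cv_-$, and $v_M=v_{\epsilon_1}\otimes\cdots\otimes v_{\epsilon_n}\in V^{\otimes n}$ where $\epsilon_j=-$ if $j\in M$ and $\epsilon_j=+$ otherwise. Then $\psi_P=\sum_MI_M(P)v_M$, the sum being over all such $M$. It is known that, as a function of $\beta_n$, $\psi_P$ has at most a simple pole at $\beta_n=\beta_{n-1}+\pi i$. *)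

theory Defs
  imports
    "HOL-Complex_Analysis.Complex_Analysis"
    "HOL-Combinatorics.Permutations"
    "HOL-Library.Poly_Mapping"
begin

text \<open>
  A polynomial in two families of variables is a finitely supported map from monomials to
  coefficients. The variable \<open>Inl a\<close> is $X_a$, the variable \<open>Inr j\<close> is $x_j$.
\<close>

type_synonym Xx_poly = "((nat + nat) \<Rightarrow>\<^sub>0 nat) \<Rightarrow>\<^sub>0 complex"

definition eval_poly :: "Xx_poly \<Rightarrow> (nat \<Rightarrow> complex) \<Rightarrow> (nat \<Rightarrow> complex) \<Rightarrow> complex" where
  "eval_poly P X x =
     (\<Sum>m\<in>Poly_Mapping.keys P. Poly_Mapping.lookup P m * (\<Prod>v\<in>Poly_Mapping.keys m. (case v of Inl a \<Rightarrow> X a | Inr j \<Rightarrow> x j) ^ Poly_Mapping.lookup m v))"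

text \<open>
  The exterior power $\wedge^l H^{(n)}$ over the ring of symmetric polynomials, realised as the space
  of polynomials in $X_1,\dots,X_l,x_1,\dots,x_n$ that are anti-symmetric in the $X_a$, of degree
  less than $n$ in each $X_a$, and symmetric in the $x_j$. Since the coefficients are complex, the
  two symmetry conditions may be tested on values.
\<close>

definition wedge_H :: "nat \<Rightarrow> nat \<Rightarrow> Xx_poly set" where
  "wedge_H n l = {P.
     (\<forall>m\<in>Poly_Mapping.keys P. Poly_Mapping.keys m \<subseteq> Inl ` {1..l} \<union> Inr ` {1..n}) \<and>
     (\<forall>m\<in>Poly_Mapping.keys P. \<forall>a\<in>{1..l}. Poly_Mapping.lookup m (Inl a) < n) \<and>
     (\<forall>\<sigma>. \<sigma> permutes {1..l} \<longrightarrow>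
        (\<forall>X x. eval_poly P (X \<circ> \<sigma>) x = of_int (sign \<sigma>) * eval_poly P X x)) \<and>
     (\<forall>\<sigma>. \<sigma> permutes {1..n} \<longrightarrow> (\<forall>X x. eval_poly P X (x \<circ> \<sigma>) = eval_poly P X x))}"

text \<open>
  $\rho_\pm(P)$ as a function of $X_1,\dots,X_{l-1},x_1,\dots,x_{n-2}$ and $x=x_{n-1}$; the sign is the
  parameter \<open>s\<close>. It is a Laurent polynomial in $x$, so only its values at $x\neq 0$ are meaningful.
\<close>

definition rho :: "nat \<Rightarrow> nat \<Rightarrow> complex \<Rightarrow> Xx_poly \<Rightarrow> (nat \<Rightarrow> complex) \<Rightarrow> (nat \<Rightarrow> complex) \<Rightarrow> complex" where
  "rho n l s P X x = eval_poly P (X(l := s * inverse (x (n - 1)))) (x(n := - x (n - 1)))"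

definition rho_vanishes :: "nat \<Rightarrow> nat \<Rightarrow> complex \<Rightarrow> Xx_poly \<Rightarrow> bool" where
  "rho_vanishes n l s P \<longleftrightarrow> (\<forall>X x. x (n - 1) \<noteq> 0 \<longrightarrow> rho n l s P X x = 0)"

definition phi :: "nat \<Rightarrow> (nat \<Rightarrow> complex) \<Rightarrow> complex \<Rightarrow> complex" where
  "phi n \<beta> \<alpha> = (\<Prod>j=1..n. Gamma ((\<alpha> - \<beta> j + pi * \<i>) / (-2 * pi * \<i>))
                          / Gamma ((\<alpha> - \<beta> j) / (-2 * pi * \<i>)))"

text \<open>
  The indices $M=(m_1,\dots,m_l)$ are strictly increasing lists; lists are counted from 0, so
  $m_a$ is \<open>M ! (a - 1)\<close>.
\<close>

definition indices :: "nat \<Rightarrow> nat \<Rightarrow> nat list set" where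
  "indices n l = {M. length M = l \<and> sorted_wrt (<) M \<and> set M \<subseteq> {1..n}}"

definition g :: "nat \<Rightarrow> (nat \<Rightarrow> complex) \<Rightarrow> nat list \<Rightarrow> (nat \<Rightarrow> complex) \<Rightarrow> complex" where
  "g l \<beta> M \<alpha> =
     (\<Prod>a=1..l. 1 / (\<alpha> a - \<beta> (M ! (a - 1))) *
        (\<Prod>j=1..<M ! (a - 1). (\<alpha> a - \<beta> j + pi * \<i>) / (\<alpha> a - \<beta> j))) *
     (\<Prod>b=1..l. \<Prod>a=1..<b. \<alpha> a - \<alpha> b + pi * \<i>)"

definition lower_points :: "nat \<Rightarrow> (nat \<Rightarrow> complex) \<Rightarrow> complex set" where
  "lower_points n \<beta> = {\<beta> j - 2 * of_nat k * pi * \<i> | j k. j \<in> {1..n}}"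

definition upper_points :: "nat \<Rightarrow> (nat \<Rightarrow> complex) \<Rightarrow> complex set" where
  "upper_points n \<beta> = {\<beta> j - pi * \<i> + 2 * of_nat k * pi * \<i> | j k. j \<in> {1..n}}"

definition separates :: "(real \<Rightarrow> complex) \<Rightarrow> complex set \<Rightarrow> complex set \<Rightarrow> bool" where
  "separates C S T \<longleftrightarrow> S \<inter> range C = {} \<and> T \<inter> range C = {} \<and>
     (\<forall>s\<in>S. \<forall>t\<in>T. \<not> connected_component (- range C) s t)"

text \<open>
  An admissible contour is a simple $C^1$ curve from $-\infty$ to $+\infty$, running along the real
  axis near both ends. The derivative may vanish, so contours with corners are included after
  reparametrisation. A simple such curve cuts the plane into two components, one below and one
  above it; as the two point sets go down and up to infinity, \<open>separates\<close> puts the first one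
  entirely below and the second one entirely above. Such a curve exists iff the two sets are
  disjoint, and by Cauchy's theorem the integrals below do not depend on the choice.
\<close>

definition contour :: "nat \<Rightarrow> (nat \<Rightarrow> complex) \<Rightarrow> (real \<Rightarrow> complex) \<Rightarrow> bool" where
  "contour n \<beta> C \<longleftrightarrow>
     C C1_differentiable_on UNIV \<and> inj C \<and>
     (\<exists>R. \<forall>t. R \<le> \<bar>t\<bar> \<longrightarrow> C t = of_real t) \<and>
     separates C (lower_points n \<beta>) (upper_points n \<beta>)"

text \<open>The integral of \<open>f\<close> over $C^l$, with respect to $d\alpha_1\cdots d\alpha_l$.\<close>

definition integral_over_power ::
    "nat \<Rightarrow> (real \<Rightarrow> complex) \<Rightarrow> ((nat \<Rightarrow> complex) \<Rightarrow> complex) \<Rightarrow> complex" where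
  "integral_over_power l C f =
     (LINT t|PiM {1..l} (\<lambda>_. lborel).
        (\<Prod>a=1..l. vector_derivative C (at (t a))) * f (\<lambda>a. C (t a)))"

definition I_M :: "nat \<Rightarrow> nat \<Rightarrow> Xx_poly \<Rightarrow> (real \<Rightarrow> complex) \<Rightarrow> (nat \<Rightarrow> complex) \<Rightarrow> nat list \<Rightarrow> complex" where
  "I_M n l P C \<beta> M = integral_over_power l C (\<lambda>\<alpha>.
     (\<Prod>a=1..l. phi n \<beta> (\<alpha> a)) * g l \<beta> M \<alpha> *
     (eval_poly P (\<lambda>a. exp (- \<alpha> a)) (\<lambda>j. exp (\<beta> j)) /
      (\<Prod>a=1..l. \<Prod>j=1..n. 1 - exp (- \<alpha> a) * exp (\<beta> j))))"

text \<open>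
  The space $V$ is given by coordinates with respect to $v_+,v_-$, and $V^{\otimes n}$ by coordinates
  with respect to the basis $v_{\epsilon_1}\otimes\cdots\otimes v_{\epsilon_n}$, which is indexed by the
  words of length $n$ in the two signs.
\<close>

datatype spin = SpinPlus | SpinMinus

type_synonym V = "spin \<Rightarrow> complex"
type_synonym V_tensor = "spin list \<Rightarrow> complex"

definition v :: "spin \<Rightarrow> V" where
  "v e = (\<lambda>e'. if e' = e then 1 else 0)"

definition tensor :: "V list \<Rightarrow> V_tensor" where
  "tensor us = (\<lambda>es. if length es = length us then \<Prod>i<length us. (us ! i) (es ! i) else 0)"

definition v_M :: "nat \<Rightarrow> nat list \<Rightarrow> V_tensor" where
  "v_M n M = tensor (map (\<lambda>j. v (if j \<in> set M then SpinMinus else SpinPlus)) [1..<n + 1])"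

definition psi :: "nat \<Rightarrow> nat \<Rightarrow> Xx_poly \<Rightarrow> (real \<Rightarrow> complex) \<Rightarrow> (nat \<Rightarrow> complex) \<Rightarrow> V_tensor" where
  "psi n l P C \<beta> = (\<lambda>es. \<Sum>M\<in>indices n l. I_M n l P C \<beta> M * v_M n M es)"

definition residue_tensor :: "(complex \<Rightarrow> V_tensor) \<Rightarrow> complex \<Rightarrow> V_tensor" where
  "residue_tensor F z = (\<lambda>es. residue (\<lambda>b. F b es) z)"

end

theory Submission
  imports Defs
begin

text \<open>
  Write \<open>b\<close> for \<open>\<beta>\<^sub>n\<close> and \<open>z = \<beta>\<^sub>n\<^sub>-\<^sub>1 + \<pi> \<i>\<close>. As \<open>b\<close> tends to \<open>z\<close>, the points \<open>b\<close>, \<open>\<beta>\<^sub>n\<^sub>-\<^sub>1\<close> and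
  \<open>b - 2 \<pi> \<i>\<close> below the contour collide with points above it. Expanding \<open>P\<close> and the product of the
  \<open>\<alpha>\<^sub>a - \<alpha>\<^sub>b + \<pi> \<i>\<close> into monomials reduces the integral to products of one-variable integrals, and
  moving the contour past these three points splits each of these into a part analytic at \<open>z\<close> and
  three residues with at most a simple pole there. Selecting in each variable either the analytic part or
  one of the points, one has to show that every resulting term is regular.

  At the three points \<open>X\<close> takes only two values as a function of \<open>b\<close>, so by antisymmetry at most two variables
  contribute a residue. In the limit these values are \<open>\<plusminus>1/x\<close>, so \<open>\<rho>\<^sub>\<plusminus> P = 0\<close> kills a simple pole. A double
  pole also loses its second order: either one of the residues vanishes in the limit or identically because
  \<open>M\<close> is increasing, or the factor \<open>\<alpha>\<^sub>a - \<alpha>\<^sub>b + \<pi> \<i>\<close> equals \<open>\<plusminus>(b - z)\<close> at the selected points.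

  The expansion needs integrable monomials. If the degree \<open>l - 1\<close> in \<open>\<alpha>\<^sub>a\<close> is too large for this, then
  either \<open>P\<close> is divisible by all \<open>X\<^sub>a\<close>, which gives exponential decay, or for \<open>b \<noteq> z\<close> near \<open>z\<close> the full integrand is
  never absolutely integrable, and then its Lebesgue integral is 0 by convention.
\<close>

section \<open>Proper curves and winding numbers\<close>

text \<open>The curve \<open>C b\<close> may change with \<open>b\<close> without any continuity, so
  no deformation can follow it. Each one-variable integral is therefore rewritten, for every single
  admissible curve, as an integral over one fixed horizontal line and residues, after which the
  curve no longer occurs. Which residues occur is a topological question: \<open>separates\<close>
  only says that certain pairs of points lie in different components, and the Jordan curve theorem
  is needed to turn this into winding numbers. Residues at lower points that do not collide are
  gathered by integrals over fixed small circles, so the order of those poles never matters. At the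
  colliding points the poles are simple because \<beta> (n - 1) differs from the earlier parameters
  by no multiple of \<pi> i: even multiples are excluded by hypothesis, odd ones by the existence of
  a contour. The regular parts at \<open>b = z\<close> are limits rather than integrals over
  admissible contours. Identities for \<open>P\<close> reach them because the functions
  \<open>\<alpha> ^ k * exp (- \<alpha>) ^ i\<close> are linearly independent, so a relation between
  these holds for any numbers attached to the pairs \<open>(k, i)\<close>.\<close>

definition moebius_curve :: "(real \<Rightarrow> complex) \<Rightarrow> complex \<Rightarrow> real \<Rightarrow> complex" where
  "moebius_curve C q u =
     (if cos (pi * (u - 1/2)) = 0 then 0 else 1 / (C (tan (pi * (u - 1/2))) - q))"

lemma cos_moebius_zero_iff:
  assumes "u \<in> {0..1}"
  shows "cos (pi * (u - 1/2)) = 0 \<longleftrightarrow> u = 0 \<or> u = 1"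
proof
  assume c0: "cos (pi * (u - 1/2)) = 0"
  show "u = 0 \<or> u = 1"
  proof (rule ccontr)
    assume "\<not> (u = 0 \<or> u = 1)"
    then have "0 < u" "u < 1" using assms by auto
    then have "pi * (u - 1/2) < pi * (1/2)" "pi * (-1/2) < pi * (u - 1/2)"
      by (intro mult_strict_left_mono; simp)+
    then have "cos (pi * (u - 1/2)) > 0"
      by (intro cos_gt_zero_pi) auto
    with c0 show False by simp
  qed
next
  assume "u = 0 \<or> u = 1"
  then show "cos (pi * (u - 1/2)) = 0"
    by (auto simp: algebra_simps cos_diff)
qed

lemma moebius_arctan:
  fixes t :: real
  defines "u \<equiv> arctan t / pi + 1/2"
  shows "0 < u" "u < 1" "tan (pi * (u - 1/2)) = t"
proof -
  have e: "pi * (u - 1/2) = arctan t" by (simp add: u_def)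
  show "tan (pi * (u - 1/2)) = t" unfolding e by (rule tan_arctan)
  have "arctan t > pi * (-1/2)" "arctan t < pi * (1/2)"
    using arctan_bounded[of t] by auto
  then have "pi * (u - 1/2) > pi * (-1/2)" "pi * (u - 1/2) < pi * (1/2)"
    unfolding e by auto
  then have "u - 1/2 > -1/2" "u - 1/2 < 1/2"
    by (metis mult_less_cancel_left_pos pi_gt_zero)+
  then show "0 < u" "u < 1" by auto
qed

text \<open>Infinity goes to 0 under \<open>1 / (z - q)\<close>, and the tangent stretches the open
  unit interval over the real line, so both ends close up at 0. Testing \<open>cos\<close> instead
  of \<open>u\<close> keeps the definition 1-periodic, and continuity at the ends is an ordinary
  two-sided limit.\<close>

lemma continuous_moebius_curve:
  assumes cont: "continuous_on UNIV C" and R: "\<forall>t. R \<le> \<bar>t\<bar> \<longrightarrow> C t = of_real t"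
    and q: "q \<notin> range C"
  shows "continuous_on {0..1} (moebius_curve C q)"
proof (rule continuous_at_imp_continuous_on, rule ballI)
  fix u :: real assume u: "u \<in> {0..1}"
  let ?th = "\<lambda>u::real. pi * (u - 1/2)"
  show "isCont (moebius_curve C q) u"
  proof (cases "cos (?th u) = 0")
    case False
    have "isCont C x" for x using cont by (simp add: continuous_on_eq_continuous_at)
    moreover have "isCont (\<lambda>u. tan (?th u)) u" using False by (intro continuous_intros) auto
    ultimately have "isCont (\<lambda>u. C (tan (?th u))) u" by (rule isCont_o2[rotated])
    moreover have "C (tan (?th u)) - q \<noteq> 0" using q by auto
    ultimately have "isCont (\<lambda>u. 1 / (C (tan (?th u)) - q)) u"
      by (intro isCont_divide isCont_diff continuous_const)
    moreover have "isCont (\<lambda>u. cos (?th u)) u" by (intro continuous_intros)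
    then have "(\<lambda>u. cos (?th u)) \<midarrow>u\<rightarrow> cos (?th u)" by (simp add: isCont_def)
    then have "\<forall>\<^sub>F x in at u. cos (?th x) \<noteq> 0"
      using False by (metis tendsto_imp_eventually_ne)
    then have "\<forall>\<^sub>F x in at u. 1 / (C (tan (?th x)) - q) = moebius_curve C q x"
      by eventually_elim (simp add: moebius_curve_def)
    ultimately show ?thesis
      using False unfolding isCont_def
      by (subst (asm) tendsto_cong) (auto simp: moebius_curve_def)
  next
    case True
    \<comment> \<open>Where the curve is real, numerator and denominator of
      \<open>1 / (tan - q)\<close> are multiplied by \<open>cos\<close>, which removes the pole of
      the tangent. The expression with \<open>R\<close> below is positive only where the tangent, if
      defined, exceeds \<open>R\<close> in absolute value.\<close>
    let ?f = "\<lambda>u. complex_of_real (cos (?th u)) / (of_real (sin (?th u)) - q * of_real (cos (?th u)))"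
    have s1: "\<bar>sin (?th u)\<bar> = 1"
      using True sin_cos_squared_add[of "?th u"] by (auto simp: power2_eq_1_iff)
    have "isCont ?f u" using True s1 by (intro continuous_intros) auto
    then have lim: "?f \<midarrow>u\<rightarrow> 0" using True by (simp add: isCont_def)
    have "isCont (\<lambda>u. \<bar>sin (?th u)\<bar> - R * \<bar>cos (?th u)\<bar>) u" by (intro continuous_intros)
    then have "(\<lambda>u. \<bar>sin (?th u)\<bar> - R * \<bar>cos (?th u)\<bar>) \<midarrow>u\<rightarrow> 1"
      using True s1 by (simp add: isCont_def)
    then have "\<forall>\<^sub>F x in at u. \<bar>sin (?th x)\<bar> - R * \<bar>cos (?th x)\<bar> > 0"
      by (rule order_tendstoD) simp
    then have "\<forall>\<^sub>F x in at u. ?f x = moebius_curve C q x"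
    proof eventually_elim
      case (elim x)
      show ?case
      proof (cases "cos (?th x) = 0")
        case False
        have "R \<le> \<bar>tan (?th x)\<bar>" using elim False by (simp add: tan_def field_simps)
        then have "C (tan (?th x)) = of_real (tan (?th x))" using R by simp
        moreover have "complex_of_real (sin (?th x)) - q * of_real (cos (?th x)) =
            of_real (cos (?th x)) * (of_real (tan (?th x)) - q)"
          using False by (simp add: tan_def algebra_simps)
        ultimately show ?thesis using False by (simp add: moebius_curve_def)
      qed (simp add: moebius_curve_def)
    qed
    then have "moebius_curve C q \<midarrow>u\<rightarrow> 0" using lim by (subst (asm) tendsto_cong)
    then show ?thesis using True by (simp add: isCont_def moebius_curve_def)
  qed
qed

lemma moebius_curve_simple_loop:
  assumes cont: "continuous_on UNIV C" and R: "\<forall>t. R \<le> \<bar>t\<bar> \<longrightarrow> C t = of_real t"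
    and inj: "inj C" and q: "q \<notin> range C"
  shows "simple_path (moebius_curve C q)"
    "pathfinish (moebius_curve C q) = pathstart (moebius_curve C q)"
    "path_image (moebius_curve C q) = insert 0 ((\<lambda>z. 1 / (z - q)) ` range C)"
proof -
  let ?th = "\<lambda>u::real. pi * (u - 1/2)"
  have ends: "moebius_curve C q 0 = 0" "moebius_curve C q 1 = 0"
    by (simp_all add: moebius_curve_def)
  then show "pathfinish (moebius_curve C q) = pathstart (moebius_curve C q)"
    by (simp add: pathfinish_def pathstart_def)
  have "loop_free (moebius_curve C q)"
    unfolding loop_free_def
  proof (intro ballI impI)
    fix x y assume x: "x \<in> {0..1::real}" and y: "y \<in> {0..1::real}"
      and eq: "moebius_curve C q x = moebius_curve C q y"
    have ne: "moebius_curve C q x = 0 \<longleftrightarrow> x = 0 \<or> x = 1" if "x \<in> {0..1}" for x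
      using cos_moebius_zero_iff[OF that] q by (auto simp: moebius_curve_def)
    show "x = y \<or> x = 0 \<and> y = 1 \<or> x = 1 \<and> y = 0"
    proof (cases "moebius_curve C q x = 0")
      case True
      then show ?thesis using ne[OF x] ne[OF y] eq by auto
    next
      case False
      then have xy: "0 < x" "x < 1" "0 < y" "y < 1" using ne[OF x] ne[OF y] eq x y by force+
      then have "cos (?th x) \<noteq> 0" "cos (?th y) \<noteq> 0" using cos_moebius_zero_iff x y by auto
      then have "1 / (C (tan (?th x)) - q) = 1 / (C (tan (?th y)) - q)"
        using eq by (simp add: moebius_curve_def)
      then have "C (tan (?th x)) = C (tan (?th y))" by simp
      then have "tan (?th x) = tan (?th y)" using inj by (simp add: inj_eq)
      moreover have "- (pi/2) < ?th z \<and> ?th z < pi/2" if "0 < z" "z < 1" for z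
      proof -
        have "pi * (-1/2) < pi * (z - 1/2)" "pi * (z - 1/2) < pi * (1/2)"
          using that by (intro mult_strict_left_mono; simp)+
        then show ?thesis by simp
      qed
      ultimately have "?th x = ?th y" using xy arctan_tan[of "?th x"] arctan_tan[of "?th y"] by metis
      then show ?thesis by simp
    qed
  qed
  then show "simple_path (moebius_curve C q)"
    using continuous_moebius_curve[OF cont R q] by (simp add: simple_path_def path_def)
  show "path_image (moebius_curve C q) = insert 0 ((\<lambda>z. 1 / (z - q)) ` range C)"
  proof (intro set_eqI iffI)
    fix w assume "w \<in> path_image (moebius_curve C q)"
    then show "w \<in> insert 0 ((\<lambda>z. 1 / (z - q)) ` range C)"
      by (auto simp: path_image_def moebius_curve_def)
  next
    fix w assume "w \<in> insert 0 ((\<lambda>z. 1 / (z - q)) ` range C)"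
    then consider "w = 0" | t where "w = 1 / (C t - q)" by auto
    then show "w \<in> path_image (moebius_curve C q)"
    proof cases
      case 1
      then show ?thesis using ends by (force simp: path_image_def)
    next
      case 2
      let ?u = "arctan t / pi + 1/2"
      have u: "0 < ?u" "?u < 1" "tan (?th ?u) = t" using moebius_arctan[of t] by auto
      have "cos (?th ?u) \<noteq> 0" using cos_moebius_zero_iff[of ?u] u by auto
      then have "moebius_curve C q ?u = w" using u 2 by (simp add: moebius_curve_def)
      then show ?thesis using u by (force simp: path_image_def)
    qed
  qed
qed

text \<open>The map \<open>z \<mapsto> 1 / (z - q)\<close> turns the curve into a Jordan curve through 0, and the component
  of \<open>q\<close> into its outside.\<close>

lemma complement_two_components:
  fixes C :: "real \<Rightarrow> complex"
  assumes cont: "continuous_on UNIV C" and R: "\<forall>t. R \<le> \<bar>t\<bar> \<longrightarrow> C t = of_real t"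
    and inj: "inj C" and q: "q \<notin> range C" and s: "s \<notin> range C" "s' \<notin> range C"
    and sq: "\<not> connected_component (- range C) s q" "\<not> connected_component (- range C) s' q"
  shows "connected_component (- range C) s s'"
proof -
  let ?g = "moebius_curve C q" and ?F = "\<lambda>w. q + 1 / w"
  note loop = moebius_curve_simple_loop[OF cont R inj q]
  note J = Jordan_inside_outside[OF loop(1,2)]
  have F_img: "?F ` A \<subseteq> - range C" if "A \<inter> path_image ?g = {}" for A
  proof clarify
    fix w t assume w: "w \<in> A" and eq: "q + 1 / w = C t"
    have "w \<notin> path_image ?g" using that w by blast
    moreover have "w = 1 / (C t - q)" by (simp add: eq[symmetric])
    ultimately show False using loop(3) by auto
  qed
  have F_cont: "continuous_on A ?F" if "A \<inter> path_image ?g = {}" for A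
    using that loop(3) by (intro continuous_intros) auto
  have ins: "1 / (s - q) \<in> inside (path_image ?g)"
    if s: "s \<notin> range C" and sq: "\<not> connected_component (- range C) s q" for s
  proof -
    have "s \<noteq> q" using sq q connected_component_refl[of q "- range C"] by auto
    have "1 / (s - q) \<notin> path_image ?g"
    proof
      assume "1 / (s - q) \<in> path_image ?g"
      then have "1 / (s - q) \<in> (\<lambda>z. 1 / (z - q)) ` range C"
        using \<open>s \<noteq> q\<close> by (simp add: loop(3))
      then obtain t where "1 / (s - q) = 1 / (C t - q)" by blast
      then have "s = C t" by simp
      then show False using s by simp
    qed
    moreover have "1 / (s - q) \<notin> outside (path_image ?g)"
    proof
      assume out: "1 / (s - q) \<in> outside (path_image ?g)"
      let ?A = "?F ` outside (path_image ?g)"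
      have disj: "outside (path_image ?g) \<inter> path_image ?g = {}" by (rule outside_no_overlap)
      have conn: "connected ?A" using J F_cont[OF disj] by (intro connected_continuous_image) auto
      \<comment> \<open>\<open>?F w\<close> tends to \<open>q\<close> as \<open>w\<close> tends to
        infinity, and the outside is unbounded. Adding such a limit point keeps the image connected,
        which would join \<open>s\<close> to \<open>q\<close>.\<close>
      have "q \<in> closure ?A"
      proof (rule closure_approachable[THEN iffD2], intro allI impI)
        fix e :: real assume e: "e > 0"
        have "\<not> bounded (outside (path_image ?g))" using J by blast
        then have "\<not> (\<forall>w\<in>outside (path_image ?g). norm w \<le> 1 / e)" unfolding bounded_iff by blast
        then obtain w where w: "w \<in> outside (path_image ?g)" "norm w > 1 / e" by force
        have "0 < 1 / e" using e by simp
        then have "norm w > 0" using w(2) by linarith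
        then have "dist (?F w) q < e" using w e by (simp add: dist_norm norm_divide field_simps)
        then show "\<exists>y\<in>?A. dist y q < e" using w by blast
      qed
      then have "connected (insert q ?A)"
        by (intro connected_intermediate_closure[OF conn]) (auto simp: closure_subset[THEN subsetD])
      moreover have "insert q ?A \<subseteq> - range C" using F_img[OF disj] q by auto
      moreover have "s \<in> ?A" using out by (intro image_eqI[of _ _ "1 / (s - q)"]) auto
      ultimately show False using sq unfolding connected_component_def by blast
    qed
    ultimately show ?thesis using J by blast
  qed
  let ?B = "?F ` inside (path_image ?g)"
  have disj: "inside (path_image ?g) \<inter> path_image ?g = {}" by (rule inside_no_overlap)
  have "connected ?B" using J F_cont[OF disj] by (intro connected_continuous_image) auto
  moreover have "?B \<subseteq> - range C" using F_img[OF disj] .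
  moreover have "s \<in> ?B" if "s \<notin> range C" "\<not> connected_component (- range C) s q" for s
    using ins[OF that] by (intro image_eqI[of _ _ "1 / (s - q)"]) auto
  ultimately show ?thesis using s sq by (intro connected_componentI[of ?B]) auto
qed

section \<open>Properness of the curve and the loops that close it up\<close>

lemma closed_range_proper_curve:
  fixes C :: "real \<Rightarrow> complex"
  assumes cont: "continuous_on UNIV C" and R: "\<forall>t. R \<le> \<bar>t\<bar> \<longrightarrow> C t = of_real t"
  shows "closed (range C)"
proof -
  have "range C = C ` {-R..R} \<union> {z. Im z = 0 \<and> (Re z \<ge> R \<or> Re z \<le> -R)}" (is "_ = ?A \<union> ?B")
  proof (intro set_eqI iffI)
    fix z assume "z \<in> range C"
    then obtain t where t: "z = C t" by blast
    show "z \<in> ?A \<union> ?B"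
    proof (cases "t \<in> {-R..R}")
      case False
      then have "R \<le> \<bar>t\<bar>" "t \<ge> R \<or> t \<le> -R" by auto
      then show ?thesis using R t by simp
    qed (simp add: t)
  next
    fix z assume "z \<in> ?A \<union> ?B"
    moreover have "z = C (Re z)" if "Im z = 0" "Re z \<ge> R \<or> Re z \<le> -R"
      using R[rule_format, of "Re z"] that by (auto simp: complex_eq_iff abs_real_def)
    ultimately show "z \<in> range C" by blast
  qed
  moreover have "closed ?A"
    by (intro compact_imp_closed compact_continuous_image continuous_on_subset[OF cont]) auto
  moreover have "closed ?B"
    by (intro closed_Collect_conj closed_Collect_disj closed_Collect_eq closed_Collect_le continuous_intros)
  ultimately show ?thesis by (simp add: closed_Un)
qed

lemma bounded_Im_proper_curve:
  fixes C :: "real \<Rightarrow> complex"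
  assumes cont: "continuous_on UNIV C" and R: "\<forall>t. R \<le> \<bar>t\<bar> \<longrightarrow> C t = of_real t"
  obtains H where "H > 0" "\<And>t. \<bar>Im (C t)\<bar> < H"
proof -
  have "compact (C ` {-R..R})"
    by (intro compact_continuous_image continuous_on_subset[OF cont]) auto
  then obtain B where B: "B > 0" "\<And>t. t \<in> {-R..R} \<Longrightarrow> norm (C t) \<le> B"
    by (metis bounded_pos compact_imp_bounded image_eqI)
  have "\<bar>Im (C t)\<bar> < B + 1" for t
  proof (cases "t \<in> {-R..R}")
    case True
    then show ?thesis using B(2)[of t] abs_Im_le_cmod[of "C t"] by simp
  next
    case False
    then have "R \<le> \<bar>t\<bar>" by auto
    then show ?thesis using R[rule_format, of t] B(1) by simp
  qed
  then show ?thesis using B(1) that[of "B + 1"] by simp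
qed

text \<open>For \<open>y\<close> below the curve the loop runs clockwise. This is the origin of the
  winding number -1 and of the minus sign in front of the residues in
  \<open>contour_shift\<close>.\<close>

definition closed_up :: "(real \<Rightarrow> complex) \<Rightarrow> real \<Rightarrow> real \<Rightarrow> real \<Rightarrow> complex" where
  "closed_up C T y = (\<lambda>s. C (2 * T * s - T)) +++ linepath (of_real T) (Complex T y) +++
     linepath (Complex T y) (Complex (-T) y) +++ linepath (Complex (-T) y) (of_real (-T))"

lemma affine_image_symmetric:
  fixes T :: real
  assumes "T > 0"
  shows "(\<lambda>s. 2 * T * s - T) ` {0..1} = {-T..T}"
proof (intro set_eqI iffI)
  fix x assume "x \<in> (\<lambda>s. 2 * T * s - T) ` {0..1}"
  then obtain s where s: "x = 2 * T * s - T" "s \<in> {0..1}" by (rule imageE)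
  have "T * s \<le> T" "0 \<le> T * s" using s assms by (auto simp: mult_left_le)
  then show "x \<in> {-T..T}" using s by auto
next
  fix x assume "x \<in> {-T..T}"
  then show "x \<in> (\<lambda>s. 2 * T * s - T) ` {0..1}"
    using assms by (intro image_eqI[of _ _ "(x + T) / (2 * T)"]) (auto simp: field_simps)
qed

lemma has_vector_derivative_affine_curve:
  fixes C :: "real \<Rightarrow> complex"
  assumes C1: "C C1_differentiable_on UNIV"
  shows "((\<lambda>s. C (2 * T * s - T)) has_vector_derivative
           (2 * T) *\<^sub>R vector_derivative C (at (2 * T * s - T))) (at s)"
proof -
  have "C differentiable at (2 * T * s - T)" using C1 by (simp add: C1_differentiable_on_eq)
  then have d: "(C has_vector_derivative vector_derivative C (at (2 * T * s - T))) (at (2 * T * s - T))"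
    by (simp add: vector_derivative_works)
  have "((\<lambda>s. 2 * T * s - T) has_vector_derivative 2 * T) (at s)"
    by (auto intro!: derivative_eq_intros simp: has_real_derivative_iff_has_vector_derivative[symmetric])
  from vector_diff_chain_at[OF this d] show ?thesis unfolding o_def .
qed

lemma C1_affine_curve:
  fixes C :: "real \<Rightarrow> complex"
  assumes C1: "C C1_differentiable_on UNIV"
  shows "(\<lambda>s. C (2 * T * s - T)) C1_differentiable_on {0..1}"
    "vector_derivative (\<lambda>s. C (2 * T * s - T)) (at s) =
       (2 * T) *\<^sub>R vector_derivative C (at (2 * T * s - T))"
proof -
  note d = has_vector_derivative_affine_curve[OF C1]
  show e: "vector_derivative (\<lambda>s. C (2 * T * s - T)) (at s) =
       (2 * T) *\<^sub>R vector_derivative C (at (2 * T * s - T))" for s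
    using d by (rule vector_derivative_at)
  have "continuous_on UNIV (\<lambda>t. vector_derivative C (at t))" using C1 by (simp add: C1_differentiable_on_eq)
  then have "continuous_on {0..1} (\<lambda>s. vector_derivative C (at (2 * T * s - T)))"
    by (rule continuous_on_compose2) (auto intro: continuous_intros)
  then have "continuous_on {0..1} (\<lambda>s. (2 * T) *\<^sub>R vector_derivative C (at (2 * T * s - T)))"
    by (intro continuous_on_scaleR continuous_on_const)
  then show "(\<lambda>s. C (2 * T * s - T)) C1_differentiable_on {0..1}"
    unfolding C1_differentiable_on_def using d
    by (intro exI[of _ "\<lambda>s. (2 * T) *\<^sub>R vector_derivative C (at (2 * T * s - T))"]) auto
qed

text \<open>Stated for an arbitrary curve, so that it also covers the horizontal line.\<close>

lemma contour_integral_affine_curve: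
  fixes C :: "real \<Rightarrow> complex"
  assumes C1: "C C1_differentiable_on UNIV" and T: "T > 0" and f: "continuous_on (C ` {-T..T}) f"
  shows "contour_integral (\<lambda>s. C (2 * T * s - T)) f =
           integral {-T..T} (\<lambda>t. vector_derivative C (at t) * f (C t))"
    "f contour_integrable_on (\<lambda>s. C (2 * T * s - T))"
proof -
  let ?h = "\<lambda>t. vector_derivative C (at t) * f (C t)"
  have "continuous_on UNIV (\<lambda>t. vector_derivative C (at t))" using C1 by (simp add: C1_differentiable_on_eq)
  then have "continuous_on {-T..T} (\<lambda>t. vector_derivative C (at t))" by (rule continuous_on_subset) simp
  moreover have "continuous_on UNIV C" using C1 by (rule C1_differentiable_imp_continuous_on)
  then have "continuous_on {-T..T} C" by (rule continuous_on_subset) simp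
  then have "continuous_on {-T..T} (\<lambda>t. f (C t))" by (rule continuous_on_compose2[OF f]) simp
  ultimately have ch: "continuous_on {-T..T} ?h" by (rule continuous_on_mult)
  have "((\<lambda>x. (2 * T) *\<^sub>R ?h (2 * T * x - T)) has_integral
      (integral {2 * T * 0 - T..2 * T * 1 - T} ?h)) {0..1}"
    by (rule has_integral_substitution[where c = "-T" and d = T])
       (use T ch affine_image_symmetric[OF T] in
         \<open>auto intro!: derivative_eq_intros simp: has_real_derivative_iff_has_vector_derivative[symmetric]\<close>)
  moreover have "(\<lambda>x. (2 * T) *\<^sub>R ?h (2 * T * x - T)) =
      (\<lambda>x. f (C (2 * T * x - T)) * vector_derivative (\<lambda>s. C (2 * T * s - T)) (at x))"
    by (simp add: fun_eq_iff C1_affine_curve(2)[OF C1])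
  moreover have "2 * T * 0 - T = -T" "2 * T * 1 - T = T" by simp_all
  ultimately have "((\<lambda>x. f (C (2 * T * x - T)) * vector_derivative (\<lambda>s. C (2 * T * s - T)) (at x)) has_integral
      (integral {-T..T} ?h)) {0..1}" by (simp only:)
  then have "(f has_contour_integral integral {-T..T} ?h) (\<lambda>s. C (2 * T * s - T))"
    by (simp add: has_contour_integral)
  then show "contour_integral (\<lambda>s. C (2 * T * s - T)) f = integral {-T..T} ?h"
    "f contour_integrable_on (\<lambda>s. C (2 * T * s - T))"
    by (auto simp: contour_integral_unique contour_integrable_on_def)
qed

lemma closed_up_path:
  fixes C :: "real \<Rightarrow> complex"
  assumes C1: "C C1_differentiable_on UNIV" and R: "\<forall>t. R \<le> \<bar>t\<bar> \<longrightarrow> C t = of_real t"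
    and T: "T \<ge> R" "T > 0"
  shows "valid_path (closed_up C T y)" "pathfinish (closed_up C T y) = pathstart (closed_up C T y)"
    "path_image (closed_up C T y) = C ` {-T..T} \<union> closed_segment (of_real T) (Complex T y) \<union>
       closed_segment (Complex T y) (Complex (-T) y) \<union> closed_segment (Complex (-T) y) (of_real (-T))"
    "valid_path (\<lambda>s. C (2 * T * s - T))"
    "pathfinish (\<lambda>s. C (2 * T * s - T)) = of_real T"
proof -
  let ?p = "\<lambda>s. C (2 * T * s - T)"
  have ends: "C T = of_real T" "C (-T) = of_real (-T)" using R[rule_format, of T] R[rule_format, of "-T"] T by auto
  show v: "valid_path ?p"
    unfolding valid_path_def by (intro C1_differentiable_imp_piecewise C1_affine_curve C1)
  show f: "pathfinish ?p = of_real T" using ends by (simp add: pathfinish_def)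
  have s: "pathstart ?p = of_real (-T)" using ends by (simp add: pathstart_def)
  have pim: "path_image ?p = C ` {-T..T}"
    unfolding path_image_def affine_image_symmetric[OF T(2), symmetric] by (simp add: image_image)
  show "valid_path (closed_up C T y)"
    unfolding closed_up_def using v f by (intro valid_path_join) auto
  show "pathfinish (closed_up C T y) = pathstart (closed_up C T y)"
    unfolding closed_up_def using s by simp
  show "path_image (closed_up C T y) = C ` {-T..T} \<union> closed_segment (of_real T) (Complex T y) \<union>
       closed_segment (Complex T y) (Complex (-T) y) \<union> closed_segment (Complex (-T) y) (of_real (-T))"
    unfolding closed_up_def using f pim by (subst path_image_join; simp add: path_image_join Un_assoc)
qed

lemma contour_integral_closed_up:
  fixes C :: "real \<Rightarrow> complex"
  assumes C1: "C C1_differentiable_on UNIV" and R: "\<forall>t. R \<le> \<bar>t\<bar> \<longrightarrow> C t = of_real t"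
    and T: "T \<ge> R" "T > 0" and f: "continuous_on (path_image (closed_up C T y)) f"
  shows "contour_integral (closed_up C T y) f =
     integral {-T..T} (\<lambda>t. vector_derivative C (at t) * f (C t)) +
     contour_integral (linepath (of_real T) (Complex T y)) f +
     contour_integral (linepath (Complex T y) (Complex (-T) y)) f +
     contour_integral (linepath (Complex (-T) y) (of_real (-T))) f"
proof -
  note P = closed_up_path[OF C1 R T]
  let ?p = "\<lambda>s. C (2 * T * s - T)"
  have c: "continuous_on (closed_segment (of_real T) (Complex T y)) f"
     "continuous_on (closed_segment (Complex T y) (Complex (-T) y)) f"
     "continuous_on (closed_segment (Complex (-T) y) (of_real (-T))) f"
     "continuous_on (C ` {-T..T}) f"
    by (rule continuous_on_subset[OF f], use P(3) in blast)+
  have i: "f contour_integrable_on linepath (of_real T) (Complex T y)"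
     "f contour_integrable_on linepath (Complex T y) (Complex (-T) y)"
     "f contour_integrable_on linepath (Complex (-T) y) (of_real (-T))"
    by (rule contour_integrable_continuous_linepath, fact c)+
  note ip = contour_integral_affine_curve[OF C1 T(2) c(4)]
  show ?thesis
    unfolding closed_up_def ip(1)[symmetric] using ip(2) i P(4,5)
    by (simp add: contour_integral_join contour_integrable_joinI valid_path_join)
qed

lemma Im_closed_segment: "w \<in> closed_segment a b \<Longrightarrow> Im a = Im b \<Longrightarrow> Im w = Im a"
  by (clarsimp simp: closed_segment_def) (simp add: algebra_simps)

lemma Re_closed_segment: "w \<in> closed_segment a b \<Longrightarrow> Re a = Re b \<Longrightarrow> Re w = Re a"
  by (clarsimp simp: closed_segment_def) (simp add: algebra_simps)

lemma closed_up_off_path: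
  fixes C :: "real \<Rightarrow> complex"
  assumes C1: "C C1_differentiable_on UNIV" and R: "\<forall>t. R \<le> \<bar>t\<bar> \<longrightarrow> C t = of_real t"
    and T: "T \<ge> R" "T > 0" and p: "p \<notin> range C" "\<bar>Re p\<bar> < T" "Im p \<noteq> y"
  shows "p \<notin> path_image (closed_up C T y)"
  unfolding closed_up_path(3)[OF C1 R T] using p
  by (auto dest: Im_closed_segment Re_closed_segment)

text \<open>The loops at the heights \<open>y\<close> and \<open>y'\<close> differ by the boundary
  of the rectangle between them, traversed clockwise. This allows the bottom side to move while the
  curve stays as it is.\<close>

lemma winding_closed_up_change:
  fixes C :: "real \<Rightarrow> complex"
  assumes C1: "C C1_differentiable_on UNIV" and R: "\<forall>t. R \<le> \<bar>t\<bar> \<longrightarrow> C t = of_real t"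
    and T: "T \<ge> R" "T > 0" and y: "y' < y" "y < 0"
    and p: "p \<notin> range C" "\<bar>Re p\<bar> < T" "Im p > y'" "Im p \<noteq> y"
  shows "winding_number (closed_up C T y') p =
           winding_number (closed_up C T y) p - (if Im p < y then 1 else 0)"
proof -
  define f where "f = (\<lambda>w. 1 / (w - p))"
  define I where "I = (\<lambda>a b. contour_integral (linepath a b) f)"
  let ?a = "Complex (-T) y'" and ?b = "Complex T y'" and ?c = "Complex T y" and ?d = "Complex (-T) y"
  let ?r = "rectpath ?a ?c"
  have f_cont: "continuous_on A f" if "p \<notin> A" for A
    unfolding f_def using that by (intro continuous_intros) auto
  have off: "p \<notin> closed_segment ?a ?b" "p \<notin> closed_segment ?c ?d" "p \<notin> closed_segment ?d ?c"
    "p \<notin> closed_segment ?b ?a"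
    "p \<notin> closed_segment ?b ?c" "p \<notin> closed_segment ?d ?a" "p \<notin> closed_segment ?a ?d" "p \<notin> closed_segment ?c ?b"
    "p \<notin> closed_segment (of_real T) ?b" "p \<notin> closed_segment ?a (of_real (-T))"
    using p by (auto dest: Im_closed_segment Re_closed_segment)
  have rev: "I u v = - I v u" if "p \<notin> closed_segment u v" for u v
    unfolding I_def by (rule contour_integral_reverse_linepath[OF f_cont[OF that]])
  \<comment> \<open>The longer vertical side is cut at the corner of the shorter one; the piece
    between the two heights is a side of the rectangle.\<close>
  have split1: "I (of_real T) ?b = I (of_real T) ?c + I ?c ?b"
    unfolding I_def
  proof (rule contour_integral_split_linepath[OF f_cont[OF off(9)]])
    show "?c \<in> closed_segment (of_real T) ?b" using y
      by (subst closed_segment_same_Re) (auto simp: closed_segment_eq_real_ivl)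
  qed
  have split2: "I ?a (of_real (-T)) = I ?a ?d + I ?d (of_real (-T))"
    unfolding I_def
  proof (rule contour_integral_split_linepath[OF f_cont[OF off(10)]])
    show "?d \<in> closed_segment ?a (of_real (-T))" using y
      by (subst closed_segment_same_Re) (auto simp: closed_segment_eq_real_ivl)
  qed
  have wn: "winding_number (closed_up C T z) p =
      1 / (2 * pi * \<i>) * (integral {-T..T} (\<lambda>t. vector_derivative C (at t) * f (C t)) +
        I (of_real T) (Complex T z) + I (Complex T z) (Complex (-T) z) + I (Complex (-T) z) (of_real (-T)))"
    if "Im p \<noteq> z" for z
  proof -
    have np: "p \<notin> path_image (closed_up C T z)"
      by (rule closed_up_off_path[OF C1 R T p(1,2) that])
    show ?thesis
      unfolding winding_number_valid_path[OF closed_up_path(1)[OF C1 R T] np] I_def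
      using contour_integral_closed_up[OF C1 R T f_cont[OF np]] by (simp add: f_def)
  qed
  have rp: "path_image ?r = closed_segment ?a ?b \<union> closed_segment ?b ?c \<union> closed_segment ?c ?d \<union> closed_segment ?d ?a"
    by (simp add: rectpath_def Let_def path_image_join Un_assoc)
  have pr: "p \<notin> path_image ?r" unfolding rp using off by auto
  have ii: "f contour_integrable_on linepath u v" if "p \<notin> closed_segment u v" for u v
    using f_cont[OF that] by (rule contour_integrable_continuous_linepath)
  have "contour_integral ?r f = I ?a ?b + I ?b ?c + I ?c ?d + I ?d ?a"
    unfolding rectpath_def Let_def I_def
    using ii[OF off(1)] ii[OF off(5)] ii[OF off(2)] ii[OF off(6)]
    by (simp add: contour_integrable_joinI valid_path_join)
  then have wr: "winding_number ?r p = 1 / (2 * pi * \<i>) * (I ?a ?b + I ?b ?c + I ?c ?d + I ?d ?a)"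
    using winding_number_valid_path[OF _ pr] by (simp add: f_def valid_path_rectpath)
  have wr': "winding_number ?r p = (if Im p < y then 1 else 0)"
  proof (cases "Im p < y")
    case True
    then have "p \<in> box ?a ?c" using p by (auto simp: in_box_complex_iff)
    then show ?thesis using True by (simp add: winding_number_rectpath)
  next
    case False
    then have "p \<notin> cbox ?a ?c" using p by (auto simp: in_cbox_complex_iff)
    then show ?thesis using False y T by (simp add: winding_number_rectpath_outside)
  qed
  have "Im p \<noteq> y'" using p by simp
  then have "winding_number (closed_up C T y') p - winding_number (closed_up C T y) p = - winding_number ?r p"
    unfolding wn[OF \<open>Im p \<noteq> y'\<close>] wn[OF p(4)] wr split1 split2
    unfolding rev[OF off(8)] rev[OF off(7)] rev[OF off(4)] by (simp add: field_simps)
  then show ?thesis using wr' by (simp add: algebra_simps)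
qed

section \<open>Shifting contours\<close>

text \<open>The complement is open, so the connection may be taken to be a path, which is compact:
  for large \<open>T\<close> and low \<open>y\<close> it also misses the three added sides, and the
  winding number is constant along it.\<close>

lemma winding_path_invariant:
  fixes C :: "real \<Rightarrow> complex"
  assumes C1: "C C1_differentiable_on UNIV" and R: "\<forall>t. R \<le> \<bar>t\<bar> \<longrightarrow> C t = of_real t"
    and cc: "connected_component (- range C) p p'"
  obtains B where "B > 0" "\<forall>T y. T \<ge> B \<longrightarrow> y \<le> - B \<longrightarrow>
     T \<ge> R \<and> \<bar>Re p\<bar> < T \<and> \<bar>Re p'\<bar> < T \<and> Im p > y \<and> Im p' > y \<and>
     winding_number (closed_up C T y) p = winding_number (closed_up C T y) p'"
proof -
  have cont: "continuous_on UNIV C" using C1 by (rule C1_differentiable_imp_continuous_on)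
  have "open (- range C)" using closed_range_proper_curve[OF cont R] by (simp add: open_Compl)
  then have "path_component (- range C) p p'" using cc by (simp add: open_path_connected_component)
  then obtain g where g: "path g" "path_image g \<subseteq> - range C" "pathstart g = p" "pathfinish g = p'"
    unfolding path_component_def by blast
  have "bounded (path_image g)" using g(1) by (rule bounded_path_image)
  then obtain B where B: "B > 0" "\<And>z. z \<in> path_image g \<Longrightarrow> norm z \<le> B"
    unfolding bounded_pos by blast
  have pin: "p \<in> path_image g" "p' \<in> path_image g" using g by auto
  show thesis
  proof (rule that[of "max (B + 1) \<bar>R\<bar>"], use B(1) in simp, intro allI impI)
    fix T y assume T: "T \<ge> max (B + 1) \<bar>R\<bar>" and y: "y \<le> - max (B + 1) \<bar>R\<bar>"
    then have TR: "T \<ge> R" "T > 0" using B(1) by auto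
    have ext: "\<bar>Re z\<bar> < T" "Im z > y" if "z \<in> path_image g" for z
      using B(2)[OF that] abs_Re_le_cmod[of z] abs_Im_le_cmod[of z] T y by auto
    have "z \<notin> path_image (closed_up C T y)" if "z \<in> path_image g" for z
      using ext[OF that] g(2) that by (intro closed_up_off_path[OF C1 R TR]) auto
    then have "winding_number (closed_up C T y) constant_on path_image g"
      using closed_up_path(2)[OF C1 R TR]
      by (intro winding_number_constant valid_path_imp_path[OF closed_up_path(1)[OF C1 R TR]]
          connected_path_image[OF g(1)]) auto
    then have "winding_number (closed_up C T y) p = winding_number (closed_up C T y) p'"
      using pin unfolding constant_on_def by metis
    then show "T \<ge> R \<and> \<bar>Re p\<bar> < T \<and> \<bar>Re p'\<bar> < T \<and> Im p > y \<and> Im p' > y \<and>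
       winding_number (closed_up C T y) p = winding_number (closed_up C T y) p'"
      using ext pin TR by auto
  qed
qed

lemma winding_closed_up_half_plane:
  fixes C :: "real \<Rightarrow> complex"
  assumes C1: "C C1_differentiable_on UNIV" and R: "\<forall>t. R \<le> \<bar>t\<bar> \<longrightarrow> C t = of_real t"
    and T: "T \<ge> R" "T > 0" and H: "\<And>t. \<bar>Im (C t)\<bar> < H" and y: "y < 0"
  shows "Im p > H \<Longrightarrow> winding_number (closed_up C T y) p = 0"
    "Im p < -H \<Longrightarrow> y \<ge> -H \<Longrightarrow> winding_number (closed_up C T y) p = 0"
proof -
  have H0: "H > 0" using H[of 0] by linarith
  have p: "path (closed_up C T y)" using closed_up_path(1)[OF C1 R T] by (rule valid_path_imp_path)
  have seg: "closed_segment a b \<subseteq> S" if "convex S" "a \<in> S" "b \<in> S" for a b :: complex and S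
    using that by (rule closed_segment_subset[rotated 2])
  have HI: "Im (C t) \<le> H" "Im (C t) \<ge> -H" for t using H[of t] by auto
  { assume "Im p > H"
    then show "winding_number (closed_up C T y) p = 0"
    proof (intro winding_number_zero_outside[OF p convex_halfspace_Im_le[of H] closed_up_path(2)[OF C1 R T]])
      show "path_image (closed_up C T y) \<subseteq> {x. Im x \<le> H}"
        unfolding closed_up_path(3)[OF C1 R T] using HI H0 y
        by (intro Un_least seg[OF convex_halfspace_Im_le[of H]]) auto
    qed simp }
  { assume "Im p < -H" "y \<ge> -H"
    then show "winding_number (closed_up C T y) p = 0"
    proof (intro winding_number_zero_outside[OF p convex_halfspace_Im_ge[of "-H"] closed_up_path(2)[OF C1 R T]])
      show "path_image (closed_up C T y) \<subseteq> {x. Im x \<ge> -H}"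
        unfolding closed_up_path(3)[OF C1 R T] using HI H0 \<open>y \<ge> -H\<close>
        by (intro Un_least seg[OF convex_halfspace_Im_ge[of "-H"]]) auto
    qed simp }
qed

text \<open>The point is transported to a \<open>p'\<close> below the whole curve. With the bottom
  at \<open>- H\<close> the loop stays above \<open>p'\<close> and does not wind around it; lowering
  the bottom past \<open>p'\<close> yields -1, and raising it to \<open>y\<close> takes this back
  for points below \<open>y\<close>.\<close>

lemma winding_closed_up_below_curve:
  fixes C :: "real \<Rightarrow> complex"
  assumes C1: "C C1_differentiable_on UNIV" and R: "\<forall>t. R \<le> \<bar>t\<bar> \<longrightarrow> C t = of_real t"
    and y: "y < 0" and p: "p \<notin> range C" "Im p \<noteq> y"
    and low: "\<forall>H. \<exists>p'. Im p' < H \<and> p' \<notin> range C \<and> connected_component (- range C) p p'"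
  shows "\<forall>\<^sub>F T in at_top. winding_number (closed_up C T y) p = (if Im p > y then -1 else 0)"
proof -
  have cont: "continuous_on UNIV C" using C1 by (rule C1_differentiable_imp_continuous_on)
  obtain H where H: "H > 0" "\<And>t. \<bar>Im (C t)\<bar> < H" using bounded_Im_proper_curve[OF cont R] by metis
  obtain p' where p': "Im p' < -H" "p' \<notin> range C" "connected_component (- range C) p p'" using low by blast
  obtain B where B: "B > 0" "\<forall>T y. T \<ge> B \<longrightarrow> y \<le> - B \<longrightarrow>
     T \<ge> R \<and> \<bar>Re p\<bar> < T \<and> \<bar>Re p'\<bar> < T \<and> Im p > y \<and> Im p' > y \<and>
     winding_number (closed_up C T y) p = winding_number (closed_up C T y) p'"
    by (rule winding_path_invariant[OF C1 R p'(3)])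
  \<comment> \<open>Low enough for the invariance along the path, and strictly below both
    \<open>y\<close> and the auxiliary bottom at \<open>- H\<close>.\<close>
  define y' where "y' = min (-B) (min (y - 1) (- H - 1))"
  have y': "y' \<le> -B" "y' < y" "y' < -H" by (auto simp: y'_def)
  show ?thesis
    using eventually_ge_at_top[of B]
  proof eventually_elim
    case (elim T)
    note F = B(2)[rule_format, OF elim y'(1)]
    have T: "T \<ge> R" "T > 0" using F elim B(1) by auto
    have "winding_number (closed_up C T y') p' = winding_number (closed_up C T (-H)) p' - 1"
      using winding_closed_up_change[OF C1 R T y'(3) _ p'(2)] F p'(1) H(1) by simp
    moreover have "winding_number (closed_up C T (-H)) p' = 0"
      using winding_closed_up_half_plane(2)[OF C1 R T H(2) _ p'(1)] H(1) by simp
    moreover have "winding_number (closed_up C T y) p =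
        winding_number (closed_up C T y') p + (if Im p < y then 1 else 0)"
      using winding_closed_up_change[OF C1 R T y'(2) y p(1)] F p(2) by simp
    ultimately show ?case using F p(2) by auto
  qed
qed

text \<open>Transport to a point above the whole curve, which a loop in the half-plane below it
  never encloses.\<close>

lemma winding_closed_up_above_curve:
  fixes C :: "real \<Rightarrow> complex"
  assumes C1: "C C1_differentiable_on UNIV" and R: "\<forall>t. R \<le> \<bar>t\<bar> \<longrightarrow> C t = of_real t"
    and y: "y < 0" and p: "p \<notin> range C" "Im p > y"
    and high: "\<forall>H. \<exists>p'. Im p' > H \<and> connected_component (- range C) p p'"
  shows "\<forall>\<^sub>F T in at_top. winding_number (closed_up C T y) p = 0"
proof -
  have cont: "continuous_on UNIV C" using C1 by (rule C1_differentiable_imp_continuous_on)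
  obtain H where H: "H > 0" "\<And>t. \<bar>Im (C t)\<bar> < H" using bounded_Im_proper_curve[OF cont R] by metis
  obtain p' where p': "Im p' > H" "connected_component (- range C) p p'" using high by blast
  obtain B where B: "B > 0" "\<forall>T y. T \<ge> B \<longrightarrow> y \<le> - B \<longrightarrow>
     T \<ge> R \<and> \<bar>Re p\<bar> < T \<and> \<bar>Re p'\<bar> < T \<and> Im p > y \<and> Im p' > y \<and>
     winding_number (closed_up C T y) p = winding_number (closed_up C T y) p'"
    by (rule winding_path_invariant[OF C1 R p'(2)])
  define y' where "y' = min (-B) (y - 1)"
  have y': "y' \<le> -B" "y' < y" by (auto simp: y'_def)
  show ?thesis
    using eventually_ge_at_top[of B]
  proof eventually_elim
    case (elim T)
    note F = B(2)[rule_format, OF elim y'(1)]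
    have T: "T \<ge> R" "T > 0" using F elim B(1) by auto
    have "winding_number (closed_up C T y') p' = 0"
      using winding_closed_up_half_plane(1)[OF C1 R T H(2) _ p'(1)] y y' by simp
    moreover have "winding_number (closed_up C T y') p =
        winding_number (closed_up C T y) p - (if Im p < y then 1 else 0)"
      using winding_closed_up_change[OF C1 R T y'(2) y p(1)] F p(2) by simp
    ultimately show ?case using F p(2) by simp
  qed
qed

text \<open>The exponent is that of the worst admissible monomial: the weight is of order
  \<open>t powr (- 1 - n/2)\<close>, and for \<open>2 * k + 1 \<le> n\<close> the exponent
  \<open>- 1 - n/2 + k\<close> is at most -3/2.\<close>

definition decay :: "real \<Rightarrow> real" where "decay t = (1 + \<bar>t\<bar>) powr (-3/2)"

lemma decay_pos: "decay t > 0" by (simp add: decay_def add_nonneg_eq_0_iff)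

lemma decay_tendsto_0: "(decay \<longlongrightarrow> 0) at_top"
  unfolding decay_def
  by (rule tendsto_neg_powr) (auto intro!: filterlim_tendsto_add_at_top[OF tendsto_const] filterlim_abs_real)

lemma integrable_decay: "integrable lborel decay"
proof -
  let ?f = "\<lambda>x::real. indicator {0..} x *\<^sub>R (1 + x) powr (-3/2)"
  have "(\<integral>\<^sup>+x. ennreal ((1 + x) powr (-3/2)) * indicator {0::real..} x \<partial>lborel) = ennreal (0 - (-2 * (1 + 0) powr (-1/2)))"
  proof (rule nn_integral_FTC_atLeast)
    fix x :: real assume "0 \<le> x"
    then show "((\<lambda>x. -2 * (1 + x) powr (-1/2)) has_real_derivative (1 + x) powr (-3/2)) (at x)"
      by (auto intro!: derivative_eq_intros simp: powr_diff[symmetric] field_simps)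
  next
    have "((\<lambda>x::real. (1 + x) powr (-1/2)) \<longlongrightarrow> 0) at_top"
      by (rule tendsto_neg_powr) (auto intro!: filterlim_tendsto_add_at_top[OF tendsto_const] filterlim_ident)
    from tendsto_mult_right_zero[OF this, of "-2"]
    show "((\<lambda>x::real. -2 * (1 + x) powr (-1/2)) \<longlongrightarrow> 0) at_top" by simp
  qed auto
  then have i: "integrable lborel ?f"
    by (intro integrableI_nonneg)
       (auto simp: indicator_mult_ennreal mult.commute ennreal_mult_left_cong top.not_eq_extremum[symmetric]
             intro!: ennreal_less_top)
  have i2: "integrable lborel (\<lambda>x. ?f (0 + (-1) * x))" by (rule lborel_integrable_real_affine[OF i]) simp
  show ?thesis
  proof (rule Bochner_Integration.integrable_bound[OF Bochner_Integration.integrable_add[OF i i2]])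
    show "decay \<in> borel_measurable lborel" unfolding decay_def by measurable
    show "AE x in lborel. norm (decay x) \<le> norm (?f x + ?f (0 + (-1) * x))"
      by (rule AE_I2) (auto simp: decay_def indicator_def)
  qed
qed

lemma integrable_decaying:
  fixes h :: "real \<Rightarrow> complex"
  assumes h: "continuous_on UNIV h" and K: "\<And>t. T0 \<le> \<bar>t\<bar> \<Longrightarrow> norm (h t) \<le> K * decay t"
  shows "integrable lborel h"
proof -
  have "compact (h ` {-T0..T0})"
    by (intro compact_continuous_image continuous_on_subset[OF h]) auto
  then obtain B where B: "B > 0" "\<And>t. t \<in> {-T0..T0} \<Longrightarrow> norm (h t) \<le> B"
    by (metis bounded_pos compact_imp_bounded image_eqI)
  define K' where "K' = max K (B / decay T0)"
  show ?thesis
  proof (rule Bochner_Integration.integrable_bound[of _ "\<lambda>t. K' * decay t"])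
    show "integrable lborel (\<lambda>t. K' * decay t)" using integrable_decay by simp
    show "h \<in> borel_measurable lborel" using h by (simp add: borel_measurable_continuous_onI)
    have "norm (h t) \<le> norm (K' * decay t)" for t
    proof (cases "t \<in> {-T0..T0}")
      case True
      then have "decay t \<ge> decay T0" unfolding decay_def by (intro powr_mono2') auto
      then have "B \<le> B / decay T0 * decay t" using B(1) decay_pos[of T0] by (simp add: field_simps)
      also have "\<dots> \<le> K' * decay t" unfolding K'_def using decay_pos[of t] by (intro mult_right_mono) auto
      finally show ?thesis using B(2)[OF True] by simp
    next
      case False
      then have "norm (h t) \<le> K * decay t" by (intro K) auto
      also have "\<dots> \<le> K' * decay t" unfolding K'_def using decay_pos[of t] by (intro mult_right_mono) auto
      finally show ?thesis by simp
    qed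
    then show "AE t in lborel. norm (h t) \<le> norm (K' * decay t)" by simp
  qed
qed

text \<open>The residue theorem yields symmetric truncations; absolute integrability identifies
  their limit with the Lebesgue integral.\<close>

lemma integral_symmetric_tendsto:
  fixes h :: "real \<Rightarrow> complex"
  assumes h: "integrable lborel h"
  shows "((\<lambda>T. integral {-T..T} h) \<longlongrightarrow> (LINT t|lborel. h t)) at_top"
proof -
  have m: "h \<in> borel_measurable lborel" using h by simp
  have "((\<lambda>T. LINT t|lborel. indicator {-T..T} t *\<^sub>R h t) \<longlongrightarrow> (LINT t|lborel. h t)) at_top"
  proof (rule integral_dominated_convergence_at_top)
    show "integrable lborel (\<lambda>t. norm (h t))" using h by simp
    show "AE x in lborel. ((\<lambda>i. indicator {- i..i} x *\<^sub>R h x) \<longlongrightarrow> h x) at_top"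
    proof (rule AE_I2)
      fix x :: real
      show "((\<lambda>i. indicator {- i..i} x *\<^sub>R h x) \<longlongrightarrow> h x) at_top"
        using eventually_ge_at_top[of "\<bar>x\<bar>"]
        by (intro tendsto_eventually, elim eventually_mono) (auto simp: indicator_def)
    qed
    show "\<forall>\<^sub>F i in at_top. AE x in lborel. norm (indicator {- i..i} x *\<^sub>R h x) \<le> norm (h x)"
      by (intro always_eventually allI AE_I2) (auto simp: indicator_def)
  qed (use m in measurable)
  moreover have "(LINT t|lborel. indicator {-T..T} t *\<^sub>R h t) = integral {-T..T} h" for T :: real
  proof -
    have "set_integrable lborel {-T..T} h"
      unfolding set_integrable_def using h by (intro integrable_mult_indicator) auto
    then show ?thesis using set_borel_integral_eq_integral(2) by (simp add: set_lebesgue_integral_def)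
  qed
  ultimately show ?thesis by simp
qed

text \<open>The residue theorem is applied in a strip to the curve closed up at height
  \<open>y\<close>. Only finitely many singularities lie in the strip, so for large \<open>T\<close>
  all of them have their final winding numbers: -1 for points of \<open>L\<close> above
  \<open>y\<close>, and 0 otherwise. The vertical sides contribute at most a multiple of
  \<open>decay T\<close>.\<close>

lemma contour_shift:
  fixes C :: "real \<Rightarrow> complex" and f :: "complex \<Rightarrow> complex" and L U :: "complex set"
  assumes C1: "C C1_differentiable_on UNIV" and inj: "inj C"
    and R: "\<forall>t. R \<le> \<bar>t\<bar> \<longrightarrow> C t = of_real t" and sep: "separates C L U"
    and low: "\<And>H. \<exists>p\<in>L. Im p < H" and high: "\<And>H. \<exists>p\<in>U. Im p > H"
    and fin: "\<And>H. finite {p \<in> L \<union> U. \<bar>Im p\<bar> < H}" and bdd: "\<And>p. p \<in> L \<Longrightarrow> Im p \<le> HL"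
    and y: "y < 0" "\<And>p. p \<in> U \<Longrightarrow> Im p > y" "\<And>p. p \<in> L \<Longrightarrow> Im p \<noteq> y"
    and holo: "f holomorphic_on - (L \<union> U)"
    and K: "\<And>\<alpha>. \<bar>Im \<alpha>\<bar> \<le> - y \<Longrightarrow> T0 \<le> \<bar>Re \<alpha>\<bar> \<Longrightarrow> norm (f \<alpha>) \<le> K * decay (Re \<alpha>)"
  shows "integrable lborel (\<lambda>t. vector_derivative C (at t) * f (C t))"
    "integrable lborel (\<lambda>t. f (Complex t y))"
    "(LINT t|lborel. vector_derivative C (at t) * f (C t)) =
       (LINT t|lborel. f (Complex t y)) - 2 * pi * \<i> * (\<Sum>p\<in>{p \<in> L. Im p > y}. residue f p)"
proof -
  let ?h = "\<lambda>t. vector_derivative C (at t) * f (C t)" and ?l = "\<lambda>t. f (Complex t y)"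
  have cont: "continuous_on UNIV C" using C1 by (rule C1_differentiable_imp_continuous_on)
  have off: "p \<notin> range C" if "p \<in> L \<union> U" for p using sep that unfolding separates_def by blast
  have f_cont: "continuous_on A f" if "A \<inter> (L \<union> U) = {}" for A
    using holomorphic_on_imp_continuous_on[OF holo] by (rule continuous_on_subset) (use that in blast)
  have line_off: "Complex t y \<notin> L \<union> U" for t using y(2,3)[of "Complex t y"] by auto
  have h_cont: "continuous_on UNIV ?h"
  proof (rule continuous_on_mult)
    show "continuous_on UNIV (\<lambda>t. vector_derivative C (at t))" using C1 by (simp add: C1_differentiable_on_eq)
    show "continuous_on UNIV (\<lambda>t. f (C t))"
      using f_cont[of "range C"] off by (intro continuous_on_compose2[OF _ cont]) auto
  qed
  have line_cont: "continuous_on UNIV (\<lambda>t. Complex t y)" by (intro continuous_intros)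
  have l_cont: "continuous_on UNIV ?l"
    using f_cont[of "range (\<lambda>t. Complex t y)"] line_off
    by (intro continuous_on_compose2[OF _ line_cont]) auto
  have tail: "?h t = f (of_real t)" if "\<bar>R\<bar> + 1 \<le> \<bar>t\<bar>" for t
  proof -
    have "((\<lambda>t. of_real t) has_vector_derivative (1::complex)) (at t)"
      by (auto intro!: derivative_eq_intros)
    then have "(C has_vector_derivative 1) (at t)"
    proof (rule has_vector_derivative_transform_within_open)
      show "open {t. \<bar>R\<bar> < \<bar>t\<bar>}" by (intro open_Collect_less continuous_intros)
    qed (use that R in auto)
    then have "vector_derivative C (at t) = 1" by (rule vector_derivative_at)
    then show ?thesis using R that by simp
  qed
  show int_h: "integrable lborel ?h"
  proof (rule integrable_decaying[OF h_cont])
    fix t :: real assume "max T0 (\<bar>R\<bar> + 1) \<le> \<bar>t\<bar>"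
    then show "norm (?h t) \<le> K * decay t" using tail[of t] K[of "of_real t"] y(1) by simp
  qed
  show int_l: "integrable lborel ?l"
  proof (rule integrable_decaying[OF l_cont])
    fix t :: real assume "T0 \<le> \<bar>t\<bar>"
    then show "norm (?l t) \<le> K * decay t" using K[of "Complex t y"] y(1) by simp
  qed
  obtain H where H: "H > 0" "\<And>t. \<bar>Im (C t)\<bar> < H" using bounded_Im_proper_curve[OF cont R] by metis
  \<comment> \<open>The strip must contain the curve, the line at height \<open>y\<close> and,
    through \<open>HL\<close>, every point of \<open>L\<close> above that line; the added 1 makes
    the inclusions strict.\<close>
  define Y where "Y = max H (max (- y) (max HL 0)) + 1"
  define S where "S = {z. \<bar>Im z\<bar> < Y}"
  define pts where "pts = {p \<in> L \<union> U. \<bar>Im p\<bar> < Y}"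
  have S_alt: "S = {z. Im z < Y} \<inter> {z. Im z > - Y}" by (auto simp: S_def)
  have convS: "convex S" unfolding S_alt by (intro convex_Int convex_halfspace_Im_lt convex_halfspace_Im_gt)
  have openS: "open S" unfolding S_alt by (intro open_Int open_halfspace_Im_lt open_halfspace_Im_gt)
  have fin_pts: "finite pts" unfolding pts_def by (rule fin)
  define wn where "wn = (\<lambda>p. if p \<in> L \<and> Im p > y then - 1 else 0 :: complex)"
  have sep': "\<not> connected_component (- range C) p q" "\<not> connected_component (- range C) q p"
    if "p \<in> L" "q \<in> U" for p q
    using sep that connected_component_sym unfolding separates_def by blast+
  have LU: "L \<inter> U = {}"
    using sep' off connected_component_refl by (metis ComplI Un_iff disjoint_iff)
  note two = complement_two_components[OF cont R inj]
  have wL: "\<forall>\<^sub>F T in at_top. winding_number (closed_up C T y) p = wn p" if p: "p \<in> L" for p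
  proof -
    \<comment> \<open>All points of \<open>L\<close> are cut off from \<open>q\<close>. Since there
      are at most two components, they are connected with each other, and \<open>L\<close> reaches
      arbitrarily far down.\<close>
    obtain q where q: "q \<in> U" using high by blast
    have "\<forall>H. \<exists>p'. Im p' < H \<and> p' \<notin> range C \<and> connected_component (- range C) p p'"
    proof
      fix H
      obtain p' where p': "p' \<in> L" "Im p' < H" using low by blast
      have "connected_component (- range C) p p'"
        by (rule two[of q]) (use off sep' p p' q in auto)
      then show "\<exists>p'. Im p' < H \<and> p' \<notin> range C \<and> connected_component (- range C) p p'"
        using p' off by blast
    qed
    from winding_closed_up_below_curve[OF C1 R y(1) off y(3)[OF p] this]
    show ?thesis using p by (simp add: wn_def)
  qed
  have wU: "\<forall>\<^sub>F T in at_top. winding_number (closed_up C T y) p = wn p" if p: "p \<in> U" for p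
  proof -
    obtain q where q: "q \<in> L" using low by blast
    have "\<forall>H. \<exists>p'. Im p' > H \<and> connected_component (- range C) p p'"
    proof
      fix H
      obtain p' where p': "p' \<in> U" "Im p' > H" using high by blast
      have "connected_component (- range C) p p'"
        by (rule two[of q]) (use off sep' p p' q in auto)
      then show "\<exists>p'. Im p' > H \<and> connected_component (- range C) p p'" using p' by blast
    qed
    from winding_closed_up_above_curve[OF C1 R y(1) off y(2)[OF p] this]
    show ?thesis using p LU by (auto simp: wn_def)
  qed
  have ev_wn: "\<forall>\<^sub>F T in at_top. \<forall>p\<in>pts. winding_number (closed_up C T y) p = wn p"
    by (rule eventually_ball_finite[OF fin_pts]) (use wL wU in \<open>auto simp: pts_def\<close>)
  have ev_re: "\<forall>\<^sub>F T in at_top. \<forall>p\<in>pts. \<bar>Re p\<bar> < T"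
    by (rule eventually_ball_finite[OF fin_pts]) (auto intro: eventually_gt_at_top)
  let ?V1 = "\<lambda>T. contour_integral (linepath (of_real T) (Complex T y)) f"
  let ?V2 = "\<lambda>T. contour_integral (linepath (Complex (-T) y) (of_real (-T))) f"
  have main: "\<forall>\<^sub>F T in at_top. integral {-T..T} ?h - integral {-T..T} ?l + (?V1 T + ?V2 T) =
      2 * pi * \<i> * (\<Sum>p\<in>pts. wn p * residue f p) \<and>
      norm (?V1 T + ?V2 T) \<le> 2 * \<bar>K\<bar> * \<bar>y\<bar> * decay T"
    using ev_wn ev_re eventually_ge_at_top[of "max 1 (max T0 R)"]
  proof eventually_elim
    case (elim T)
    have T: "T \<ge> R" "T > 0" "T \<ge> T0" using elim by auto
    let ?g = "closed_up C T y"
    note P = closed_up_path[OF C1 R T(1,2)]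
    have verts: "\<bar>Re z\<bar> = T" "\<bar>Im z\<bar> \<le> - y"
      if "z \<in> closed_segment (of_real T) (Complex T y) \<union> closed_segment (Complex (-T) y) (of_real (-T))" for z
    proof -
      show "\<bar>Re z\<bar> = T" using that T by (auto dest: Re_closed_segment)
      have "closed_segment a b \<subseteq> {z. Im z \<le> 0} \<inter> {z. Im z \<ge> y}"
        if "a \<in> {z. Im z \<le> 0} \<inter> {z. Im z \<ge> y}" "b \<in> {z. Im z \<le> 0} \<inter> {z. Im z \<ge> y}" for a b
        using that by (rule closed_segment_subset)
          (intro convex_Int convex_halfspace_Im_le convex_halfspace_Im_ge)
      from this[of "of_real T" "Complex T y"] this[of "Complex (-T) y" "of_real (-T)"]
      show "\<bar>Im z\<bar> \<le> - y" using that y(1) by (auto simp: subset_iff)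
    qed
    have hor: "Im z = y" if "z \<in> closed_segment (Complex T y) (Complex (-T) y)" for z
      using Im_closed_segment[OF that] by simp
    have g_sub: "path_image ?g \<subseteq> S - pts"
    proof
      fix z assume z: "z \<in> path_image ?g"
      consider (curve) t where "z = C t"
        | (vert) "z \<in> closed_segment (of_real T) (Complex T y) \<union> closed_segment (Complex (-T) y) (of_real (-T))"
        | (hor) "z \<in> closed_segment (Complex T y) (Complex (-T) y)"
        using z unfolding P(3) by blast
      then have "z \<in> S"
      proof cases
        case curve
        then show ?thesis using H(2)[of t] by (simp add: S_def Y_def)
      next
        case vert
        from verts(2)[OF vert] show ?thesis by (simp add: S_def Y_def)
      next
        case hor
        from Im_closed_segment[OF hor] show ?thesis using y(1) by (simp add: S_def Y_def)
      qed
      moreover have "z \<notin> pts"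
      proof
        assume zp: "z \<in> pts"
        then have "z \<in> L \<union> U" "\<bar>Re z\<bar> < T" using elim by (auto simp: pts_def)
        then have "z \<notin> range C" "Im z \<noteq> y" using off y(2,3) by force+
        then show False using closed_up_off_path[OF C1 R T(1,2) _ \<open>\<bar>Re z\<bar> < T\<close>] z by blast
      qed
      ultimately show "z \<in> S - pts" by blast
    qed
    have gLU: "path_image ?g \<inter> (L \<union> U) = {}" using g_sub by (auto simp: pts_def S_def)
    have "contour_integral ?g f = 2 * pi * \<i> * (\<Sum>p\<in>pts. winding_number ?g p * residue f p)"
    proof (rule Residue_theorem[OF openS convex_connected[OF convS] fin_pts _ P(1,2) g_sub])
      show "f holomorphic_on S - pts"
        using holo by (rule holomorphic_on_subset) (auto simp: pts_def S_def)
      show "\<forall>z. z \<notin> S \<longrightarrow> winding_number ?g z = 0"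
        using g_sub P(1,2) convS by (intro allI impI winding_number_zero_outside[of _ S])
          (auto intro: valid_path_imp_path)
    qed
    also have "(\<Sum>p\<in>pts. winding_number ?g p * residue f p) = (\<Sum>p\<in>pts. wn p * residue f p)"
      using elim by (intro sum.cong) auto
    finally have res: "contour_integral ?g f = 2 * pi * \<i> * (\<Sum>p\<in>pts. wn p * residue f p)" .
    have bottom: "contour_integral (linepath (Complex T y) (Complex (-T) y)) f = - integral {-T..T} ?l"
    proof -
      have C1l: "(\<lambda>t. Complex t y) C1_differentiable_on UNIV"
        unfolding C1_differentiable_on_def
        by (intro exI[of _ "\<lambda>_. 1"]) (auto simp: Complex_eq intro!: derivative_eq_intros)
      have vd: "vector_derivative (\<lambda>t. Complex t y) (at t) = 1" for t
        by (rule vector_derivative_at) (auto simp: Complex_eq intro!: derivative_eq_intros)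
      have "continuous_on ((\<lambda>t. Complex t y) ` {-T..T}) f" by (rule f_cont) (use line_off in auto)
      from contour_integral_affine_curve(1)[OF C1l T(2) this]
      have "contour_integral (\<lambda>s. Complex (2 * T * s - T) y) f = integral {-T..T} ?l" by (simp add: vd)
      moreover have "(\<lambda>s. Complex (2 * T * s - T) y) = linepath (Complex (-T) y) (Complex T y)"
        by (auto simp: linepath_def complex_eq_iff algebra_simps)
      moreover have "contour_integral (linepath (Complex T y) (Complex (-T) y)) f =
          - contour_integral (linepath (Complex (-T) y) (Complex T y)) f"
        by (rule contour_integral_reverse_linepath[OF f_cont]) (use gLU P(3) in blast)
      ultimately show ?thesis by simp
    qed
    have vb: "norm (contour_integral (linepath a b) f) \<le> \<bar>K\<bar> * decay T * \<bar>y\<bar>"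
      if ab: "closed_segment a b \<subseteq> closed_segment (of_real T) (Complex T y) \<union> closed_segment (Complex (-T) y) (of_real (-T))"
        "norm (b - a) = \<bar>y\<bar>" for a b
    proof -
      have "f contour_integrable_on linepath a b"
        by (rule contour_integrable_continuous_linepath, rule f_cont) (use ab gLU P(3) in blast)
      moreover have "norm (f z) \<le> \<bar>K\<bar> * decay T" if "z \<in> closed_segment a b" for z
      proof -
        note v = verts[of z]
        have "norm (f z) \<le> K * decay (Re z)" using v that ab(1) T(3) by (intro K) auto
        also have "decay (Re z) = decay T" using v(1) that ab(1) T(2) by (auto simp: decay_def)
        also have "K * decay T \<le> \<bar>K\<bar> * decay T" using decay_pos[of T] by (intro mult_right_mono) auto
        finally show ?thesis .
      qed
      ultimately have "norm (contour_integral (linepath a b) f) \<le> \<bar>K\<bar> * decay T * norm (b - a)"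
        using decay_pos[of T] by (intro contour_integral_bound_linepath) auto
      then show ?thesis using ab(2) by simp
    qed
    have "norm (?V1 T) \<le> \<bar>K\<bar> * decay T * \<bar>y\<bar>" "norm (?V2 T) \<le> \<bar>K\<bar> * decay T * \<bar>y\<bar>"
      by (rule vb; simp add: cmod_def)+
    then have "norm (?V1 T + ?V2 T) \<le> 2 * \<bar>K\<bar> * \<bar>y\<bar> * decay T"
      using norm_triangle_ineq[of "?V1 T" "?V2 T"] by (simp add: mult_ac)
    moreover have "integral {-T..T} ?h - integral {-T..T} ?l + (?V1 T + ?V2 T) =
      2 * pi * \<i> * (\<Sum>p\<in>pts. wn p * residue f p)"
      using contour_integral_closed_up[OF C1 R T(1,2) f_cont[OF gLU]] unfolding res bottom by simp
    ultimately show ?case by blast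
  qed
  have V0: "((\<lambda>T. ?V1 T + ?V2 T) \<longlongrightarrow> 0) at_top"
  proof (rule Lim_null_comparison)
    show "\<forall>\<^sub>F T in at_top. norm (?V1 T + ?V2 T) \<le> 2 * \<bar>K\<bar> * \<bar>y\<bar> * decay T"
      using main by eventually_elim blast
    show "((\<lambda>T. 2 * \<bar>K\<bar> * \<bar>y\<bar> * decay T) \<longlongrightarrow> 0) at_top"
      using tendsto_mult_right_zero[OF decay_tendsto_0] .
  qed
  have lim: "((\<lambda>T. integral {-T..T} ?h - integral {-T..T} ?l + (?V1 T + ?V2 T)) \<longlongrightarrow>
      (LINT t|lborel. ?h t) - (LINT t|lborel. ?l t) + 0) at_top"
    by (intro tendsto_intros integral_symmetric_tendsto int_h int_l V0)
  have "((\<lambda>T. integral {-T..T} ?h - integral {-T..T} ?l + (?V1 T + ?V2 T)) \<longlongrightarrow>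
      2 * pi * \<i> * (\<Sum>p\<in>pts. wn p * residue f p)) at_top"
    by (rule tendsto_eventually) (use main in eventually_elim, blast)
  from tendsto_unique[OF _ lim this]
  have "(LINT t|lborel. ?h t) - (LINT t|lborel. ?l t) = 2 * pi * \<i> * (\<Sum>p\<in>pts. wn p * residue f p)" by simp
  also have "(\<Sum>p\<in>pts. wn p * residue f p) = (\<Sum>p\<in>{p \<in> L. Im p > y}. - residue f p)"
  proof (rule sum.mono_neutral_cong_right[OF fin_pts])
    show "{p \<in> L. Im p > y} \<subseteq> pts"
      using bdd by (auto simp: pts_def Y_def abs_less_iff) (smt (verit))+
  qed (auto simp: wn_def)
  finally show "(LINT t|lborel. ?h t) =
       (LINT t|lborel. ?l t) - 2 * pi * \<i> * (\<Sum>p\<in>{p \<in> L. Im p > y}. residue f p)"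
    by (simp add: sum_negf algebra_simps)
qed

section \<open>Bounds for quotients of Gamma functions\<close>

text \<open>In this double cone all translates \<open>z + k\<close> stay away from 0 at a rate
  linear in \<open>k\<close>, even when \<open>Re z\<close> is negative. This makes the product for
  the Gamma quotient converge uniformly.\<close>

lemma norm_square_lower_bound_shift:
  fixes z :: complex
  assumes "\<bar>Im z\<bar> \<ge> \<bar>Re z\<bar> + 2"
  shows "(norm (z + of_nat k))\<^sup>2 \<ge> (real k + 1)\<^sup>2 / 4" "norm (z + of_nat k) \<ge> 2"
proof -
  let ?x = "Re z" and ?k = "real k"
  have n2: "(norm (z + of_nat k))\<^sup>2 = (?x + ?k)\<^sup>2 + (Im z)\<^sup>2" by (simp add: cmod_power2)
  have "(Im z)\<^sup>2 \<ge> (\<bar>?x\<bar> + 2)\<^sup>2" using assms by (metis abs_ge_zero add_nonneg_nonneg abs_le_square_iff abs_of_nonneg zero_le_numeral)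
  moreover have "(\<bar>?x\<bar> + 2)\<^sup>2 = ?x\<^sup>2 + 4 * \<bar>?x\<bar> + 4" by (simp add: power2_eq_square algebra_simps)
  ultimately have im: "(Im z)\<^sup>2 \<ge> ?x\<^sup>2 + 4" by simp
  \<comment> \<open>Twice the sum of the squares of \<open>x + k\<close> and \<open>x\<close> is the
    square of \<open>2 x + k\<close> plus the square of \<open>k\<close>; the second inequality
    compares the squares of \<open>k\<close> and \<open>k + 1\<close>.\<close>
  have "(2 * ?x + ?k)\<^sup>2 \<ge> 0" "(?k - 1)\<^sup>2 \<ge> 0" by simp_all
  then show "(norm (z + of_nat k))\<^sup>2 \<ge> (?k + 1)\<^sup>2 / 4"
    unfolding n2 using im by (simp add: power2_eq_square algebra_simps)
  have "(norm (z + of_nat k))\<^sup>2 \<ge> 4"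
    unfolding n2 using im zero_le_power2[of "?x + ?k"] zero_le_power2[of ?x] by linarith
  then have "(norm (z + of_nat k))\<^sup>2 \<ge> 2\<^sup>2" by simp
  then show "norm (z + of_nat k) \<ge> 2" by (rule power2_le_imp_le) simp
qed

text \<open>The upper bound comes from \<open>1 + s \<le> exp s\<close>. For the lower one,
  \<open>(1 - s) * (1 + 2 * s) \<ge> 1\<close> for \<open>s\<close> between 0 and 1/2 gives
  \<open>1 - s \<ge> 1 / (1 + 2 * s) \<ge> exp (- 2 * s)\<close>.\<close>

lemma prod_one_plus_small_bounds:
  fixes \<epsilon> :: "nat \<Rightarrow> complex" and s :: "nat \<Rightarrow> real"
  assumes "\<And>k. norm (\<epsilon> k) \<le> s k" "\<And>k. s k \<le> 1/2" "\<And>N. (\<Sum>k\<le>N. s k) \<le> S"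
  shows "norm (\<Prod>k\<le>N. 1 + \<epsilon> k) \<le> exp S" "norm (\<Prod>k\<le>N. 1 + \<epsilon> k) \<ge> exp (- 2 * S)"
proof -
  have s0: "s k \<ge> 0" for k using assms(1)[of k] norm_ge_zero[of "\<epsilon> k"] by linarith
  have "norm (\<Prod>k\<le>N. 1 + \<epsilon> k) \<le> (\<Prod>k\<le>N. exp (s k))"
    unfolding prod_norm[symmetric]
  proof (rule prod_mono, intro conjI)
    fix k
    have "norm (1 + \<epsilon> k) \<le> 1 + s k" using norm_triangle_ineq[of 1 "\<epsilon> k"] assms(1)[of k] by simp
    then show "norm (1 + \<epsilon> k) \<le> exp (s k)" using exp_ge_add_one_self[of "s k"] by linarith
  qed simp
  also have "\<dots> = exp (\<Sum>k\<le>N. s k)" by (simp add: exp_sum)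
  also have "\<dots> \<le> exp S" using assms(3) by simp
  finally show "norm (\<Prod>k\<le>N. 1 + \<epsilon> k) \<le> exp S" .
  have "exp (- 2 * S) \<le> exp (\<Sum>k\<le>N. - 2 * s k)"
    using assms(3)[of N] by (simp add: sum_distrib_left[symmetric] sum_negf)
  also have "\<dots> = (\<Prod>k\<le>N. exp (- 2 * s k))" by (simp add: exp_sum)
  also have "\<dots> \<le> norm (\<Prod>k\<le>N. 1 + \<epsilon> k)"
    unfolding prod_norm[symmetric]
  proof (rule prod_mono, intro conjI)
    fix k
    have "exp (2 * s k) \<ge> 1 + 2 * s k" using exp_ge_add_one_self[of "2 * s k"] by simp
    then have "exp (- 2 * s k) \<le> 1 / (1 + 2 * s k)"
      using s0[of k] by (simp add: exp_minus divide_simps)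
    also have "1 / (1 + 2 * s k) \<le> 1 - s k"
    proof -
      have "s k * s k \<le> s k * (1/2)" using s0[of k] assms(2)[of k] by (intro mult_left_mono) auto
      then have "1 \<le> (1 - s k) * (1 + 2 * s k)" by (simp add: algebra_simps)
      then show ?thesis using s0[of k] by (simp add: field_simps)
    qed
    also have "1 - s k \<le> norm (1 + \<epsilon> k)"
      using norm_diff_ineq[of 1 "\<epsilon> k"] assms(1)[of k] by simp
    finally show "exp (- 2 * s k) \<le> norm (1 + \<epsilon> k)" .
  qed simp
  finally show "norm (\<Prod>k\<le>N. 1 + \<epsilon> k) \<ge> exp (- 2 * S)" .
qed

lemma sum_inverse_squares_le: "(\<Sum>k\<le>N. 1 / (real k + 1)\<^sup>2) \<le> 2 - 1 / (real N + 1)"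
proof (induction N)
  case (Suc N)
  have "1 / (real (Suc N) + 1)\<^sup>2 \<le> 1 / (real N + 1) - 1 / (real (Suc N) + 1)"
    by (simp add: divide_simps power2_eq_square)
  then show ?case using Suc by simp
qed simp

text \<open>With \<open>w = z + k\<close>, the factor \<open>w\<^sup>3 / ((w - 1/2)\<^sup>2 (w + 1))\<close> of the infinite product for
  \<open>z \<Gamma>(z - 1/2)\<^sup>2 / \<Gamma>(z)\<^sup>2\<close> is the inverse of \<open>1 - 3/(4 w\<^sup>2) + 1/(4 w\<^sup>3)\<close>.\<close>

lemma Gamma_half_quotient_LIMSEQ:
  fixes z :: complex
  assumes z: "\<bar>Im z\<bar> \<ge> \<bar>Re z\<bar> + 2"
  shows "(\<lambda>N. norm (z + of_nat N + 1) / real N * norm (inverse (\<Prod>k\<le>N. 1 + (1 / (4 * (z + of_nat k) ^ 3) - 3 / (4 * (z + of_nat k)\<^sup>2)))))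
     \<longlonglongrightarrow> norm z * (norm (Gamma (z - 1/2) / Gamma z))\<^sup>2"
proof -
  have w0: "z + of_nat k \<noteq> 0" for k using norm_square_lower_bound_shift(2)[OF z, of k] by auto
  have w1: "z - 1/2 + of_nat k \<noteq> 0" for k
  proof
    assume "z - 1/2 + of_nat k = 0"
    then have "Im (z - 1/2 + of_nat k) = 0" by simp
    then show False using z by simp
  qed
  have nz: "z \<notin> \<int>\<^sub>\<le>\<^sub>0"
    using z by (auto elim!: nonpos_Ints_cases)
  have G0: "Gamma z \<noteq> 0" using nz by (simp add: Gamma_eq_zero_iff)
  have "(\<lambda>N. norm z * (norm (Gamma_series (z - 1/2) N / Gamma_series z N))\<^sup>2)
     \<longlonglongrightarrow> norm z * (norm (Gamma (z - 1/2) / Gamma z))\<^sup>2"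
    using G0 by (intro tendsto_intros)
  moreover have "\<forall>\<^sub>F N in sequentially. norm z * (norm (Gamma_series (z - 1/2) N / Gamma_series z N))\<^sup>2 =
     norm (z + of_nat N + 1) / real N * norm (inverse (\<Prod>k\<le>N. 1 + (1 / (4 * (z + of_nat k) ^ 3) - 3 / (4 * (z + of_nat k)\<^sup>2))))"
    using eventually_gt_at_top[of 0]
  proof eventually_elim
    case (elim N)
    let ?w = "\<lambda>k. z + of_nat k"
    have poch: "pochhammer x (N + 1) = (\<Prod>k\<le>N. x + of_nat k)" for x :: complex
      by (simp add: pochhammer_prod atLeast0AtMost[symmetric] atLeastLessThanSuc_atLeastAtMost)
    have e: "exp ((z - 1/2) * of_real (ln (real N))) / exp (z * of_real (ln (real N))) = exp (- (of_real (ln (real N)) / 2))"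
      by (simp add: exp_diff[symmetric] algebra_simps)
    have ne: "norm (exp (- (complex_of_real (ln (real N)) / 2))) ^ 2 = 1 / real N"
    proof -
      have "norm (exp (- (complex_of_real (ln (real N)) / 2))) ^ 2 = exp (- (ln (real N) / 2)) ^ 2"
        by (simp add: norm_exp_eq_Re)
      also have "\<dots> = exp (- ln (real N))" by (simp add: power2_eq_square exp_add[symmetric])
      finally show ?thesis using elim by (simp add: exp_minus field_simps)
    qed
    have q: "Gamma_series (z - 1/2) N / Gamma_series z N =
        exp (- (of_real (ln (real N)) / 2)) * (\<Prod>k\<le>N. ?w k / (?w k - 1/2))"
    proof -
      have "(c * x / p) / (c * y / p') = x / y * (p' / p)" if "c \<noteq> 0" for c x y p p' :: complex
        using that by simp
      moreover have "(\<Prod>k\<le>N. z - 1/2 + of_nat k) = (\<Prod>k\<le>N. ?w k - 1/2)"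
        by (simp add: algebra_simps)
      ultimately show ?thesis
        unfolding Gamma_series_def poch e[symmetric] prod_dividef by simp
    qed
    \<comment> \<open>The product of the squares of \<open>w / (w - 1/2)\<close> alone grows like
      \<open>N\<close>. The telescoping factors \<open>w / (w + 1)\<close> compensate this
      growth.\<close>
    have tele: "(\<Prod>k\<le>N. ?w k / ?w (Suc k)) = z / (z + of_nat N + 1)"
    proof (induction N)
      case (Suc N)
      then show ?case using w0[of "Suc N"] by (simp add: add_ac)
    qed (simp add: add_ac)
    have "(norm (\<Prod>k\<le>N. ?w k / (?w k - 1/2)))\<^sup>2 * norm (\<Prod>k\<le>N. ?w k / ?w (Suc k)) =
        norm (\<Prod>k\<le>N. (?w k / (?w k - 1/2))\<^sup>2 * (?w k / ?w (Suc k)))"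
      by (simp only: prod.distrib norm_mult norm_power prod_power_distrib[symmetric])
    also have "(\<Prod>k\<le>N. (?w k / (?w k - 1/2))\<^sup>2 * (?w k / ?w (Suc k))) =
        (\<Prod>k\<le>N. inverse (1 + (1 / (4 * ?w k ^ 3) - 3 / (4 * (?w k)\<^sup>2))))"
    proof (rule prod.cong[OF refl])
      fix k
      define w where "w = ?w k"
      have w: "w \<noteq> 0" "w - 1/2 \<noteq> 0" "w + 1 \<noteq> 0" "?w (Suc k) = w + 1"
        using w0[of k] w1[of k] w0[of "Suc k"] by (auto simp: w_def algebra_simps)
      have "1 + (1 / (4 * w ^ 3) - 3 / (4 * w\<^sup>2)) = ((w - 1/2)\<^sup>2 * (w + 1)) / w ^ 3"
        using w(1) by (simp add: field_simps power2_eq_square power3_eq_cube)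
      then show "(?w k / (?w k - 1/2))\<^sup>2 * (?w k / ?w (Suc k)) = inverse (1 + (1 / (4 * ?w k ^ 3) - 3 / (4 * (?w k)\<^sup>2)))"
        unfolding w(4) w_def[symmetric] by (simp add: power2_eq_square power3_eq_cube)
    qed
    also have "\<dots> = inverse (\<Prod>k\<le>N. 1 + (1 / (4 * ?w k ^ 3) - 3 / (4 * (?w k)\<^sup>2)))"
      by (rule prod_inversef[unfolded comp_def])
    finally have main: "(norm (\<Prod>k\<le>N. ?w k / (?w k - 1/2)))\<^sup>2 * norm (z / (z + of_nat N + 1)) =
        norm (inverse (\<Prod>k\<le>N. 1 + (1 / (4 * ?w k ^ 3) - 3 / (4 * (?w k)\<^sup>2))))"
      unfolding tele .
    have "z + of_nat N + 1 \<noteq> 0" using w0[of "Suc N"] by (simp add: algebra_simps)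
    then show ?case
      unfolding q norm_mult power_mult_distrib ne main[symmetric] norm_divide
      by (simp add: field_simps)
  qed
  ultimately show ?thesis by (rule Lim_transform_eventually)
qed

text \<open>The deviations of the factors from 1 sum to at most \<open>4 * 2 = 8\<close>, so the
  product lies between \<open>exp (- 16)\<close> and \<open>exp 8\<close>. It enters through its
  inverse, which lies between these two constants.\<close>

definition Gamma_quot_lower :: real where "Gamma_quot_lower = exp (- 8)"
definition Gamma_quot_upper :: real where "Gamma_quot_upper = exp 16"

text \<open>The quotient thus decays exactly like the inverse square root of \<open>norm z\<close>.
  The upper bound serves the convergence of the integrals, the lower bound their divergence when the
  degree is too high.\<close>

lemma Gamma_half_quotient_bounds:
  fixes z :: complex
  assumes z: "\<bar>Im z\<bar> \<ge> \<bar>Re z\<bar> + 2"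
  shows "norm z * (norm (Gamma (z - 1/2) / Gamma z))\<^sup>2 \<ge> Gamma_quot_lower"
    "norm z * (norm (Gamma (z - 1/2) / Gamma z))\<^sup>2 \<le> Gamma_quot_upper"
proof -
  let ?e = "\<lambda>k. 1 / (4 * (z + of_nat k) ^ 3) - 3 / (4 * (z + of_nat k)\<^sup>2)"
  let ?s = "\<lambda>k. 1 / (norm (z + of_nat k))\<^sup>2"
  have b1: "norm (?e k) \<le> ?s k" and b2: "?s k \<le> 1 / 2" and b3: "?s k \<le> 4 * (1 / (real k + 1)\<^sup>2)" for k
  proof -
    let ?r = "norm (z + of_nat k)"
    have r: "?r \<ge> 2" "?r\<^sup>2 \<ge> (real k + 1)\<^sup>2 / 4" using norm_square_lower_bound_shift[OF z] by auto
    have "norm (?e k) \<le> norm (1 / (4 * (z + of_nat k) ^ 3)) + norm (3 / (4 * (z + of_nat k)\<^sup>2))"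
      by (rule norm_triangle_ineq4)
    also have "\<dots> = 1 / (4 * ?r ^ 3) + 3 / (4 * ?r\<^sup>2)" by (simp add: norm_divide norm_mult norm_power)
    also have "1 / (4 * ?r ^ 3) \<le> 1 / (4 * ?r\<^sup>2)"
      using r(1) by (intro divide_left_mono mult_left_mono power_increasing) auto
    finally show "norm (?e k) \<le> ?s k" by simp
    have "?r\<^sup>2 \<ge> 2\<^sup>2" using r(1) by (intro power_mono) auto
    then have "1 / ?r\<^sup>2 \<le> 1 / 2\<^sup>2" by (intro divide_left_mono) auto
    then show "?s k \<le> 1 / 2" by simp
    have "1 / ?r\<^sup>2 \<le> 1 / ((real k + 1)\<^sup>2 / 4)"
    proof (rule divide_left_mono)
      show "0 < ?r\<^sup>2 * ((real k + 1)\<^sup>2 / 4)"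
        using \<open>?r\<^sup>2 \<ge> 2\<^sup>2\<close> by (intro mult_pos_pos divide_pos_pos zero_less_power) auto
    qed (use r in auto)
    then show "?s k \<le> 4 * (1 / (real k + 1)\<^sup>2)" by simp
  qed
  have b4: "(\<Sum>k\<le>N. ?s k) \<le> 8" for N
  proof -
    have "(\<Sum>k\<le>N. ?s k) \<le> (\<Sum>k\<le>N. 4 * (1 / (real k + 1)\<^sup>2))" by (intro sum_mono b3)
    also have "\<dots> = 4 * (\<Sum>k\<le>N. 1 / (real k + 1)\<^sup>2)" by (rule sum_distrib_left[symmetric])
    also have "\<dots> \<le> 4 * (2 - 1 / (real N + 1))" by (intro mult_left_mono sum_inverse_squares_le) simp
    finally show ?thesis by (simp add: algebra_simps) (smt (verit) divide_nonneg_nonneg of_nat_0_le_iff)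
  qed
  note P = prod_one_plus_small_bounds[of ?e ?s 8, OF b1 b2 b4]
  let ?a = "\<lambda>N. norm (z + of_nat N + 1) / real N"
  let ?P = "\<lambda>N. \<Prod>k\<le>N. 1 + ?e k"
  have lim1: "?a \<longlonglongrightarrow> 1"
  proof -
    have "(\<lambda>N. norm (1 + (z + 1) / of_nat N)) \<longlonglongrightarrow> norm (1 + 0 :: complex)"
      by (intro tendsto_intros lim_const_over_n)
    moreover have "\<forall>\<^sub>F N in sequentially. norm (1 + (z + 1) / of_nat N) = ?a N"
      using eventually_gt_at_top[of 0]
    proof eventually_elim
      case (elim N)
      then have "1 + (z + 1) / of_nat N = (z + of_nat N + 1) / of_nat N" by (simp add: field_simps)
      then show ?case by (simp add: norm_divide)
    qed
    ultimately show ?thesis using Lim_transform_eventually by force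
  qed
  note L = Gamma_half_quotient_LIMSEQ[OF z]
  have "(\<lambda>N. ?a N * exp (- 8)) \<longlonglongrightarrow> 1 * exp (- 8)" by (intro tendsto_intros lim1)
  moreover have "?a N * exp (- 8) \<le> ?a N * norm (inverse (?P N))" for N
  proof -
    have "exp (- 8) \<le> inverse (norm (?P N))"
    proof -
      have "0 < norm (?P N)" using P(2)[of N] by (smt (verit) exp_gt_zero)
      then have "inverse (exp 8) \<le> inverse (norm (?P N))" using P(1)[of N] by (intro le_imp_inverse_le)
      then show ?thesis by (simp add: exp_minus)
    qed
    then show ?thesis by (intro mult_left_mono) (simp_all add: norm_inverse)
  qed
  ultimately show "norm z * (norm (Gamma (z - 1/2) / Gamma z))\<^sup>2 \<ge> Gamma_quot_lower"
    unfolding Gamma_quot_lower_def using LIMSEQ_le[OF _ L] by fastforce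
  have "(\<lambda>N. ?a N * exp 16) \<longlonglongrightarrow> 1 * exp 16" by (intro tendsto_intros lim1)
  moreover have "?a N * norm (inverse (?P N)) \<le> ?a N * exp 16" for N
  proof -
    have "inverse (norm (?P N)) \<le> inverse (exp (- 2 * 8))" using P(2)[of N] by (intro le_imp_inverse_le) auto
    also have "\<dots> = exp 16" by (simp add: exp_minus)
    finally show ?thesis by (intro mult_left_mono) (simp_all add: norm_inverse)
  qed
  ultimately show "norm z * (norm (Gamma (z - 1/2) / Gamma z))\<^sup>2 \<le> Gamma_quot_upper"
    unfolding Gamma_quot_upper_def using LIMSEQ_le[OF L] by fastforce
qed

section \<open>The one-variable weight\<close>

definition zeta_arg :: "complex \<Rightarrow> complex \<Rightarrow> complex" where
  "zeta_arg b \<alpha> = (\<alpha> - b) / (-2 * pi * \<i>)"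

text \<open>By the reflection formula, one factor of \<open>phi\<close> divided by \<open>1 - X x\<close> has only the poles displayed
  by these two Gamma functions.\<close>

definition gamma_factor :: "complex \<Rightarrow> complex \<Rightarrow> complex" where
  "gamma_factor b \<alpha> = \<i> / (2 * pi) * exp ((\<alpha> - b) / 2) * Gamma (zeta_arg b \<alpha> - 1/2) * Gamma (1 - zeta_arg b \<alpha>)"

definition rational_factor :: "(nat \<Rightarrow> complex) \<Rightarrow> nat \<Rightarrow> complex \<Rightarrow> complex" where
  "rational_factor \<beta> m \<alpha> = 1 / (\<alpha> - \<beta> m) * (\<Prod>j=1..<m. (\<alpha> - \<beta> j + pi * \<i>) / (\<alpha> - \<beta> j))"

definition weight :: "nat \<Rightarrow> (nat \<Rightarrow> complex) \<Rightarrow> nat \<Rightarrow> complex \<Rightarrow> complex" where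
  "weight n \<beta> m \<alpha> = (\<Prod>j=1..n. gamma_factor (\<beta> j) \<alpha>) * rational_factor \<beta> m \<alpha>"

lemma half_shift_zeta: "(\<alpha> - b + pi * \<i>) / (-2 * pi * \<i>) = zeta_arg b \<alpha> - 1/2"
  by (simp add: zeta_arg_def field_simps)

text \<open>With \<open>h = exp ((\<alpha> - b) / 2)\<close> the sine in the reflection formula is
  \<open>(inverse h - h) / (2 * \<i>)\<close>, and \<open>1 - X x\<close> is
  \<open>1 - inverse h * inverse h\<close>, so they agree up to a power of \<open>h\<close> and a
  constant. At the excluded points the right side is a division by 0, whereas the left side may be
  regular there, as it is at \<open>\<alpha> = b\<close>.\<close>

lemma gamma_factor_eq:
  assumes "1 - exp (- \<alpha>) * exp b \<noteq> 0"
  shows "gamma_factor b \<alpha> = Gamma (zeta_arg b \<alpha> - 1/2) / Gamma (zeta_arg b \<alpha>) / (1 - exp (- \<alpha>) * exp b)"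
proof -
  define z where "z = zeta_arg b \<alpha>"
  define h where "h = exp ((\<alpha> - b) / 2)"
  have h0: "h \<noteq> 0" by (simp add: h_def)
  have hz: "exp (\<i> * (pi * z)) = inverse h" "exp (- (\<i> * (pi * z))) = h"
  proof -
    have "\<alpha> - b = - 2 * pi * \<i> * z" by (simp add: z_def zeta_arg_def)
    then have "\<i> * (pi * z) = - ((\<alpha> - b) / 2)" by simp
    then show "exp (\<i> * (pi * z)) = inverse h" "exp (- (\<i> * (pi * z))) = h"
      by (simp_all only: h_def exp_minus minus_minus)
  qed
  have e2: "exp (- \<alpha>) * exp b = inverse h * inverse h"
  proof -
    define x where "x = (\<alpha> - b) / 2"
    have "y / 2 + y / 2 = y" for y :: complex by (simp flip: add_divide_distrib mult_2)
    then have X: "x + x = \<alpha> - b" unfolding x_def .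
    have "- x + - x = - (x + x)" by simp
    then have "- \<alpha> + b = - x + - x" unfolding X by simp
    then show ?thesis unfolding h_def x_def[symmetric] by (metis exp_add exp_minus)
  qed
  have hh: "h * h \<noteq> 1" using assms h0 unfolding e2 by (auto simp: field_simps)
  have s: "sin (pi * z) = (inverse h - h) / (2 * \<i>)"
    by (simp add: sin_exp_eq hz)
  moreover have "inverse h - h \<noteq> 0"
  proof
    assume "inverse h - h = 0"
    then have "h * inverse h = h * h" by simp
    then show False using h0 hh by simp
  qed
  ultimately have s0: "sin (pi * z) \<noteq> 0" by simp
  have refl: "Gamma z * Gamma (1 - z) = pi / sin (pi * z)" by (rule Gamma_reflection_complex)
  then have G0: "Gamma z \<noteq> 0" using s0 by auto
  have "Gamma (1 - z) = (Gamma z * Gamma (1 - z)) / Gamma z" using G0 by simp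
  then have "Gamma (1 - z) = pi / sin (pi * z) / Gamma z" unfolding refl .
  then have "gamma_factor b \<alpha> = \<i> / (2 * pi) * h * Gamma (z - 1/2) * (pi / sin (pi * z) / Gamma z)"
    by (simp add: gamma_factor_def z_def h_def)
  also have "\<dots> = Gamma (z - 1/2) / Gamma z * (\<i> * h / (2 * sin (pi * z)))" by (simp add: mult_ac)
  also have "\<i> * h / (2 * sin (pi * z)) = 1 / (1 - exp (- \<alpha>) * exp b)"
    unfolding s e2 using h0 hh by (simp add: field_simps)
  finally show ?thesis by (simp add: z_def)
qed

lemma weight_eq:
  assumes "\<And>j. j \<in> {1..n} \<Longrightarrow> 1 - exp (- \<alpha>) * exp (\<beta> j) \<noteq> 0"
  shows "weight n \<beta> m \<alpha> = phi n \<beta> \<alpha> * rational_factor \<beta> m \<alpha> / (\<Prod>j=1..n. 1 - exp (- \<alpha>) * exp (\<beta> j))"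
proof -
  have "(\<Prod>j=1..n. gamma_factor (\<beta> j) \<alpha>) = (\<Prod>j=1..n. Gamma ((\<alpha> - \<beta> j + pi * \<i>) / (-2 * pi * \<i>))
        / Gamma ((\<alpha> - \<beta> j) / (-2 * pi * \<i>)) / (1 - exp (- \<alpha>) * exp (\<beta> j)))"
    unfolding half_shift_zeta using assms
    by (intro prod.cong refl) (simp add: gamma_factor_eq zeta_arg_def)
  also have "\<dots> = phi n \<beta> \<alpha> / (\<Prod>j=1..n. 1 - exp (- \<alpha>) * exp (\<beta> j))"
    unfolding phi_def by (rule prod_dividef)
  finally show ?thesis by (simp add: weight_def)
qed

text \<open>The point \<open>b\<close> is absent: there the zero of
  \<open>1 / Gamma (zeta_arg b \<alpha>)\<close> cancels the pole of \<open>1 / (1 - X x)\<close>.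
  It can become a pole of the weight only through \<open>rational_factor\<close>.\<close>

definition gamma_poles :: "complex \<Rightarrow> complex set" where
  "gamma_poles b = range (\<lambda>k::nat. b - pi * \<i> + 2 * of_nat k * pi * \<i>) \<union>
     range (\<lambda>k::nat. b - 2 * of_nat (Suc k) * pi * \<i>)"

lemma gamma_args_regular:
  assumes "\<alpha> \<notin> gamma_poles b"
  shows "zeta_arg b \<alpha> - 1/2 \<notin> \<int>\<^sub>\<le>\<^sub>0" "1 - zeta_arg b \<alpha> \<notin> \<int>\<^sub>\<le>\<^sub>0"
proof -
  show "zeta_arg b \<alpha> - 1/2 \<notin> \<int>\<^sub>\<le>\<^sub>0"
  proof
    assume "zeta_arg b \<alpha> - 1/2 \<in> \<int>\<^sub>\<le>\<^sub>0"
    then obtain k where k: "zeta_arg b \<alpha> - 1/2 = - of_nat k" by (rule nonpos_Ints_cases')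
    have "\<alpha> = b + (-2 * pi * \<i>) * zeta_arg b \<alpha>" by (simp add: zeta_arg_def)
    also have "zeta_arg b \<alpha> = 1/2 - of_nat k" using k by (simp add: algebra_simps)
    finally have "\<alpha> = b - pi * \<i> + 2 * of_nat k * pi * \<i>" by (simp add: algebra_simps)
    then show False using assms by (auto simp: gamma_poles_def)
  qed
  show "1 - zeta_arg b \<alpha> \<notin> \<int>\<^sub>\<le>\<^sub>0"
  proof
    assume "1 - zeta_arg b \<alpha> \<in> \<int>\<^sub>\<le>\<^sub>0"
    then obtain k where k: "1 - zeta_arg b \<alpha> = - of_nat k" by (rule nonpos_Ints_cases')
    have "\<alpha> = b + (-2 * pi * \<i>) * zeta_arg b \<alpha>" by (simp add: zeta_arg_def)
    also have "zeta_arg b \<alpha> = 1 + of_nat k" using k by (simp add: algebra_simps)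
    finally have "\<alpha> = b - 2 * of_nat (Suc k) * pi * \<i>" by (simp add: algebra_simps)
    then show False using assms by (auto simp: gamma_poles_def simp del: of_nat_Suc)
  qed
qed

lemma gamma_factor_analytic:
  fixes f g :: "complex \<Rightarrow> complex"
  assumes "f analytic_on A" "g analytic_on A" "\<And>z. z \<in> A \<Longrightarrow> g z \<notin> gamma_poles (f z)"
  shows "(\<lambda>z. gamma_factor (f z) (g z)) analytic_on A"
proof -
  have z: "(\<lambda>z. zeta_arg (f z) (g z)) analytic_on A"
    unfolding zeta_arg_def by (intro analytic_intros assms(1,2)) simp
  show ?thesis
    unfolding gamma_factor_def using assms gamma_args_regular[OF assms(3)]
    by (intro analytic_intros z analytic_on_Gamma') auto
qed

lemma gamma_factor_continuous:
  fixes f g :: "'a :: topological_space \<Rightarrow> complex"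
  assumes "continuous_on A f" "continuous_on A g" "\<And>z. z \<in> A \<Longrightarrow> g z \<notin> gamma_poles (f z)"
  shows "continuous_on A (\<lambda>z. gamma_factor (f z) (g z))"
proof -
  have z: "continuous_on A (\<lambda>z. zeta_arg (f z) (g z))"
    unfolding zeta_arg_def by (intro continuous_intros assms(1,2)) simp
  have G: "continuous_on A (\<lambda>z. Gamma (h z))" if "continuous_on A h" "\<And>z. z \<in> A \<Longrightarrow> h z \<notin> \<int>\<^sub>\<le>\<^sub>0" for h :: "_ \<Rightarrow> complex"
    by (rule continuous_on_compose2[OF continuous_on_Gamma[of "h ` A"]]) (use that in auto)
  show ?thesis
    unfolding gamma_factor_def using gamma_args_regular[OF assms(3)]
    by (intro continuous_intros G z assms(1,2)) auto
qed

lemma regular_point: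
  assumes "\<alpha> \<notin> lower_points n \<beta> \<union> upper_points n \<beta>" "j \<in> {1..n}"
  shows "\<alpha> \<notin> gamma_poles (\<beta> j)" "\<alpha> \<noteq> \<beta> j"
proof -
  have l: "\<beta> j - 2 * of_nat k * pi * \<i> \<in> lower_points n \<beta>" for k
    unfolding lower_points_def using assms(2) by blast
  have u: "\<beta> j - pi * \<i> + 2 * of_nat k * pi * \<i> \<in> upper_points n \<beta>" for k
    unfolding upper_points_def using assms(2) by blast
  show "\<alpha> \<notin> gamma_poles (\<beta> j)" "\<alpha> \<noteq> \<beta> j"
    using assms(1) l u l[of 0] unfolding gamma_poles_def by (auto simp del: of_nat_Suc)
qed

lemma weight_analytic:
  fixes g :: "complex \<Rightarrow> complex"
  assumes B: "\<And>j. j \<in> {1..n} \<Longrightarrow> (\<lambda>z. B z j) analytic_on A" and g: "g analytic_on A" and m: "m \<in> {1..n}"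
    and reg: "\<And>z. z \<in> A \<Longrightarrow> g z \<notin> lower_points n (B z) \<union> upper_points n (B z)"
  shows "(\<lambda>z. weight n (B z) m (g z)) analytic_on A"
  unfolding weight_def rational_factor_def using regular_point[OF reg] m
  by (intro analytic_intros analytic_on_prod gamma_factor_analytic B g) auto

lemma weight_continuous:
  fixes g :: "'a :: topological_space \<Rightarrow> complex"
  assumes B: "\<And>j. j \<in> {1..n} \<Longrightarrow> continuous_on A (\<lambda>z. B z j)" and g: "continuous_on A g" and m: "m \<in> {1..n}"
    and reg: "\<And>z. z \<in> A \<Longrightarrow> g z \<notin> lower_points n (B z) \<union> upper_points n (B z)"
  shows "continuous_on A (\<lambda>z. weight n (B z) m (g z))"
  unfolding weight_def rational_factor_def using regular_point[OF reg] m
  by (intro continuous_intros gamma_factor_continuous B g) auto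

section \<open>Size of the weight far to the right and far to the left\<close>

lemma gamma_factor_bounds:
  assumes Re: "\<bar>Re \<alpha>\<bar> \<ge> 2 * Bd + Y + 20" and Im: "\<bar>Im \<alpha>\<bar> \<le> Y" and b: "norm b \<le> Bd"
  shows "1 - exp (- \<alpha>) * exp b \<noteq> 0"
    "(norm (gamma_factor b \<alpha>) * norm (1 - exp (- \<alpha>) * exp b))\<^sup>2 \<le> 4 * pi * Gamma_quot_upper / \<bar>Re \<alpha>\<bar>"
    "(norm (gamma_factor b \<alpha>) * norm (1 - exp (- \<alpha>) * exp b))\<^sup>2 \<ge> Gamma_quot_lower / \<bar>Re \<alpha>\<bar>"
proof -
  let ?z = "zeta_arg b \<alpha>"
  have bnd: "\<bar>Re b\<bar> \<le> Bd" "\<bar>Im b\<bar> \<le> Bd" "0 \<le> Bd" "0 \<le> Y"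
    using b abs_Re_le_cmod[of b] abs_Im_le_cmod[of b] norm_ge_zero[of b] Im by linarith+
  have zc: "Re ?z = - Im (\<alpha> - b) / (2 * pi)" "Im ?z = Re (\<alpha> - b) / (2 * pi)"
    by (simp_all add: zeta_arg_def Re_divide Im_divide power2_eq_square field_simps)
  have pi4: "pi \<le> 4" "pi > 3" using pi_less_4 pi_gt3 by simp_all
  \<comment> \<open>\<open>zeta_arg\<close> rotates by a right angle and divides by 2 \<pi>, so this
    is the cone condition of the Gamma bounds. The 20 in the hypothesis exceeds 4 \<pi>.\<close>
  have "\<bar>Re (\<alpha> - b)\<bar> \<ge> \<bar>Im (\<alpha> - b)\<bar> + 4 * pi" using Re Im bnd pi4 by simp
  then have "(\<bar>Im (\<alpha> - b)\<bar> + 4 * pi) / (2 * pi) \<le> \<bar>Re (\<alpha> - b)\<bar> / (2 * pi)"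
    by (intro divide_right_mono) auto
  then have "\<bar>Im ?z\<bar> \<ge> \<bar>Re ?z\<bar> + 2" unfolding zc by (simp add: add_divide_distrib abs_divide abs_minus_commute)
  note G = Gamma_half_quotient_bounds[OF this]
  have ab: "norm (\<alpha> - b) \<ge> \<bar>Re \<alpha>\<bar> / 2"
    using abs_Re_le_cmod[of "\<alpha> - b"] Re bnd by simp
  have ab2: "norm (\<alpha> - b) \<le> 2 * \<bar>Re \<alpha>\<bar>"
    using cmod_le[of "\<alpha> - b"] Re bnd Im by simp
  have nz: "norm ?z = norm (\<alpha> - b) / (2 * pi)" by (simp add: zeta_arg_def norm_divide norm_mult)
  have t0: "\<bar>Re \<alpha>\<bar> > 0" using Re bnd by linarith
  have z1: "norm ?z \<ge> \<bar>Re \<alpha>\<bar> / (4 * pi)" unfolding nz using ab by (simp add: field_simps)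
  have z2: "norm ?z \<le> \<bar>Re \<alpha>\<bar>"
  proof -
    have "norm (\<alpha> - b) \<le> 2 * pi * \<bar>Re \<alpha>\<bar>"
      using ab2 pi4 mult_right_mono[of 2 "2 * pi" "\<bar>Re \<alpha>\<bar>"] by simp
    then show ?thesis unfolding nz by (simp add: field_simps)
  qed
  have z0: "norm ?z > 0" using z1 t0 by (smt (verit) divide_pos_pos pi_gt_zero zero_less_mult_iff)
  show ne: "1 - exp (- \<alpha>) * exp b \<noteq> 0"
  proof
    assume "1 - exp (- \<alpha>) * exp b = 0"
    then have "exp (b - \<alpha>) = 1" by (simp add: exp_diff exp_minus field_simps)
    then have "Re (b - \<alpha>) = 0" by (simp add: exp_eq_1)
    then show False using Re bnd by simp
  qed
  let ?G = "norm (Gamma (?z - 1/2) / Gamma ?z)"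
  have e: "norm (gamma_factor b \<alpha>) * norm (1 - exp (- \<alpha>) * exp b) = ?G"
    unfolding gamma_factor_eq[OF ne] using ne by (simp add: norm_divide norm_mult)
  have "\<bar>Re \<alpha>\<bar> / (4 * pi) * ?G\<^sup>2 \<le> norm ?z * ?G\<^sup>2" using z1 by (intro mult_right_mono) auto
  also note G(2)
  finally show "(norm (gamma_factor b \<alpha>) * norm (1 - exp (- \<alpha>) * exp b))\<^sup>2 \<le> 4 * pi * Gamma_quot_upper / \<bar>Re \<alpha>\<bar>"
    unfolding e using t0 by (simp add: field_simps)
  note G(1)
  also have "norm ?z * ?G\<^sup>2 \<le> \<bar>Re \<alpha>\<bar> * ?G\<^sup>2" using z2 by (intro mult_right_mono) auto
  finally show "(norm (gamma_factor b \<alpha>) * norm (1 - exp (- \<alpha>) * exp b))\<^sup>2 \<ge> Gamma_quot_lower / \<bar>Re \<alpha>\<bar>"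
    unfolding e using t0 by (simp add: field_simps)
qed

text \<open>To the left each of the \<open>n\<close> denominators grows like
  \<open>exp (- Re \<alpha>)\<close>; together they outweigh a numerator of degree less than
  \<open>n\<close> in \<open>X\<close>.\<close>

lemma one_minus_exp_bounds:
  assumes b: "norm b \<le> Bd"
  shows "Re \<alpha> \<ge> Bd + 1 \<Longrightarrow> norm (1 - exp (- \<alpha>) * exp b) \<ge> 1/2"
    "Re \<alpha> \<ge> Bd + 1 \<Longrightarrow> norm (1 - exp (- \<alpha>) * exp b) \<le> 2"
    "Re \<alpha> \<le> - Bd - 1 \<Longrightarrow> norm (1 - exp (- \<alpha>) * exp b) \<ge> exp (- Bd) / 2 * exp (- Re \<alpha>)"
proof -
  have rb: "\<bar>Re b\<bar> \<le> Bd" using b abs_Re_le_cmod[of b] by linarith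
  have n: "norm (exp (- \<alpha>) * exp b) = exp (Re b - Re \<alpha>)"
    by (simp only: exp_add[symmetric] norm_exp_eq_Re) simp
  have e1: "exp (1::real) \<ge> 2" using exp_ge_add_one_self[of "1::real"] by simp
  { assume "Re \<alpha> \<ge> Bd + 1"
    then have "exp (Re b - Re \<alpha>) \<le> exp (-1)" using rb by simp
    also have "\<dots> \<le> 1 / 2" using e1 by (simp add: exp_minus field_simps)
    finally have h: "norm (exp (- \<alpha>) * exp b) \<le> 1 / 2" unfolding n .
    show "norm (1 - exp (- \<alpha>) * exp b) \<ge> 1/2"
      using norm_triangle_ineq2[of 1 "exp (- \<alpha>) * exp b"] h by simp
    show "norm (1 - exp (- \<alpha>) * exp b) \<le> 2"
      using norm_triangle_ineq4[of 1 "exp (- \<alpha>) * exp b"] h by simp }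
  { assume "Re \<alpha> \<le> - Bd - 1"
    then have "exp 1 \<le> exp (Re b - Re \<alpha>)" using rb by simp
    then have h: "2 \<le> exp (Re b - Re \<alpha>)" using e1 by linarith
    have "exp (- Bd) * exp (- Re \<alpha>) \<le> exp (Re b - Re \<alpha>)" using rb by (simp add: exp_add[symmetric])
    then have "exp (- Bd) / 2 * exp (- Re \<alpha>) \<le> exp (Re b - Re \<alpha>) / 2" by simp
    also have "\<dots> \<le> exp (Re b - Re \<alpha>) - 1" using h by simp
    also have "\<dots> \<le> norm (1 - exp (- \<alpha>) * exp b)"
      using norm_triangle_ineq3[of 1 "exp (- \<alpha>) * exp b"] n by simp
    finally show "norm (1 - exp (- \<alpha>) * exp b) \<ge> exp (- Bd) / 2 * exp (- Re \<alpha>)" . }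
qed

text \<open>At distance at least 2 \<pi> from every \<open>\<beta> j\<close>, the shift by \<pi> i
  changes \<open>\<alpha> - \<beta> j\<close> by a bounded factor, so only
  \<open>1 / (\<alpha> - \<beta> m)\<close> determines the order.\<close>

lemma rational_factor_bounds:
  assumes Re: "\<bar>Re \<alpha>\<bar> \<ge> 2 * Bd + Y + 20" and Im: "\<bar>Im \<alpha>\<bar> \<le> Y"
    and \<beta>: "\<And>j. j \<in> {1..n} \<Longrightarrow> norm (\<beta> j) \<le> Bd" and m: "m \<in> {1..n}"
  shows "norm (rational_factor \<beta> m \<alpha>) \<le> 2 ^ (n + 1) / \<bar>Re \<alpha>\<bar>"
    "norm (rational_factor \<beta> m \<alpha>) \<ge> 1 / (2 ^ (n + 1) * \<bar>Re \<alpha>\<bar>)"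
proof -
  have Bd: "0 \<le> Bd" "0 \<le> Y" using \<beta>[OF m] norm_ge_zero[of "\<beta> m"] Im by linarith+
  have t0: "\<bar>Re \<alpha>\<bar> > 0" using Re Bd by linarith
  have pi4: "pi \<le> 4" "pi > 3" using pi_less_4 pi_gt3 by simp_all
  have d1: "norm (\<alpha> - \<beta> j) \<ge> \<bar>Re \<alpha>\<bar> / 2" and d2: "norm (\<alpha> - \<beta> j) \<le> 2 * \<bar>Re \<alpha>\<bar>"
    and d3: "norm (\<alpha> - \<beta> j) \<ge> 2 * pi" if j: "j \<in> {1..n}" for j
  proof -
    have bnd: "\<bar>Re (\<beta> j)\<bar> \<le> Bd" "\<bar>Im (\<beta> j)\<bar> \<le> Bd"
      using \<beta>[OF j] abs_Re_le_cmod[of "\<beta> j"] abs_Im_le_cmod[of "\<beta> j"] by linarith+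
    show "norm (\<alpha> - \<beta> j) \<ge> \<bar>Re \<alpha>\<bar> / 2" "norm (\<alpha> - \<beta> j) \<ge> 2 * pi"
      using abs_Re_le_cmod[of "\<alpha> - \<beta> j"] Re bnd Bd pi4 by auto
    show "norm (\<alpha> - \<beta> j) \<le> 2 * \<bar>Re \<alpha>\<bar>"
      using cmod_le[of "\<alpha> - \<beta> j"] Re bnd Im Bd by simp
  qed
  have q: "norm ((\<alpha> - \<beta> j + pi * \<i>) / (\<alpha> - \<beta> j)) \<le> 2" "norm ((\<alpha> - \<beta> j + pi * \<i>) / (\<alpha> - \<beta> j)) \<ge> 1 / 2"
    if j: "j \<in> {1..n}" for j
  proof -
    have "norm (\<alpha> - \<beta> j) > 0" using d3[OF j] pi4 by linarith
    moreover have "norm (\<alpha> - \<beta> j + pi * \<i>) \<le> norm (\<alpha> - \<beta> j) + pi"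
      using norm_triangle_ineq[of "\<alpha> - \<beta> j" "pi * \<i>"] by (simp add: norm_mult)
    moreover have "norm (\<alpha> - \<beta> j + pi * \<i>) \<ge> norm (\<alpha> - \<beta> j) - pi"
      using norm_diff_ineq[of "\<alpha> - \<beta> j" "pi * \<i>"] by (simp add: norm_mult)
    ultimately show "norm ((\<alpha> - \<beta> j + pi * \<i>) / (\<alpha> - \<beta> j)) \<le> 2" "norm ((\<alpha> - \<beta> j + pi * \<i>) / (\<alpha> - \<beta> j)) \<ge> 1 / 2"
      using d3[OF j] by (simp_all add: norm_divide field_simps)
  qed
  have p1: "norm (\<Prod>j=1..<m. (\<alpha> - \<beta> j + pi * \<i>) / (\<alpha> - \<beta> j)) \<le> 2 ^ n"
  proof -
    have "(\<Prod>j=1..<m. norm ((\<alpha> - \<beta> j + pi * \<i>) / (\<alpha> - \<beta> j))) \<le> (\<Prod>j=1..<m. 2)"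
      using q(1) m by (intro prod_mono) auto
    also have "\<dots> = 2 ^ (m - 1)" by simp
    also have "\<dots> \<le> 2 ^ n"
    proof (rule power_increasing)
      show "m - 1 \<le> n" using m unfolding atLeastAtMost_iff by linarith
    qed simp
    finally show ?thesis by (simp add: prod_norm)
  qed
  have p2: "norm (\<Prod>j=1..<m. (\<alpha> - \<beta> j + pi * \<i>) / (\<alpha> - \<beta> j)) \<ge> 1 / 2 ^ n"
  proof -
    have "1 / 2 ^ n \<le> (1 / 2 :: real) ^ (m - 1)"
      unfolding power_one_over[symmetric] 
    proof (rule power_decreasing)
      show "m - 1 \<le> n" using m unfolding atLeastAtMost_iff by linarith
    qed auto
    also have "\<dots> = (\<Prod>j=1..<m. 1 / 2)" by simp
    also have "\<dots> \<le> (\<Prod>j=1..<m. norm ((\<alpha> - \<beta> j + pi * \<i>) / (\<alpha> - \<beta> j)))"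
      using q(2) m by (intro prod_mono) auto
    finally show ?thesis by (simp add: prod_norm)
  qed
  have r1: "norm (1 / (\<alpha> - \<beta> m)) \<le> 2 / \<bar>Re \<alpha>\<bar>" "norm (1 / (\<alpha> - \<beta> m)) \<ge> 1 / (2 * \<bar>Re \<alpha>\<bar>)"
  proof -
    have p: "norm (\<alpha> - \<beta> m) > 0" using d3[OF m] pi4 by linarith
    show "norm (1 / (\<alpha> - \<beta> m)) \<le> 2 / \<bar>Re \<alpha>\<bar>" using p d1[OF m] t0 by (simp add: norm_divide field_simps)
    show "norm (1 / (\<alpha> - \<beta> m)) \<ge> 1 / (2 * \<bar>Re \<alpha>\<bar>)" using p d2[OF m] t0 by (simp add: norm_divide field_simps)
  qed
  have "norm (rational_factor \<beta> m \<alpha>) \<le> 2 / \<bar>Re \<alpha>\<bar> * 2 ^ n"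
    unfolding rational_factor_def norm_mult by (intro mult_mono r1 p1) auto
  then show "norm (rational_factor \<beta> m \<alpha>) \<le> 2 ^ (n + 1) / \<bar>Re \<alpha>\<bar>" by simp
  have "1 / (2 * \<bar>Re \<alpha>\<bar>) * (1 / 2 ^ n) \<le> norm (rational_factor \<beta> m \<alpha>)"
    unfolding rational_factor_def norm_mult by (intro mult_mono r1 p2) auto
  then show "norm (rational_factor \<beta> m \<alpha>) \<ge> 1 / (2 ^ (n + 1) * \<bar>Re \<alpha>\<bar>)" by (simp add: field_simps)
qed

definition monom_exp :: "nat \<Rightarrow> nat \<Rightarrow> complex \<Rightarrow> complex" where
  "monom_exp k i \<alpha> = \<alpha> ^ k * exp (- \<alpha>) ^ i"

lemma power_le_fact_exp:
  fixes t :: real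
  assumes "t \<ge> 0"
  shows "t ^ m \<le> fact m * exp t"
proof -
  have s: "(\<lambda>n. t ^ n /\<^sub>R fact n) sums exp t" by (rule exp_converges)
  have "sum (\<lambda>n. t ^ n /\<^sub>R fact n) {m} \<le> suminf (\<lambda>n. t ^ n /\<^sub>R fact n)"
    by (rule sum_le_suminf) (use s assms in \<open>auto simp: sums_iff\<close>)
  then have "t ^ m / fact m \<le> exp t" using s by (simp add: sums_iff field_simps)
  then show ?thesis by (simp add: field_simps)
qed

text \<open>From \<open>1 + t \<le> 2 * t\<close>; the constant 4 is a crude bound for 2 to the
  power 3/2.\<close>

lemma decay_lower_bound:
  assumes "t \<ge> 1"
  shows "1 / (t * sqrt t) \<le> 4 * decay t"
proof -
  have e: "x powr (-3/2) = 1 / (x * sqrt x)" if "x > 0" for x :: real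
  proof -
    have "x powr (-3/2) = x powr (- 1 + - (1/2))" by simp
    also have "\<dots> = 1 / (x * sqrt x)"
      unfolding powr_add using that by (simp add: powr_minus powr_half_sqrt field_simps)
    finally show ?thesis .
  qed
  have "sqrt 2 \<le> 2" by (simp add: real_le_lsqrt)
  then have "(2 * t) * sqrt (2 * t) \<le> 4 * (t * sqrt t)" using assms by (simp add: real_sqrt_mult)
  then have "1 / (4 * (t * sqrt t)) \<le> 1 / ((2 * t) * sqrt (2 * t))"
    using assms by (intro divide_left_mono) auto
  also have "\<dots> = (2 * t) powr (-3/2)" by (rule e[symmetric]) (use assms in simp)
  also have "\<dots> \<le> decay t" unfolding decay_def using assms by (intro powr_mono2') auto
  finally have "4 * (1 / (4 * (t * sqrt t))) \<le> 4 * decay t" by (intro mult_left_mono) auto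
  then show ?thesis by simp
qed

text \<open>The constant is uniform in all parameters of norm at most \<open>Bd\<close>, because one
  of them is going to move. To the right with \<open>i = 0\<close> there are \<open>n\<close>
  factors \<open>1 / sqrt t\<close>, one \<open>1 / t\<close> and the monomial \<open>t ^ k\<close>.
  In every other case an exponential \<open>exp (- t)\<close> remains: from \<open>X ^ i\<close> on
  the right, and on the left from the \<open>n\<close> denominators, which exceed the degree
  \<open>i\<close> of the numerator.\<close>

lemma weight_decay:
  fixes Bd Y :: real and n D :: nat
  assumes Bd: "Bd \<ge> 0" and Y: "Y \<ge> 0"
  shows "\<exists>K. \<forall>(\<beta> :: nat \<Rightarrow> complex) \<alpha> m k i. (\<forall>j\<in>{1..n}. norm (\<beta> j) \<le> Bd) \<longrightarrow> \<bar>Im \<alpha>\<bar> \<le> Y \<longrightarrow> 2 * Bd + Y + 20 \<le> \<bar>Re \<alpha>\<bar> \<longrightarrow>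
     m \<in> {1..n} \<longrightarrow> k \<le> D \<longrightarrow> i < n \<longrightarrow> 2 * k + 1 \<le> n \<or> 1 \<le> i \<longrightarrow>
     norm (weight n \<beta> m \<alpha> * monom_exp k i \<alpha>) \<le> K * decay (Re \<alpha>)"
proof -
  define c where "c = sqrt (4 * pi * Gamma_quot_upper)"
  define K1 where "K1 = (2 * exp Bd) ^ n"
  have c0: "c \<ge> 0" by (simp add: c_def Gamma_quot_upper_def)
  have K1: "K1 \<ge> 2 ^ n" "K1 \<ge> 0" unfolding K1_def using Bd by (auto intro!: power_mono)
  define K where "K = c ^ n * 2 ^ (n + 1) * 2 ^ D * K1 * fact (D + 1) * 4"
  show ?thesis
  proof (intro exI[of _ K] allI impI)
    fix \<beta> :: "nat \<Rightarrow> complex" and \<alpha> m k i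
    assume \<beta>: "\<forall>j\<in>{1..n}. norm (\<beta> j) \<le> Bd" and Im: "\<bar>Im \<alpha>\<bar> \<le> Y" and Re: "2 * Bd + Y + 20 \<le> \<bar>Re \<alpha>\<bar>"
      and m: "m \<in> {1..n}" and k: "k \<le> D" and i: "i < n" and ki: "2 * k + 1 \<le> n \<or> 1 \<le> i"
    define t where "t = \<bar>Re \<alpha>\<bar>"
    have t: "t \<ge> 1" "t \<ge> Bd + 1" "t \<ge> Y" using Re Bd Y by (auto simp: t_def)
    have st: "sqrt t \<ge> 1" using t by simp
    let ?o = "\<lambda>j. norm (1 - exp (- \<alpha>) * exp (\<beta> j))"
    have E: "norm (gamma_factor (\<beta> j) \<alpha>) \<le> c / sqrt t * (1 / ?o j)" if j: "j \<in> {1..n}" for j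
    proof -
      note B = gamma_factor_bounds[OF Re Im \<beta>[rule_format, OF j]]
      have "(c / sqrt t)\<^sup>2 = 4 * pi * Gamma_quot_upper / \<bar>Re \<alpha>\<bar>"
        using t by (simp add: c_def power_divide t_def Gamma_quot_upper_def)
      then have "(norm (gamma_factor (\<beta> j) \<alpha>) * ?o j)\<^sup>2 \<le> (c / sqrt t)\<^sup>2"
        using B(2) by (simp only:)
      then have "norm (gamma_factor (\<beta> j) \<alpha>) * ?o j \<le> c / sqrt t"
        by (rule power2_le_imp_le) (use c0 t in simp)
      moreover have "?o j > 0" using B(1) by simp
      ultimately have "norm (gamma_factor (\<beta> j) \<alpha>) \<le> (c / sqrt t) / ?o j" by (simp only: pos_le_divide_eq)
      then show ?thesis by simp
    qed
    let ?P = "\<Prod>j=1..n. 1 / ?o j"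
    have PE: "norm (\<Prod>j=1..n. gamma_factor (\<beta> j) \<alpha>) \<le> (c / sqrt t) ^ n * ?P"
    proof -
      have "(\<Prod>j=1..n. norm (gamma_factor (\<beta> j) \<alpha>)) \<le> (\<Prod>j=1..n. c / sqrt t * (1 / ?o j))"
        using E by (intro prod_mono) auto
      also have "\<dots> = (c / sqrt t) ^ n * ?P" by (simp only: prod.distrib) simp
      finally show ?thesis by (simp add: prod_norm)
    qed
    have P0: "?P \<ge> 0" by (intro prod_nonneg) auto
    have ne: "norm (exp (- \<alpha>)) = exp (- Re \<alpha>)" by (simp add: norm_exp_eq_Re)
    have Q: "?P * norm (exp (- \<alpha>)) ^ i \<le> K1 * (if i = 0 \<and> Re \<alpha> > 0 then 1 else exp (- t))"
    proof (cases "Re \<alpha> > 0")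
      case True
      have "?P \<le> (\<Prod>j=1..n. 2)"
      proof (rule prod_mono, intro conjI)
        fix j assume j: "j \<in> {1..n}"
        have "?o j \<ge> 1 / 2"
          using one_minus_exp_bounds(1)[OF \<beta>[rule_format, OF j], of \<alpha>] t(2) True by (simp add: t_def)
        moreover from this have "?o j > 0" by linarith
        ultimately show "1 / ?o j \<le> 2" by (simp add: pos_divide_le_eq)
      qed simp
      then have P: "?P \<le> K1" using K1 by simp
      have "exp (- t) ^ i \<le> (if i = 0 then 1 else exp (- t))"
      proof (cases "i = 0")
        case False
        then have "exp (- t) ^ i \<le> exp (- t) ^ 1" using t by (intro power_decreasing) auto
        then show ?thesis using False by simp
      qed simp
      then have "?P * exp (- t) ^ i \<le> K1 * (if i = 0 then 1 else exp (- t))"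
        using P P0 K1(2) by (intro mult_mono) auto
      then show ?thesis unfolding ne using True by (simp add: t_def split: if_splits)
    next
      case False
      have "?P \<le> (\<Prod>j=1..n. 2 * exp Bd * exp (- t))"
      proof (rule prod_mono, intro conjI)
        fix j assume j: "j \<in> {1..n}"
        have h: "exp (- Bd) / 2 * exp t \<le> ?o j"
          using one_minus_exp_bounds(3)[OF \<beta>[rule_format, OF j], of \<alpha>] t(2) False by (simp add: t_def)
        then have "1 / ?o j \<le> 1 / (exp (- Bd) / 2 * exp t)"
          by (intro divide_left_mono mult_pos_pos less_le_trans[OF _ h]) auto
        also have "\<dots> = 2 * exp Bd * exp (- t)" by (simp add: exp_minus field_simps)
        finally show "1 / ?o j \<le> 2 * exp Bd * exp (- t)" .
      qed simp
      also have "\<dots> = K1 * exp (- t) ^ n" unfolding K1_def by (simp add: power_mult_distrib)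
      finally have "?P * exp t ^ i \<le> K1 * exp (- t) ^ n * exp t ^ i" by (intro mult_right_mono) auto
      also have "exp (- t) ^ n = exp (- t) ^ (n - i) * exp (- t) ^ i" using i by (simp flip: power_add)
      also have "K1 * (exp (- t) ^ (n - i) * exp (- t) ^ i) * exp t ^ i = K1 * exp (- t) ^ (n - i) * (exp (- t) * exp t) ^ i"
        by (simp add: power_mult_distrib)
      also have "\<dots> = K1 * exp (- t) ^ (n - i)" by (simp flip: exp_add)
      also have "exp (- t) ^ (n - i) \<le> exp (- t) ^ 1" using t i by (intro power_decreasing) auto
      finally show ?thesis unfolding ne using False K1(2) by (simp add: t_def mult_left_mono)
    qed
    have a: "norm \<alpha> ^ k \<le> 2 ^ D * t ^ k"
    proof -
      have "norm \<alpha> \<le> 2 * t" using cmod_le[of \<alpha>] Im t(3) by (simp add: t_def)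
      then have "norm \<alpha> ^ k \<le> (2 * t) ^ k" by (intro power_mono) auto
      also have "\<dots> = 2 ^ k * t ^ k" by (simp add: power_mult_distrib)
      also have "\<dots> \<le> 2 ^ D * t ^ k" using k t by (intro mult_right_mono power_increasing) auto
      finally show ?thesis .
    qed
    have R: "norm (rational_factor \<beta> m \<alpha>) \<le> 2 ^ (n + 1) / t"
      using rational_factor_bounds(1)[OF Re Im] \<beta> m by (simp add: t_def)
    let ?F = "if i = 0 \<and> Re \<alpha> > 0 then 1 else exp (- t)"
    \<comment> \<open>One factor \<open>1 / sqrt t\<close> is kept in reserve; with the
      \<open>1 / t\<close> of \<open>rational_factor\<close> it gives the exponent -3/2. The
      factorial pays for a power of \<open>t\<close> against the exponential.\<close>
    have key: "(1 / sqrt t) ^ n * t ^ k * ?F \<le> fact (D + 1) * (1 / sqrt t)"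
    proof (cases "i = 0 \<and> Re \<alpha> > 0")
      case True
      then have "2 * k + 1 \<le> n" using ki by auto
      then have "(1 / sqrt t) ^ n \<le> (1 / sqrt t) ^ (2 * k + 1)" using st by (intro power_decreasing) auto
      also have "\<dots> = 1 / t ^ k * (1 / sqrt t)" using t by (simp add: power_mult power_divide)
      finally have "(1 / sqrt t) ^ n * t ^ k \<le> 1 / t ^ k * (1 / sqrt t) * t ^ k"
        using t by (intro mult_right_mono) auto
      also have "\<dots> = 1 / sqrt t" using t by simp
      also have "\<dots> \<le> fact (D + 1) * (1 / sqrt t)"
        using t fact_ge_1[of "D + 1", where 'a = real] by (intro mult_le_cancel_right1[THEN iffD2]) auto
      finally show ?thesis using True by simp
    next
      case False
      have "t ^ k * exp (- t) \<le> t ^ D * exp (- t)" using t k by (intro mult_right_mono power_increasing) auto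
      also have "\<dots> = t ^ (D + 1) * exp (- t) / t" using t by simp
      also have "\<dots> \<le> fact (D + 1) / t"
      proof (rule divide_right_mono)
        have "t ^ (D + 1) * exp (- t) \<le> fact (D + 1) * exp t * exp (- t)"
          using t by (intro mult_right_mono power_le_fact_exp) auto
        then show "t ^ (D + 1) * exp (- t) \<le> fact (D + 1)" by (simp add: mult.assoc flip: exp_add)
      qed (use t in auto)
      also have "\<dots> \<le> fact (D + 1) / sqrt t"
      proof (rule divide_left_mono)
        show "sqrt t \<le> t" using t by (intro real_le_lsqrt) (auto simp: power2_eq_square)
      qed (use t in auto)
      finally have h: "t ^ k * exp (- t) \<le> fact (D + 1) / sqrt t" .
      have "(1 / sqrt t) ^ n \<le> 1" using st by (intro power_le_one) auto
      then have "(1 / sqrt t) ^ n * (t ^ k * exp (- t)) \<le> 1 * (fact (D + 1) / sqrt t)"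
        using h t by (intro mult_mono) auto
      moreover have "?F = exp (- t)" using False by auto
      ultimately show ?thesis by (simp add: mult.assoc)
    qed
    have "norm (weight n \<beta> m \<alpha> * monom_exp k i \<alpha>) =
        norm (\<Prod>j=1..n. gamma_factor (\<beta> j) \<alpha>) * norm (rational_factor \<beta> m \<alpha>) * (norm \<alpha> ^ k * norm (exp (- \<alpha>)) ^ i)"
      by (simp only: weight_def monom_exp_def norm_mult norm_power)
    also have "\<dots> \<le> ((c / sqrt t) ^ n * ?P) * (2 ^ (n + 1) / t) * ((2 ^ D * t ^ k) * norm (exp (- \<alpha>)) ^ i)"
      using PE R a c0 P0 t by (intro mult_mono mult_right_mono) auto
    also have "\<dots> = c ^ n * 2 ^ (n + 1) * 2 ^ D * ((1 / sqrt t) ^ n * t ^ k / t * (?P * norm (exp (- \<alpha>)) ^ i))"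
      by (simp add: power_divide)
    also have "\<dots> \<le> c ^ n * 2 ^ (n + 1) * 2 ^ D * ((1 / sqrt t) ^ n * t ^ k / t * (K1 * ?F))"
      using c0 t by (intro mult_left_mono Q) auto
    also have "\<dots> = c ^ n * 2 ^ (n + 1) * 2 ^ D * K1 * ((1 / sqrt t) ^ n * t ^ k * ?F) / t"
      by simp
    also have "\<dots> \<le> c ^ n * 2 ^ (n + 1) * 2 ^ D * K1 * (fact (D + 1) * (1 / sqrt t)) / t"
      using c0 K1(2) t by (intro divide_right_mono mult_left_mono key) auto
    also have "\<dots> = c ^ n * 2 ^ (n + 1) * 2 ^ D * K1 * fact (D + 1) * (1 / (t * sqrt t))" by simp
    also have "\<dots> \<le> c ^ n * 2 ^ (n + 1) * 2 ^ D * K1 * fact (D + 1) * (4 * decay t)"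
      using c0 K1(2) by (intro mult_left_mono decay_lower_bound[OF t(1)]) auto
    also have "\<dots> = K * decay (Re \<alpha>)" by (simp add: K_def t_def decay_def)
    finally show "norm (weight n \<beta> m \<alpha> * monom_exp k i \<alpha>) \<le> K * decay (Re \<alpha>)" .
  qed
qed

text \<open>Far out on the positive real axis each \<open>1 - X x\<close> has norm at most 2, so the
  lower Gamma bound survives the division by it.\<close>

lemma weight_lower_bound:
  assumes \<beta>: "\<And>j. j \<in> {1..n} \<Longrightarrow> norm (\<beta> j) \<le> Bd" and m: "m \<in> {1..n}" and t: "t \<ge> 2 * Bd + 20"
  shows "norm (weight n \<beta> m (of_real t)) \<ge> (sqrt Gamma_quot_lower / 2) ^ n / 2 ^ (n + 1) / (t * sqrt t ^ n)"
proof -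
  let ?a = "complex_of_real t"
  have Bd: "Bd \<ge> 0" using \<beta>[OF m] norm_ge_zero[of "\<beta> m"] by linarith
  have Re: "\<bar>Re ?a\<bar> \<ge> 2 * Bd + 0 + 20" "\<bar>Im ?a\<bar> \<le> 0" using t Bd by auto
  have t0: "t > 0" using t Bd by linarith
  have E: "norm (gamma_factor (\<beta> j) ?a) \<ge> sqrt Gamma_quot_lower / 2 / sqrt t" if j: "j \<in> {1..n}" for j
  proof -
    let ?o = "norm (1 - exp (- ?a) * exp (\<beta> j))"
    note B = gamma_factor_bounds[OF Re \<beta>[OF j]]
    have "(sqrt Gamma_quot_lower / sqrt t)\<^sup>2 \<le> (norm (gamma_factor (\<beta> j) ?a) * ?o)\<^sup>2"
      using B(3) t0 by (simp add: power_divide Gamma_quot_lower_def)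
    then have "sqrt Gamma_quot_lower / sqrt t \<le> norm (gamma_factor (\<beta> j) ?a) * ?o"
      by (rule power2_le_imp_le) simp
    also have "\<dots> \<le> norm (gamma_factor (\<beta> j) ?a) * 2"
      using one_minus_exp_bounds(2)[OF \<beta>[OF j], of ?a] t Bd by (intro mult_left_mono) auto
    finally show ?thesis by simp
  qed
  have "(\<Prod>j=1..n. sqrt Gamma_quot_lower / 2 / sqrt t) \<le> (\<Prod>j=1..n. norm (gamma_factor (\<beta> j) ?a))"
    using E t0 by (intro prod_mono) (auto simp: Gamma_quot_lower_def)
  then have P: "(sqrt Gamma_quot_lower / 2 / sqrt t) ^ n \<le> norm (\<Prod>j=1..n. gamma_factor (\<beta> j) ?a)"
    by (simp add: prod_norm)
  have R: "1 / (2 ^ (n + 1) * t) \<le> norm (rational_factor \<beta> m ?a)"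
    using rational_factor_bounds(2)[OF Re \<beta> m] t0 by simp
  have "(sqrt Gamma_quot_lower / 2 / sqrt t) ^ n * (1 / (2 ^ (n + 1) * t)) \<le> norm (weight n \<beta> m ?a)"
    unfolding weight_def norm_mult using P R t0 by (intro mult_mono) auto
  then show ?thesis by (simp add: power_divide mult_ac)
qed

section \<open>Integrals depending on a parameter\<close>

text \<open>Morera's theorem: joint continuity lets the two integrations be exchanged, and the inner
  integral over a triangle vanishes by Cauchy's theorem.\<close>

lemma contour_integral_param_holomorphic:
  fixes F :: "complex \<Rightarrow> complex \<Rightarrow> complex"
  assumes U: "open U" and p: "valid_path p" "continuous_on {0..1} (\<lambda>t. vector_derivative p (at t))"
    and cont: "continuous_on (U \<times> path_image p) (\<lambda>(b, \<alpha>). F b \<alpha>)"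
    and holo: "\<And>\<alpha>. \<alpha> \<in> path_image p \<Longrightarrow> (\<lambda>b. F b \<alpha>) holomorphic_on U"
  shows "(\<lambda>b. contour_integral p (F b)) holomorphic_on U"
proof -
  have pc: "continuous_on {0..1} p" using p(1) by (auto simp: path_def dest: valid_path_imp_path)
  have c: "continuous_on U (\<lambda>b. contour_integral p (F b))"
  proof -
    have "continuous_on (U \<times> cbox 0 1) (\<lambda>x. (\<lambda>(b, \<alpha>). F b \<alpha>) (fst x, p (snd x)))"
      by (rule continuous_on_compose2[OF cont])
         (auto simp: path_image_def intro!: continuous_intros continuous_on_compose2[OF pc])
    moreover have "continuous_on (U \<times> cbox 0 1) (\<lambda>x. vector_derivative p (at (snd x)))"
      by (rule continuous_on_compose2[OF p(2)]) (auto intro: continuous_intros)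
    ultimately have "continuous_on (U \<times> cbox 0 1) (\<lambda>x. F (fst x) (p (snd x)) * vector_derivative p (at (snd x)))"
      by (intro continuous_on_mult) auto
    then have "continuous_on (U \<times> cbox 0 (1::real)) (\<lambda>(b, t). F b (p t) * vector_derivative p (at t))"
      by (simp add: case_prod_beta)
    then have "continuous_on U (\<lambda>b. integral (cbox 0 1) (\<lambda>t. F b (p t) * vector_derivative p (at t)))"
      by (rule integral_continuous_on_param)
    then show ?thesis by (simp only: contour_integral_integral box_real(2))
  qed
  have "(\<lambda>b. contour_integral p (F b)) analytic_on U"
  proof (rule Morera_triangle[OF c U], rule impI)
    fix x y z assume sub: "convex hull {x, y, z} \<subseteq> U"
    have segs: "closed_segment x y \<subseteq> U" "closed_segment y z \<subseteq> U" "closed_segment z x \<subseteq> U"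
      using order_trans[OF segments_subset_convex_hull(1) sub] order_trans[OF segments_subset_convex_hull(3) sub]
        order_trans[OF segments_subset_convex_hull(5) sub] by auto
    have swap: "contour_integral (linepath u w) (\<lambda>b. contour_integral p (F b)) =
        contour_integral p (\<lambda>\<alpha>. contour_integral (linepath u w) (\<lambda>b. F b \<alpha>))"
      if "closed_segment u w \<subseteq> U" for u w
    proof (rule contour_integral_swap)
      show "continuous_on (path_image (linepath u w) \<times> path_image p) (\<lambda>(y1, y2). F y1 y2)"
        by (rule continuous_on_subset[OF cont]) (use that in auto)
    qed (auto simp: p vector_derivative_linepath_at intro: continuous_intros)
    have ci: "(\<lambda>\<alpha>. contour_integral (linepath u w) (\<lambda>b. F b \<alpha>)) contour_integrable_on p"
      if s: "closed_segment u w \<subseteq> U" for u w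
    proof -
      have "continuous_on (path_image p \<times> cbox 0 1) (\<lambda>x. (\<lambda>(b, \<alpha>). F b \<alpha>) (linepath u w (snd x), fst x))"
      proof (rule continuous_on_compose2[OF cont])
        show "continuous_on (path_image p \<times> cbox 0 1) (\<lambda>x. (linepath u w (snd x), fst x))"
          unfolding linepath_def by (intro continuous_intros)
        have "linepath u w t \<in> U" if "t \<in> cbox 0 1" for t
          using s that linepath_image_01[of u w] by auto
        then show "(\<lambda>x. (linepath u w (snd x), fst x)) ` (path_image p \<times> cbox 0 1) \<subseteq> U \<times> path_image p" by auto
      qed
      then have "continuous_on (path_image p \<times> cbox 0 (1::real)) (\<lambda>(\<alpha>, t). F (linepath u w t) \<alpha> * (w - u))"
        by (simp add: case_prod_beta continuous_on_mult)
      then have "continuous_on (path_image p) (\<lambda>\<alpha>. integral (cbox 0 1) (\<lambda>t. F (linepath u w t) \<alpha> * (w - u)))"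
        by (rule integral_continuous_on_param)
      then have "continuous_on (path_image p) (\<lambda>\<alpha>. contour_integral (linepath u w) (\<lambda>b. F b \<alpha>))"
        by (simp only: contour_integral_integral box_real(2) vector_derivative_linepath_at)
      then have "continuous_on {0..1} (\<lambda>t. contour_integral (linepath u w) (\<lambda>b. F b (p t)) * vector_derivative p (at t))"
        by (intro continuous_on_mult p(2) continuous_on_compose2[OF _ pc]) (auto simp: path_image_def)
      then show ?thesis
        unfolding contour_integrable_on by (rule integrable_continuous_real)
    qed
    have zero: "contour_integral (linepath x y) (\<lambda>b. F b \<alpha>) + contour_integral (linepath y z) (\<lambda>b. F b \<alpha>) +
        contour_integral (linepath z x) (\<lambda>b. F b \<alpha>) = 0" if \<alpha>: "\<alpha> \<in> path_image p" for \<alpha>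
    proof -
      have h: "(\<lambda>b. F b \<alpha>) holomorphic_on (convex hull {x, y, z})"
        using holo[OF \<alpha>] sub by (rule holomorphic_on_subset)
      have "((\<lambda>b. F b \<alpha>) has_contour_integral 0) (linepath x y +++ linepath y z +++ linepath z x)"
        by (rule Cauchy_theorem_triangle[OF h])
      then show ?thesis by (rule has_chain_integral_chain_integral3)
    qed
    let ?S = "\<lambda>u w \<alpha>. contour_integral (linepath u w) (\<lambda>b. F b \<alpha>)"
    have "contour_integral p (?S x y) + contour_integral p (?S y z) + contour_integral p (?S z x) =
        contour_integral p (\<lambda>\<alpha>. ?S x y \<alpha> + ?S y z \<alpha> + ?S z x \<alpha>)"
      using ci[OF segs(1)] ci[OF segs(2)] ci[OF segs(3)]
      by (simp add: contour_integral_add contour_integrable_add)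
    also have "\<dots> = contour_integral p (\<lambda>\<alpha>. 0)" by (rule contour_integral_cong[OF refl]) (rule zero)
    finally show "contour_integral (linepath x y) (\<lambda>b. contour_integral p (F b)) +
        contour_integral (linepath y z) (\<lambda>b. contour_integral p (F b)) +
        contour_integral (linepath z x) (\<lambda>b. contour_integral p (F b)) = 0"
      unfolding swap[OF segs(1)] swap[OF segs(2)] swap[OF segs(3)] by simp
  qed
  then show ?thesis by (rule analytic_imp_holomorphic)
qed

text \<open>Truncations to a segment are holomorphic by the previous result. The dominating function
  is independent of \<open>b\<close>, so they converge uniformly on \<open>U\<close>.\<close>

lemma line_integral_param_holomorphic:
  fixes F :: "complex \<Rightarrow> complex \<Rightarrow> complex"
  assumes U: "open U"
    and cont: "continuous_on (U \<times> {\<alpha>. Im \<alpha> = y}) (\<lambda>(b, \<alpha>). F b \<alpha>)"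
    and holo: "\<And>\<alpha>. Im \<alpha> = y \<Longrightarrow> (\<lambda>b. F b \<alpha>) holomorphic_on U"
    and K: "\<And>b t. b \<in> U \<Longrightarrow> T0 \<le> \<bar>t\<bar> \<Longrightarrow> norm (F b (Complex t y)) \<le> K * decay t"
  shows "(\<lambda>b. LINT t|lborel. F b (Complex t y)) holomorphic_on U"
    "\<And>b. b \<in> U \<Longrightarrow> integrable lborel (\<lambda>t. F b (Complex t y))"
proof -
  have lc: "continuous_on A (\<lambda>t. Complex t y)" for A unfolding Complex_eq by (intro continuous_intros)
  have hc: "continuous_on UNIV (\<lambda>t. F b (Complex t y))" if "b \<in> U" for b
  proof -
    have "continuous_on UNIV (\<lambda>t. (\<lambda>(b, \<alpha>). F b \<alpha>) (b, Complex t y))"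
      by (rule continuous_on_compose2[OF cont continuous_on_Pair[OF continuous_on_const lc]]) (use that in auto)
    then show ?thesis by simp
  qed
  show int: "integrable lborel (\<lambda>t. F b (Complex t y))" if "b \<in> U" for b
    by (rule integrable_decaying[OF hc[OF that] K[OF that]])
  define A where "A = (\<lambda>N::nat. \<lambda>b. contour_integral (linepath (Complex (- real (Suc N)) y) (Complex (real (Suc N)) y)) (F b))"
  have A_eq: "A N b = integral {- real (Suc N)..real (Suc N)} (\<lambda>t. F b (Complex t y))" if b: "b \<in> U" for N b
  proof -
    let ?T = "real (Suc N)"
    have C1l: "(\<lambda>t. Complex t y) C1_differentiable_on UNIV"
      unfolding C1_differentiable_on_def
      by (intro exI[of _ "\<lambda>_. 1"]) (auto simp: Complex_eq intro!: derivative_eq_intros)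
    have vd: "vector_derivative (\<lambda>t. Complex t y) (at t) = 1" for t
      by (rule vector_derivative_at) (auto simp: Complex_eq intro!: derivative_eq_intros)
    have "continuous_on ((\<lambda>t. Complex t y) ` {-?T..?T}) (F b)"
    proof -
      have "continuous_on ((\<lambda>t. Complex t y) ` {-?T..?T}) (\<lambda>\<alpha>. (\<lambda>(b, \<alpha>). F b \<alpha>) (b, \<alpha>))"
        by (rule continuous_on_compose2[OF cont continuous_on_Pair[OF continuous_on_const continuous_on_id]])
           (use b in auto)
      then show ?thesis by simp
    qed
    from contour_integral_affine_curve(1)[OF C1l _ this]
    have "contour_integral (\<lambda>s. Complex (2 * ?T * s - ?T) y) (F b) = integral {-?T..?T} (\<lambda>t. F b (Complex t y))"
      by (simp add: vd)
    moreover have "(\<lambda>s. Complex (2 * ?T * s - ?T) y) = linepath (Complex (-?T) y) (Complex ?T y)"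
      by (auto simp: linepath_def complex_eq_iff algebra_simps)
    ultimately show ?thesis unfolding A_def by simp
  qed
  have A_holo: "A N holomorphic_on U" for N
    unfolding A_def
  proof (rule contour_integral_param_holomorphic[OF U])
    have i: "Im w = y" if "w \<in> path_image (linepath (Complex (- real (Suc N)) y) (Complex (real (Suc N)) y))" for w
      using that by (auto dest: Im_closed_segment)
    then show "continuous_on (U \<times> path_image (linepath (Complex (- real (Suc N)) y) (Complex (real (Suc N)) y))) (\<lambda>(b, \<alpha>). F b \<alpha>)"
      by (intro continuous_on_subset[OF cont]) auto
    show "\<And>\<alpha>. \<alpha> \<in> path_image (linepath (Complex (- real (Suc N)) y) (Complex (real (Suc N)) y)) \<Longrightarrow> (\<lambda>b. F b \<alpha>) holomorphic_on U"
      using holo i by blast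
  qed (auto simp: vector_derivative_linepath_at)
  \<comment> \<open>The tail of the dominating function bounds the truncation error for all
    \<open>b\<close> at once.\<close>
  define e where "e = (\<lambda>N::nat. LINT t|lborel. indicator (- {- real (Suc N)..real (Suc N)}) t *\<^sub>R (\<bar>K\<bar> * decay t))"
  have dK: "integrable lborel (\<lambda>t. \<bar>K\<bar> * decay t)" using integrable_decay by simp
  have e0: "e \<longlonglongrightarrow> 0"
  proof -
    have "e \<longlonglongrightarrow> (LINT t::real|lborel. (0::real))" unfolding e_def
    proof (rule integral_dominated_convergence)
      show "integrable lborel (\<lambda>t. norm (\<bar>K\<bar> * decay t))" using dK by (rule integrable_norm)
      show "AE x in lborel. (\<lambda>N. indicator (- {- real (Suc N)..real (Suc N)}) x *\<^sub>R (\<bar>K\<bar> * decay x)) \<longlonglongrightarrow> 0"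
      proof (rule AE_I2, rule tendsto_eventually)
        fix x :: real
        obtain N0 :: nat where "\<bar>x\<bar> \<le> real N0" using real_arch_simple by blast
        then show "\<forall>\<^sub>F N in sequentially. indicator (- {- real (Suc N)..real (Suc N)}) x *\<^sub>R (\<bar>K\<bar> * decay x) = 0"
          using eventually_ge_at_top[of N0] by (elim eventually_mono) (auto simp: indicator_def)
      qed
      show "\<And>N. AE x in lborel. norm (indicator (- {- real (Suc N)..real (Suc N)}) x *\<^sub>R (\<bar>K\<bar> * decay x)) \<le> norm (\<bar>K\<bar> * decay x)"
        by (rule AE_I2) (auto simp: indicator_def)
    qed (use dK in measurable)
    then show ?thesis by simp
  qed
  have bound: "norm (A N b - (LINT t|lborel. F b (Complex t y))) \<le> e N" if b: "b \<in> U" and N: "T0 \<le> real N" for N b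
  proof -
    let ?I = "{- real (Suc N)..real (Suc N)}" and ?h = "\<lambda>t. F b (Complex t y)"
    have i1: "integrable lborel (\<lambda>t. indicator ?I t *\<^sub>R ?h t)" "integrable lborel (\<lambda>t. indicator (- ?I) t *\<^sub>R ?h t)"
      using int[OF b] by (auto intro!: integrable_mult_indicator)
    have "set_integrable lborel ?I ?h" unfolding set_integrable_def by (rule i1)
    then have "A N b = (LINT t|lborel. indicator ?I t *\<^sub>R ?h t)"
      using A_eq[OF b] set_borel_integral_eq_integral(2)[of ?I ?h] unfolding set_lebesgue_integral_def by (simp only:)
    moreover have "(LINT t|lborel. ?h t) = (LINT t|lborel. indicator ?I t *\<^sub>R ?h t + indicator (- ?I) t *\<^sub>R ?h t)"
      by (rule Bochner_Integration.integral_cong[OF refl]) (auto simp: indicator_def)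
    ultimately have "A N b - (LINT t|lborel. ?h t) = - (LINT t|lborel. indicator (- ?I) t *\<^sub>R ?h t)"
      using i1 by simp
    then have "norm (A N b - (LINT t|lborel. ?h t)) = norm (LINT t|lborel. indicator (- ?I) t *\<^sub>R ?h t)" by simp
    also have "\<dots> \<le> e N"
      unfolding e_def
    proof (rule order_trans[OF integral_norm_bound], rule integral_mono)
      show "integrable lborel (\<lambda>t. norm (indicator (- ?I) t *\<^sub>R ?h t))" using i1(2) by (rule integrable_norm)
      show "integrable lborel (\<lambda>t. indicator (- ?I) t *\<^sub>R (\<bar>K\<bar> * decay t))"
        by (rule integrable_mult_indicator[OF _ dK]) simp
      fix t
      have "norm (?h t) \<le> \<bar>K\<bar> * decay t" if "t \<notin> ?I"
      proof -
        have "norm (?h t) \<le> K * decay t" using that N by (intro K[OF b]) auto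
        also have "\<dots> \<le> \<bar>K\<bar> * decay t" using decay_pos[of t] by (intro mult_right_mono) auto
        finally show ?thesis .
      qed
      then show "norm (indicator (- ?I) t *\<^sub>R ?h t) \<le> indicator (- ?I) t *\<^sub>R (\<bar>K\<bar> * decay t)"
        by (auto simp: indicator_def)
    qed
    finally show ?thesis .
  qed
  show "(\<lambda>b. LINT t|lborel. F b (Complex t y)) holomorphic_on U"
  proof (rule holomorphic_uniform_sequence[OF U A_holo])
    fix x assume "x \<in> U"
    then obtain d where d: "d > 0" "cball x d \<subseteq> U" using U open_contains_cball by blast
    have "uniform_limit (cball x d) A (\<lambda>b. LINT t|lborel. F b (Complex t y)) sequentially"
      unfolding uniform_limit_iff
    proof (intro allI impI)
      fix \<epsilon> :: real assume "\<epsilon> > 0"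
      then have ev: "\<forall>\<^sub>F N in sequentially. e N < \<epsilon>" by (rule order_tendstoD(2)[OF e0])
      obtain N0 :: nat where N0: "T0 \<le> real N0" using real_arch_simple by blast
      from ev eventually_ge_at_top[of N0]
      show "\<forall>\<^sub>F N in sequentially. \<forall>b\<in>cball x d. dist (A N b) (LINT t|lborel. F b (Complex t y)) < \<epsilon>"
      proof eventually_elim
        case (elim N)
        with N0 have "T0 \<le> real N" by linarith
        then show ?case using bound[of _ N] d(2) elim(1) unfolding dist_norm by (meson le_less_trans subsetD)
      qed
    qed
    then show "\<exists>d>0. cball x d \<subseteq> U \<and> uniform_limit (cball x d) A (\<lambda>b. LINT t|lborel. F b (Complex t y)) sequentially"
      using d by blast
  qed
qed

section \<open>Residues at the pinching points\<close>

text \<open>The lattice is the solution set of \<open>exp (2 * (x - c)) = 1\<close>. Off it the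
  claim is continuity; at a lattice point the neighbours have distance at least \<pi>, hence more
  than 1.\<close>

lemma eventually_not_in_lattice:
  fixes c x0 :: complex
  shows "\<forall>\<^sub>F x in at x0. \<forall>k::int. x \<noteq> c + of_int k * pi * \<i>"
proof -
  have one: "exp (2 * (x - c)) = 1" if "x = c + of_int k * pi * \<i>" for x and k :: int
    using that by (auto simp: exp_eq_1)
  show ?thesis
  proof (cases "exp (2 * (x0 - c)) = 1")
    case False
    have "(\<lambda>x. exp (2 * (x - c))) \<midarrow>x0\<rightarrow> exp (2 * (x0 - c))" by (intro tendsto_intros)
    then have "\<forall>\<^sub>F x in at x0. exp (2 * (x - c)) \<noteq> 1" using False by (rule tendsto_imp_eventually_ne)
    then show ?thesis by eventually_elim (use one in blast)
  next
    case True
    have "\<forall>\<^sub>F x in at x0. x \<noteq> x0 \<and> dist x x0 < 1" by (auto simp: eventually_at intro: exI[of _ 1])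
    then show ?thesis
    proof eventually_elim
      case (elim x)
      show ?case
      proof (intro allI notI)
        fix k :: int assume "x = c + of_int k * pi * \<i>"
        from one[OF this] have "exp (2 * (x - c)) / exp (2 * (x0 - c)) = 1" using True by simp
        then have "exp (2 * (x - x0)) = 1" by (simp add: exp_diff[symmetric] algebra_simps)
        then obtain m :: int where "Re (2 * (x - x0)) = 0" "Im (2 * (x - x0)) = of_int (2 * m) * pi"
          by (auto simp: exp_eq_1)
        then have m: "Re x = Re x0" "Im x - Im x0 = of_int m * pi" by auto
        have "\<bar>Im (x - x0)\<bar> < 1" using elim abs_Im_le_cmod[of "x - x0"] by (simp add: dist_norm)
        then have "\<bar>of_int m * pi\<bar> < 1" using m by simp
        then have "\<bar>real_of_int m\<bar> * pi < 1" by (simp add: abs_mult)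
        have "m = 0"
        proof (rule ccontr)
          assume "m \<noteq> 0"
          then have "real_of_int 1 \<le> real_of_int \<bar>m\<bar>" by (subst of_int_le_iff) auto
          then have "1 * pi \<le> \<bar>real_of_int m\<bar> * pi" by (intro mult_right_mono) auto
          then show False using \<open>\<bar>real_of_int m\<bar> * pi < 1\<close> pi_gt3 by linarith
        qed
        then show False using m elim by (auto simp: complex_eq_iff)
      qed
    qed
  qed
qed

lemma gamma_poles_lattice: "\<alpha> \<in> gamma_poles b \<Longrightarrow> \<exists>k::int. \<alpha> = b + of_int k * pi * \<i>"
proof -
  assume "\<alpha> \<in> gamma_poles b"
  then consider k :: nat where "\<alpha> = b - pi * \<i> + 2 * of_nat k * pi * \<i>" | k :: nat where "\<alpha> = b - 2 * of_nat (Suc k) * pi * \<i>"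
    unfolding gamma_poles_def by blast
  then show ?thesis
  proof cases
    case (1 k)
    then show ?thesis by (intro exI[of _ "2 * int k - 1"]) (simp add: algebra_simps)
  next
    case (2 k)
    then show ?thesis by (intro exI[of _ "- 2 * int (Suc k)"]) (simp add: algebra_simps)
  qed
qed

lemma int_ne_half: "2 * of_nat k \<noteq> (1 :: complex)"
proof
  assume "2 * of_nat k = (1 :: complex)"
  then have "of_nat (2 * k) = (of_nat 1 :: complex)" by simp
  then have "2 * k = 1" unfolding of_nat_eq_iff .
  then show False by presburger
qed

lemma self_not_in_gamma_poles: "b \<notin> gamma_poles b"
proof
  assume "b \<in> gamma_poles b"
  then consider k :: nat where "b = b - pi * \<i> + 2 * of_nat k * pi * \<i>" | k :: nat where "b = b - 2 * of_nat (Suc k) * pi * \<i>"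
    unfolding gamma_poles_def by blast
  then show False
  proof cases
    case (1 k)
    then have "(2 * of_nat k - 1) * (pi * \<i>) = 0" by (simp add: algebra_simps)
    then have "2 * of_nat k = (1 :: complex)" by simp
    then show False using int_ne_half by blast
  next
    case (2 k)
    then have "of_nat (Suc k) * (2 * pi * \<i>) = 0" by (simp add: algebra_simps)
    then show False by (simp del: of_nat_Suc)
  qed
qed

lemma gamma_factor_shift: "gamma_factor b \<alpha> = gamma_factor 0 (\<alpha> - b)"
  by (simp add: gamma_factor_def zeta_arg_def)

text \<open>These are the differences met at the pinching points: \<pi> i for \<open>base\<close>
  and \<beta> (n - 1), and - \<pi> i and - 2 \<pi> i at the others. The recurrence of Gamma is used
  twice for \<pi> i, where the argument tends to -1, and once otherwise, where it tends to
  0.\<close>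

lemma gamma_factor_simple_pole:
  assumes "x0 \<in> {pi * \<i>, - pi * \<i>, - 2 * pi * \<i>}"
  obtains h where "h analytic_on {x0}" "\<forall>\<^sub>F x in at x0. gamma_factor 0 x = h x / (x - x0)"
proof -
  let ?z = "\<lambda>x. zeta_arg 0 x"
  have ev: "\<forall>\<^sub>F x in at x0. ?z x - 1/2 \<notin> \<int>\<^sub>\<le>\<^sub>0 \<and> 1 - ?z x \<notin> \<int>\<^sub>\<le>\<^sub>0 \<and> x \<noteq> x0"
    using eventually_not_in_lattice[of 0 x0] eventually_neq_at_within[of x0 x0 UNIV]
  proof eventually_elim
    case (elim x)
    then have "x \<notin> gamma_poles 0" using gamma_poles_lattice[of x 0] by auto
    then show ?case using gamma_args_regular elim by blast
  qed
  have shift: "Gamma z = Gamma (z + 1) / z" if "z \<notin> \<int>\<^sub>\<le>\<^sub>0" for z :: complex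
  proof -
    have "z \<noteq> 0" using that by auto
    then show ?thesis using Gamma_plus1[OF that] by simp
  qed
  have succ: "z + 1 \<notin> \<int>\<^sub>\<le>\<^sub>0" if "z \<notin> \<int>\<^sub>\<le>\<^sub>0" for z :: complex
  proof
    assume "z + 1 \<in> \<int>\<^sub>\<le>\<^sub>0"
    then obtain k where "z + 1 = - of_nat k" by (rule nonpos_Ints_cases')
    then have "z = - of_nat k - 1" by (simp add: eq_diff_eq)
    then have "z = - of_nat (Suc k)" by simp
    then show False using that by (metis minus_of_nat_in_nonpos_Ints)
  qed
  have za: "?z analytic_on {x0}" unfolding zeta_arg_def by (intro analytic_intros) auto
  have np: "of_nat 1 \<notin> (\<int>\<^sub>\<le>\<^sub>0 :: complex set)" "1 \<notin> (\<int>\<^sub>\<le>\<^sub>0 :: complex set)" "3/2 \<notin> (\<int>\<^sub>\<le>\<^sub>0 :: complex set)" "1/2 \<notin> (\<int>\<^sub>\<le>\<^sub>0 :: complex set)"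
    by (auto elim!: nonpos_Ints_cases simp: complex_eq_iff)
  consider "x0 = - pi * \<i>" | "x0 = pi * \<i>" | "x0 = - 2 * pi * \<i>" using assms by auto
  then show thesis
  proof cases
    case 1
    have z0: "?z x0 = 1/2" by (simp add: 1 zeta_arg_def)
    let ?h = "\<lambda>x. \<i> / (2 * pi) * exp (x / 2) * (- 2 * pi * \<i> * Gamma (?z x + 1/2)) * Gamma (1 - ?z x)"
    show thesis
    proof (rule that[of ?h])
      show "?h analytic_on {x0}"
        using np by (intro analytic_intros za) (auto simp: z0)
      show "\<forall>\<^sub>F x in at x0. gamma_factor 0 x = ?h x / (x - x0)"
        using ev
      proof eventually_elim
        case (elim x)
        have d: "?z x - 1/2 = (x - x0) / (- 2 * pi * \<i>)" by (simp add: 1 zeta_arg_def field_simps)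
        have "Gamma (?z x - 1/2) = Gamma (?z x + 1/2) / (?z x - 1/2)"
          using shift[of "?z x - 1/2"] elim by (simp add: add.commute)
        also have "\<dots> = - 2 * pi * \<i> * Gamma (?z x + 1/2) / (x - x0)" by (subst d) simp
        finally have G: "Gamma (?z x - 1/2) = - 2 * pi * \<i> * Gamma (?z x + 1/2) / (x - x0)" .
        show ?case unfolding gamma_factor_def G by (simp only: times_divide_eq_left times_divide_eq_right diff_0_right)
      qed
    qed
  next
    case 2
    have z0: "?z x0 = - 1/2" by (simp add: 2 zeta_arg_def)
    let ?h = "\<lambda>x. \<i> / (2 * pi) * exp (x / 2) * (- 2 * pi * \<i> * (Gamma (?z x + 3/2) / (?z x - 1/2))) * Gamma (1 - ?z x)"
    show thesis
    proof (rule that[of ?h])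
      show "?h analytic_on {x0}"
        using np by (intro analytic_intros za) (auto simp: z0)
      show "\<forall>\<^sub>F x in at x0. gamma_factor 0 x = ?h x / (x - x0)"
        using ev
      proof eventually_elim
        case (elim x)
        have "Gamma (?z x - 1/2) = Gamma (?z x + 1/2) / (?z x - 1/2)"
          using shift[of "?z x - 1/2"] elim by (simp add: add.commute)
        also have "Gamma (?z x + 1/2) = Gamma (?z x + 3/2) / (?z x + 1/2)"
          using shift[of "?z x + 1/2"] succ[of "?z x - 1/2"] elim by (simp add: add.commute)
        also have "?z x + 1/2 = (x - x0) / (- 2 * pi * \<i>)" by (simp add: 2 zeta_arg_def field_simps)
        also have "Gamma (?z x + 3/2) / ((x - x0) / (- 2 * pi * \<i>)) / (?z x - 1/2) =
            - 2 * pi * \<i> * (Gamma (?z x + 3/2) / (?z x - 1/2)) / (x - x0)" by (simp add: mult_ac)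
        finally have G: "Gamma (?z x - 1/2) = - 2 * pi * \<i> * (Gamma (?z x + 3/2) / (?z x - 1/2)) / (x - x0)" .
        show ?case unfolding gamma_factor_def G by (simp only: times_divide_eq_left times_divide_eq_right diff_0_right)
      qed
    qed
  next
    case 3
    have z0: "?z x0 = 1" by (simp add: 3 zeta_arg_def)
    let ?h = "\<lambda>x. \<i> / (2 * pi) * exp (x / 2) * Gamma (?z x - 1/2) * (2 * pi * \<i> * Gamma (2 - ?z x))"
    show thesis
    proof (rule that[of ?h])
      show "?h analytic_on {x0}"
        using np by (intro analytic_intros za) (auto simp: z0)
      show "\<forall>\<^sub>F x in at x0. gamma_factor 0 x = ?h x / (x - x0)"
        using ev
      proof eventually_elim
        case (elim x)
        have d: "1 - ?z x = (x - x0) / (2 * pi * \<i>)" by (simp add: 3 zeta_arg_def field_simps)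
        have "Gamma (1 - ?z x) = Gamma (2 - ?z x) / (1 - ?z x)"
          using shift[of "1 - ?z x"] elim by (simp add: add.commute)
        also have "\<dots> = 2 * pi * \<i> * Gamma (2 - ?z x) / (x - x0)" by (subst d) simp
        finally have G: "Gamma (1 - ?z x) = 2 * pi * \<i> * Gamma (2 - ?z x) / (x - x0)" .
        show ?case unfolding gamma_factor_def G by (simp only: times_divide_eq_left times_divide_eq_right diff_0_right)
      qed
    qed
  qed
qed

section \<open>Residue coefficients at the colliding points\<close>

lemma residue_simple_pole_mult:
  assumes "H analytic_on {p}" "u analytic_on {p}" "\<forall>\<^sub>F \<alpha> in at p. f \<alpha> = H \<alpha> / (\<alpha> - p)"
  shows "residue (\<lambda>\<alpha>. f \<alpha> * u \<alpha>) p = H p * u p"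
proof -
  have "(\<lambda>\<alpha>. H \<alpha> * u \<alpha>) analytic_on {p}" by (intro analytic_intros assms)
  then obtain S where S: "open S" "p \<in> S" "(\<lambda>\<alpha>. H \<alpha> * u \<alpha>) holomorphic_on S"
    unfolding analytic_at by blast
  have "residue (\<lambda>\<alpha>. f \<alpha> * u \<alpha>) p = residue (\<lambda>\<alpha>. (H \<alpha> * u \<alpha>) / (\<alpha> - p)) p"
    by (rule residue_cong[OF _ refl]) (use assms(3) in eventually_elim, simp)
  also have "\<dots> = H p * u p" by (rule residue_simple[OF S])
  finally show ?thesis .
qed

lemma analytic_compose_at:
  assumes "h analytic_on {x0}" "f analytic_on {b0}" "f b0 = x0"
  shows "(\<lambda>b. h (f b)) analytic_on {b0}"
  using analytic_on_compose[of f "{b0}" h] assms by (simp add: o_def)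

text \<open>The assumption keeps the singularities belonging to earlier parameters away from the
  colliding points, so that each residue below has one factor singular in \<open>b\<close> and
  otherwise factors analytic at \<open>base\<close>.\<close>

locale pinching =
  fixes n :: nat and \<beta> :: "nat \<Rightarrow> complex"
  assumes n2: "n \<ge> 2"
    and generic: "\<And>j k. j \<in> {1..<n - 1} \<Longrightarrow> \<beta> (n - 1) - \<beta> j \<noteq> of_int k * pi * \<i>"
begin

definition base :: complex where "base = \<beta> (n - 1) + pi * \<i>"

text \<open>At \<open>b = base\<close> these lower points meet the upper family: \<open>b\<close>
  and \<open>b - 2 * pi * \<i>\<close> become the upper points \<beta> (n - 1) + \<pi> i and \<beta>
  (n - 1) - \<pi> i, and \<beta> (n - 1) becomes the upper point \<open>b - pi * \<i>\<close>. The
  number 0 stays free and will mean that no residue is taken.\<close>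

definition pinch_point :: "nat \<Rightarrow> complex \<Rightarrow> complex" where
  "pinch_point s b = (if s = 1 then b else if s = 2 then \<beta> (n - 1) else b - 2 * pi * \<i>)"

text \<open>The residue of the weight at the \<open>s\<close>-th pinching point is \<open>c b / (b - base)\<close>.\<close>

definition pinch_coeff :: "nat \<Rightarrow> nat \<Rightarrow> (complex \<Rightarrow> complex) \<Rightarrow> bool" where
  "pinch_coeff s m c \<longleftrightarrow> c analytic_on {base} \<and>
     (\<forall>\<^sub>F b in at base. \<exists>H. H analytic_on {pinch_point s b} \<and>
        (\<forall>\<^sub>F \<alpha> in at (pinch_point s b). weight n (\<beta>(n := b)) m \<alpha> = H \<alpha> / (\<alpha> - pinch_point s b)) \<and>
        H (pinch_point s b) = c b / (b - base))"

lemma prod_split_last_two: "(\<Prod>j=1..n. f j) = (\<Prod>j\<in>{1..<n - 1}. f j) * f (n - 1) * f n"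
proof -
  have "{1..n} = insert n (insert (n - 1) {1..<n - 1})" using n2 by auto
  moreover have "n \<notin> insert (n - 1) {1..<n - 1}" "n - 1 \<notin> {1..<n - 1}" using n2 by auto
  ultimately show ?thesis by (simp add: mult_ac)
qed

lemma generic_lattice:
  assumes "j \<in> {1..<n - 1}"
  shows "\<beta> (n - 1) + of_int k * pi * \<i> \<noteq> \<beta> j + of_int k' * pi * \<i>"
proof
  assume "\<beta> (n - 1) + of_int k * pi * \<i> = \<beta> j + of_int k' * pi * \<i>"
  then have "\<beta> (n - 1) - \<beta> j = of_int (k' - k) * pi * \<i>" by (simp add: algebra_simps)
  then show False using generic[OF assms] by blast
qed

lemma generic_regular:
  assumes j: "j \<in> {1..<n - 1}"
  shows "\<beta> (n - 1) + of_int k * pi * \<i> \<notin> gamma_poles (\<beta> j)" "\<beta> (n - 1) + of_int k * pi * \<i> - \<beta> j \<noteq> 0"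
proof -
  show "\<beta> (n - 1) + of_int k * pi * \<i> \<notin> gamma_poles (\<beta> j)"
    using gamma_poles_lattice generic_lattice[OF j] by blast
  show "\<beta> (n - 1) + of_int k * pi * \<i> - \<beta> j \<noteq> 0"
    using generic_lattice[OF j, of k 0] by auto
qed

lemma base_shift: "base = \<beta> (n - 1) + of_int 1 * pi * \<i>" "base - 2 * pi * \<i> = \<beta> (n - 1) + of_int (-1) * pi * \<i>"
  by (simp_all add: base_def algebra_simps)

lemma eventually_off_lattices:
  "\<forall>\<^sub>F b in at base. b \<noteq> base \<and> (\<forall>j\<in>{1..<n}. \<forall>k::int. b \<noteq> \<beta> j + of_int k * pi * \<i>)"
proof -
  have "\<forall>\<^sub>F b in at base. \<forall>j\<in>{1..<n}. \<forall>k::int. b \<noteq> \<beta> j + of_int k * pi * \<i>"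
    by (rule eventually_ball_finite) (simp, intro ballI eventually_not_in_lattice)
  then show ?thesis using eventually_neq_at_within[of base base UNIV] by eventually_elim auto
qed

lemma gamma_regular_shift:
  assumes b: "\<And>k::int. b \<noteq> c + of_int k * pi * \<i>"
  shows "b + of_int k * pi * \<i> \<notin> gamma_poles c" "c \<notin> gamma_poles b" "b + of_int k * pi * \<i> - c \<noteq> 0"
proof -
  show "b + of_int k * pi * \<i> \<notin> gamma_poles c"
  proof
    assume "b + of_int k * pi * \<i> \<in> gamma_poles c"
    then obtain k' :: int where "b + of_int k * pi * \<i> = c + of_int k' * pi * \<i>" using gamma_poles_lattice by blast
    then have "b = c + of_int (k' - k) * pi * \<i>" by (simp add: algebra_simps)
    then show False using b by blast
  qed
  show "c \<notin> gamma_poles b"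
  proof
    assume "c \<in> gamma_poles b"
    then obtain k' :: int where "c = b + of_int k' * pi * \<i>" using gamma_poles_lattice by blast
    then have "b = c + of_int (- k') * pi * \<i>" by (simp add: algebra_simps)
    then show False using b by blast
  qed
  show "b + of_int k * pi * \<i> - c \<noteq> 0"
  proof
    assume "b + of_int k * pi * \<i> - c = 0"
    then have "b = c + of_int (- k) * pi * \<i>" by (simp add: algebra_simps)
    then show False using b by blast
  qed
qed

lemma analytic_const_gamma:
  assumes "p \<notin> gamma_poles c"
  shows "(\<lambda>\<alpha>. gamma_factor c \<alpha>) analytic_on {p}"
  using assms by (intro gamma_factor_analytic analytic_intros) auto

text \<open>A regular point counts as a simple pole whose numerator vanishes there.\<close>

lemma pinch_coeff_zero:
  assumes "\<forall>\<^sub>F b in at base. weight n (\<beta>(n := b)) m analytic_on {pinch_point s b}"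
  shows "pinch_coeff s m (\<lambda>_. 0)"
  unfolding pinch_coeff_def
proof (intro conjI)
  show "\<forall>\<^sub>F b in at base. \<exists>H. H analytic_on {pinch_point s b} \<and>
      (\<forall>\<^sub>F \<alpha> in at (pinch_point s b). weight n (\<beta>(n := b)) m \<alpha> = H \<alpha> / (\<alpha> - pinch_point s b)) \<and>
      H (pinch_point s b) = 0 / (b - base)"
    using assms
  proof eventually_elim
    case (elim b)
    let ?p = "pinch_point s b"
    have "\<forall>\<^sub>F \<alpha> in at ?p. weight n (\<beta>(n := b)) m \<alpha> = (\<alpha> - ?p) * weight n (\<beta>(n := b)) m \<alpha> / (\<alpha> - ?p)"
      using eventually_neq_at_within[of ?p ?p UNIV] by eventually_elim simp
    then show ?case
      by (intro exI[of _ "\<lambda>\<alpha>. (\<alpha> - ?p) * weight n (\<beta>(n := b)) m \<alpha>"])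
         (auto intro!: analytic_intros elim)
  qed
qed (intro analytic_intros)

text \<open>For \<open>b\<close> off the lattices all Gamma factors are regular in \<alpha> at
  \<open>\<alpha> = b\<close>, so only \<open>1 / (\<alpha> - b)\<close> can produce a pole, and
  that needs \<open>m = n\<close>. The pole in \<open>b\<close> comes from the Gamma factor of
  \<beta> (n - 1), at difference \<pi> i.\<close>

lemma pinch_coeff_1:
  assumes m: "m \<in> {1..n}"
  shows "\<exists>c. pinch_coeff 1 m c \<and> (m < n \<longrightarrow> c = (\<lambda>_. 0))"
proof (cases "m = n")
  case False
  have "pinch_coeff 1 m (\<lambda>_. 0)"
  proof (rule pinch_coeff_zero)
    show "\<forall>\<^sub>F b in at base. weight n (\<beta>(n := b)) m analytic_on {pinch_point 1 b}"
      using eventually_off_lattices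
    proof eventually_elim
      case (elim b)
      have r: "b \<notin> gamma_poles (\<beta> j)" "b - \<beta> j \<noteq> 0" if "j \<in> {1..<n}" for j
        using gamma_regular_shift(1,3)[of b "\<beta> j" 0] elim that by auto
      have "(\<lambda>\<alpha>. gamma_factor ((\<beta>(n := b)) j) \<alpha>) analytic_on {b}" if "j \<in> {1..n}" for j
        using r[of j] that self_not_in_gamma_poles by (intro analytic_const_gamma) auto
      moreover have "(\<beta>(n := b)) j = \<beta> j" if "j \<in> {1..<m} \<union> {m}" for j using that m False by auto
      ultimately show ?case
        unfolding weight_def rational_factor_def pinch_point_def using m False r
        by (intro analytic_intros analytic_on_prod) auto
    qed
  qed
  then show ?thesis by blast
next
  case True
  obtain h where h: "h analytic_on {pi * \<i>}" "\<forall>\<^sub>F x in at (pi * \<i>). gamma_factor 0 x = h x / (x - pi * \<i>)"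
    using gamma_factor_simple_pole[of "pi * \<i>"] by blast
  let ?R = "\<lambda>\<alpha>. \<Prod>j=1..<n. (\<alpha> - \<beta> j + pi * \<i>) / (\<alpha> - \<beta> j)"
  define c where "c = (\<lambda>b. (\<Prod>j\<in>{1..<n - 1}. gamma_factor (\<beta> j) b) * h (b - \<beta> (n - 1)) * gamma_factor 0 0 * ?R b)"
  have "pinch_coeff 1 n c"
    unfolding pinch_coeff_def
  proof (intro conjI)
    have bj: "base - \<beta> j \<noteq> 0" if "j \<in> {1..<n}" for j
    proof (cases "j = n - 1")
      case False
      then have "j \<in> {1..<n - 1}" using that by auto
      then show ?thesis using generic_regular(2)[of j 1] by (simp add: base_def)
    qed (simp add: base_def)
    have "(\<lambda>b. h (b - \<beta> (n - 1))) analytic_on {base}"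
      by (rule analytic_compose_at[OF h(1)]) (auto simp: base_def intro!: analytic_intros)
    then show "c analytic_on {base}"
      unfolding c_def using generic_regular(1)[of _ 1] bj
      by (intro analytic_intros analytic_on_prod analytic_const_gamma) (auto simp: base_shift(1) simp del: of_int_1)
    have "filterlim (\<lambda>b. b - \<beta> (n - 1)) (at (pi * \<i>)) (at base)"
      by (intro filterlim_atI) (auto intro!: tendsto_eq_intros simp: base_def eventually_at_filter algebra_simps)
    from eventually_compose_filterlim[OF h(2) this] eventually_off_lattices
    show "\<forall>\<^sub>F b in at base. \<exists>H. H analytic_on {pinch_point 1 b} \<and>
      (\<forall>\<^sub>F \<alpha> in at (pinch_point 1 b). weight n (\<beta>(n := b)) n \<alpha> = H \<alpha> / (\<alpha> - pinch_point 1 b)) \<and>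
      H (pinch_point 1 b) = c b / (b - base)"
    proof eventually_elim
      case (elim b)
      let ?H = "\<lambda>\<alpha>. (\<Prod>j=1..n. gamma_factor ((\<beta>(n := b)) j) \<alpha>) * ?R \<alpha>"
      have r: "b \<notin> gamma_poles (\<beta> j)" "b - \<beta> j \<noteq> 0" if "j \<in> {1..<n}" for j
        using gamma_regular_shift(1,3)[of b "\<beta> j" 0] elim that by auto
      have g: "(\<lambda>\<alpha>. gamma_factor ((\<beta>(n := b)) j) \<alpha>) analytic_on {b}" if "j \<in> {1..n}" for j
        using r[of j] that self_not_in_gamma_poles by (intro analytic_const_gamma) auto
      show ?case
      proof (intro exI[of _ ?H] conjI)
        show "?H analytic_on {pinch_point 1 b}"
          unfolding pinch_point_def using g r by (intro analytic_intros analytic_on_prod) auto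
        have "rational_factor (\<beta>(n := b)) n \<alpha> = 1 / (\<alpha> - b) * ?R \<alpha>" for \<alpha>
          unfolding rational_factor_def by (auto intro!: arg_cong2[of _ _ _ _ "(*)"] prod.cong)
        then show "\<forall>\<^sub>F \<alpha> in at (pinch_point 1 b). weight n (\<beta>(n := b)) n \<alpha> = ?H \<alpha> / (\<alpha> - pinch_point 1 b)"
          by (intro always_eventually allI) (simp add: weight_def pinch_point_def)
        have "gamma_factor (\<beta> (n - 1)) b = h (b - \<beta> (n - 1)) / (b - base)"
          unfolding gamma_factor_shift[of _ b] using elim by (simp add: base_def algebra_simps)
        moreover have "gamma_factor b b = gamma_factor 0 0" by (subst gamma_factor_shift) simp
        moreover have "(\<Prod>j=1..n. gamma_factor ((\<beta>(n := b)) j) b) =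
            (\<Prod>j\<in>{1..<n - 1}. gamma_factor (\<beta> j) b) * gamma_factor (\<beta> (n - 1)) b * gamma_factor b b"
          unfolding prod_split_last_two using n2 by (auto intro!: arg_cong2[of _ _ _ _ "(*)"] prod.cong)
        ultimately show "?H (pinch_point 1 b) = c b / (b - base)"
          by (simp add: pinch_point_def c_def)
      qed
    qed
  qed
  then show ?thesis using True by blast
qed

text \<open>The pole in \<alpha> comes from \<open>rational_factor\<close>, whose denominators
  contain \<open>\<alpha> - \<beta> (n - 1)\<close> exactly for \<open>m \<ge> n - 1\<close>. The
  pole in \<open>b\<close> comes from the Gamma factor of \<open>b\<close>, at difference - \<pi>
  i.\<close>

lemma pinch_coeff_2:
  assumes m: "m \<in> {1..n}"
  shows "\<exists>c. pinch_coeff 2 m c \<and> (m < n - 1 \<longrightarrow> c = (\<lambda>_. 0))"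
proof -
  let ?p = "\<beta> (n - 1)"
  have reg: "?p \<notin> gamma_poles (\<beta> j)" "?p - \<beta> j \<noteq> 0" if "j \<in> {1..<n - 1}" for j
    using generic_regular[OF that, of 0] by auto
  have g: "(\<lambda>\<alpha>. gamma_factor ((\<beta>(n := b)) j) \<alpha>) analytic_on {?p}"
    if b: "\<forall>j\<in>{1..<n}. \<forall>k::int. b \<noteq> \<beta> j + of_int k * pi * \<i>" and j: "j \<in> {1..n}" for b j
  proof -
    consider "j \<in> {1..<n - 1}" | "j = n - 1" | "j = n" using j by force
    then have "?p \<notin> gamma_poles ((\<beta>(n := b)) j)"
    proof cases
      case 1
      then show ?thesis using reg(1)[OF 1] by auto
    next
      case 2
      then show ?thesis using self_not_in_gamma_poles n2 by auto
    next
      case 3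
      have "n - 1 \<in> {1..<n}" using n2 by auto
      then have "?p \<notin> gamma_poles b" using b by (intro gamma_regular_shift(2)) blast
      then show ?thesis using 3 by simp
    qed
    then show ?thesis by (rule analytic_const_gamma)
  qed
  show ?thesis
  proof (cases "m < n - 1")
    case True
    have "pinch_coeff 2 m (\<lambda>_. 0)"
    proof (rule pinch_coeff_zero)
      show "\<forall>\<^sub>F b in at base. weight n (\<beta>(n := b)) m analytic_on {pinch_point 2 b}"
        using eventually_off_lattices
      proof eventually_elim
        case (elim b)
        have "?p - (\<beta>(n := b)) j \<noteq> 0" if "j \<in> {1..<m} \<union> {m}" for j using reg(2)[of j] that m True by auto
        then show ?case
          unfolding weight_def rational_factor_def pinch_point_def using m True g elim
          by (intro analytic_intros analytic_on_prod) (auto simp del: fun_upd_apply)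
      qed
    qed
    then show ?thesis by blast
  next
    case False
    then have mn: "m = n - 1 \<or> m = n" using m by auto
    obtain h where h: "h analytic_on {- pi * \<i>}" "\<forall>\<^sub>F x in at (- pi * \<i>). gamma_factor 0 x = h x / (x - (- pi * \<i>))"
      using gamma_factor_simple_pole[of "- pi * \<i>"] by blast
    let ?Q = "\<lambda>\<alpha>. \<Prod>j=1..<n - 1. (\<alpha> - \<beta> j + pi * \<i>) / (\<alpha> - \<beta> j)"
    \<comment> \<open>\<open>T\<close> is \<open>rational_factor\<close> without its pole at \<beta>
      (n - 1); for \<open>m = n\<close> the numerator belonging to that pole and the denominator
      \<open>\<alpha> - b\<close> remain.\<close>
    define T where "T = (\<lambda>b \<alpha>. ?Q \<alpha> * (if m = n then (\<alpha> - ?p + pi * \<i>) / (\<alpha> - b) else 1))"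
    define c where "c = (\<lambda>b. - ((\<Prod>j\<in>{1..<n - 1}. gamma_factor (\<beta> j) ?p) * gamma_factor 0 0 * h (?p - b) * T b ?p))"
    have "pinch_coeff 2 m c"
      unfolding pinch_coeff_def
    proof (intro conjI)
      have "(\<lambda>b. h (?p - b)) analytic_on {base}"
        by (rule analytic_compose_at[OF h(1)]) (auto simp: base_def intro!: analytic_intros)
      moreover have "(\<lambda>b. T b ?p) analytic_on {base}"
        unfolding T_def using mn by (cases "m = n") (auto simp: base_def intro!: analytic_intros)
      ultimately show "c analytic_on {base}"
        unfolding c_def by (intro analytic_intros)
      have "filterlim (\<lambda>b. ?p - b) (at (- pi * \<i>)) (at base)"
        by (intro filterlim_atI) (auto intro!: tendsto_eq_intros simp: base_def eventually_at_filter algebra_simps)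
      from eventually_compose_filterlim[OF h(2) this] eventually_off_lattices
      show "\<forall>\<^sub>F b in at base. \<exists>H. H analytic_on {pinch_point 2 b} \<and>
        (\<forall>\<^sub>F \<alpha> in at (pinch_point 2 b). weight n (\<beta>(n := b)) m \<alpha> = H \<alpha> / (\<alpha> - pinch_point 2 b)) \<and>
        H (pinch_point 2 b) = c b / (b - base)"
      proof eventually_elim
        case (elim b)
        let ?H = "\<lambda>\<alpha>. (\<Prod>j=1..n. gamma_factor ((\<beta>(n := b)) j) \<alpha>) * T b \<alpha>"
        have "n - 1 \<in> {1..<n}" using n2 by auto
        then have "b \<noteq> ?p + of_int 0 * pi * \<i>" using elim by blast
        then have bp: "?p - b \<noteq> 0" by auto
        show ?case
        proof (intro exI[of _ ?H] conjI)
          have "T b analytic_on {?p}"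
            unfolding T_def using reg bp
            by (cases "m = n") (auto intro!: analytic_intros analytic_on_prod)
          then show "?H analytic_on {pinch_point 2 b}"
            unfolding pinch_point_def using g elim by (auto intro!: analytic_intros analytic_on_prod)
          have Q: "(\<Prod>j=1..<n - 1. (\<alpha> - (\<beta>(n := b)) j + pi * \<i>) / (\<alpha> - (\<beta>(n := b)) j)) = ?Q \<alpha>" for \<alpha>
            by (intro prod.cong) auto
          have ins: "{1..<n} = insert (n - 1) {1..<n - 1}" using n2 by auto
          have ins': "(\<Prod>j\<in>insert (n - 1) {1..<n - 1}. f j) = f (n - 1) * (\<Prod>j\<in>{1..<n - 1}. f j)"
            for f :: "nat \<Rightarrow> complex" by simp
          have n1: "(\<beta>(n := b)) (n - 1) = ?p" using n2 by (cases n) auto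
          have Q': "(\<Prod>j=1..<n. (\<alpha> - (\<beta>(n := b)) j + pi * \<i>) / (\<alpha> - (\<beta>(n := b)) j)) =
              (\<alpha> - ?p + pi * \<i>) / (\<alpha> - ?p) * ?Q \<alpha>" for \<alpha>
            unfolding ins ins' Q n1 by (rule refl)
          have "rational_factor (\<beta>(n := b)) m \<alpha> = T b \<alpha> / (\<alpha> - ?p)" for \<alpha>
            using mn
          proof
            assume "m = n - 1"
            moreover have "n - 1 \<noteq> n" using n2 by linarith
            ultimately show ?thesis
              unfolding rational_factor_def T_def using Q[of \<alpha>] by simp
          next
            assume "m = n"
            then show ?thesis
              unfolding rational_factor_def T_def using Q'[of \<alpha>] by simp
          qed
          then show "\<forall>\<^sub>F \<alpha> in at (pinch_point 2 b). weight n (\<beta>(n := b)) m \<alpha> = ?H \<alpha> / (\<alpha> - pinch_point 2 b)"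
            by (intro always_eventually allI) (simp add: weight_def pinch_point_def)
          have "gamma_factor b ?p = h (?p - b) / (?p - b + pi * \<i>)"
            unfolding gamma_factor_shift[of b] using elim by simp
          also have "?p - b + pi * \<i> = - (b - base)" by (simp add: base_def algebra_simps)
          finally have "gamma_factor b ?p = - (h (?p - b) / (b - base))" by (simp only: divide_minus_right)
          moreover have "gamma_factor ?p ?p = gamma_factor 0 0" by (subst gamma_factor_shift) simp
          moreover have "(\<Prod>j=1..n. gamma_factor ((\<beta>(n := b)) j) ?p) =
              (\<Prod>j\<in>{1..<n - 1}. gamma_factor (\<beta> j) ?p) * gamma_factor ?p ?p * gamma_factor b ?p"
            unfolding prod_split_last_two using n2 by (auto intro!: arg_cong2[of _ _ _ _ "(*)"] prod.cong)
          ultimately show "?H (pinch_point 2 b) = c b / (b - base)"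
            by (simp add: pinch_point_def c_def)
        qed
      qed
    qed
    then show ?thesis using False by blast
  qed
qed

text \<open>Here the pole in \<alpha> is that of the Gamma factor of \<open>b\<close> itself,
  whatever \<open>m\<close> is. For \<open>m = n\<close> the numerator
  \<open>\<alpha> - \<beta> (n - 1) + pi * \<i>\<close> of \<open>rational_factor\<close> equals
  \<open>b - base\<close> at this point, which is why the coefficient vanishes in the limit.\<close>

lemma pinch_coeff_3:
  assumes m: "m \<in> {1..n}"
  shows "\<exists>c. pinch_coeff 3 m c \<and> (m = n \<longrightarrow> c base = 0)"
proof -
  let ?p = "\<lambda>b. b - 2 * pi * \<i>" and ?b1 = "\<beta> (n - 1)"
  obtain h where h: "h analytic_on {- pi * \<i>}" "\<forall>\<^sub>F x in at (- pi * \<i>). gamma_factor 0 x = h x / (x - (- pi * \<i>))"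
    using gamma_factor_simple_pole[of "- pi * \<i>"] by blast
  obtain h3 where h3: "h3 analytic_on {- 2 * pi * \<i>}" "\<forall>\<^sub>F x in at (- 2 * pi * \<i>). gamma_factor 0 x = h3 x / (x - (- 2 * pi * \<i>))"
    using gamma_factor_simple_pole[of "- 2 * pi * \<i>"] by blast
  define c where "c = (\<lambda>b. (\<Prod>j\<in>{1..<n - 1}. gamma_factor (\<beta> j) (?p b)) * h (?p b - ?b1) * h3 (- 2 * pi * \<i>) *
     rational_factor (\<beta>(n := b)) m (?p b))"
  have bj: "base - 2 * pi * \<i> - \<beta> j \<noteq> 0" if "j \<in> {1..<n}" for j
  proof (cases "j = n - 1")
    case False
    then have "j \<in> {1..<n - 1}" using that by auto
    then show ?thesis using generic_regular(2)[of j "-1"] unfolding base_shift(2) by blast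
  qed (simp add: base_def)
  have mj: "j \<in> {1..<n}" if "j \<in> {1..<m}" for j using that m by auto
  have "pinch_coeff 3 m c"
    unfolding pinch_coeff_def
  proof (intro conjI)
    have "(\<lambda>b. h (?p b - ?b1)) analytic_on {base}"
      by (rule analytic_compose_at[OF h(1)]) (auto simp: base_def intro!: analytic_intros)
    moreover have "(\<lambda>b. gamma_factor (\<beta> j) (?p b)) analytic_on {base}" if "j \<in> {1..<n - 1}" for j
      using generic_regular(1)[OF that, of "-1"] unfolding base_shift(2)[symmetric]
      by (intro gamma_factor_analytic analytic_intros) auto
    moreover have "(\<lambda>b. rational_factor (\<beta>(n := b)) m (?p b)) analytic_on {base}"
    proof -
      have "(\<lambda>b. ?p b - (\<beta>(n := b)) m) analytic_on {base}" "?p base - (\<beta>(n := base)) m \<noteq> 0"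
        using bj[of m] m by (cases "m = n"; auto intro!: analytic_intros)+
      moreover have "(\<lambda>b. \<Prod>j=1..<m. (?p b - (\<beta>(n := b)) j + pi * \<i>) / (?p b - (\<beta>(n := b)) j)) =
          (\<lambda>b. \<Prod>j=1..<m. (?p b - \<beta> j + pi * \<i>) / (?p b - \<beta> j))"
        using m by (intro ext prod.cong) auto
      moreover have "(\<lambda>b. \<Prod>j=1..<m. (?p b - \<beta> j + pi * \<i>) / (?p b - \<beta> j)) analytic_on {base}"
        using bj mj by (intro analytic_intros analytic_on_prod) auto
      ultimately show ?thesis unfolding rational_factor_def by (auto intro!: analytic_on_mult analytic_on_divide analytic_on_const)
    qed
    ultimately show "c analytic_on {base}"
      unfolding c_def by (intro analytic_intros analytic_on_prod) auto
    have "filterlim (\<lambda>b. ?p b - ?b1) (at (- pi * \<i>)) (at base)"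
      by (intro filterlim_atI) (auto intro!: tendsto_eq_intros simp: base_def eventually_at_filter algebra_simps)
    from eventually_compose_filterlim[OF h(2) this] eventually_off_lattices
    show "\<forall>\<^sub>F b in at base. \<exists>H. H analytic_on {pinch_point 3 b} \<and>
      (\<forall>\<^sub>F \<alpha> in at (pinch_point 3 b). weight n (\<beta>(n := b)) m \<alpha> = H \<alpha> / (\<alpha> - pinch_point 3 b)) \<and>
      H (pinch_point 3 b) = c b / (b - base)"
    proof eventually_elim
      case (elim b)
      have r: "?p b \<notin> gamma_poles (\<beta> j)" "?p b - \<beta> j \<noteq> 0" if "j \<in> {1..<n}" for j
        using gamma_regular_shift(1,3)[of b "\<beta> j" "-2"] elim that by auto
      let ?R = "rational_factor (\<beta>(n := b)) m"
      let ?H = "\<lambda>\<alpha>. (\<Prod>j\<in>{1..<n}. gamma_factor (\<beta> j) \<alpha>) * h3 (\<alpha> - b) * ?R \<alpha>"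
      have split: "{1..n} = insert n {1..<n}" using n2 by auto
      have pr: "(\<Prod>j=1..n. gamma_factor ((\<beta>(n := b)) j) \<alpha>) = (\<Prod>j\<in>{1..<n}. gamma_factor (\<beta> j) \<alpha>) * gamma_factor b \<alpha>" for \<alpha>
        unfolding split by (simp add: mult.commute)
      show ?case
      proof (intro exI[of _ ?H] conjI)
        have "?p b - (\<beta>(n := b)) j \<noteq> 0" if "j \<in> {1..n}" for j
          using r(2)[of j] that by auto
        then have "?R analytic_on {?p b}"
          unfolding rational_factor_def using m
          by (intro analytic_intros analytic_on_prod) (auto simp del: fun_upd_apply)
        moreover have "(\<lambda>\<alpha>. h3 (\<alpha> - b)) analytic_on {?p b}"
          by (rule analytic_compose_at[OF h3(1)]) (auto intro!: analytic_intros)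
        ultimately show "?H analytic_on {pinch_point 3 b}"
          unfolding pinch_point_def using r by (auto intro!: analytic_intros analytic_on_prod analytic_const_gamma)
        have "filterlim (\<lambda>\<alpha>. \<alpha> - b) (at (- 2 * pi * \<i>)) (at (?p b))"
          by (intro filterlim_atI) (auto intro!: tendsto_eq_intros simp: eventually_at_filter algebra_simps)
        from eventually_compose_filterlim[OF h3(2) this]
        have ev: "\<forall>\<^sub>F \<alpha> in at (?p b). gamma_factor b \<alpha> = h3 (\<alpha> - b) / (\<alpha> - ?p b)"
          by eventually_elim (simp add: gamma_factor_shift[of b] algebra_simps)
        have pp: "pinch_point 3 b = ?p b" by (simp add: pinch_point_def)
        show "\<forall>\<^sub>F \<alpha> in at (pinch_point 3 b). weight n (\<beta>(n := b)) m \<alpha> = ?H \<alpha> / (\<alpha> - pinch_point 3 b)"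
          unfolding pp by (rule eventually_mono[OF ev]) (simp only: weight_def pr times_divide_eq_left times_divide_eq_right)
        have "gamma_factor ?b1 (?p b) = h (?p b - ?b1) / (?p b - ?b1 + pi * \<i>)"
          unfolding gamma_factor_shift[of ?b1] using elim by simp
        also have "?p b - ?b1 + pi * \<i> = b - base" by (simp add: base_def algebra_simps)
        finally have G: "gamma_factor ?b1 (?p b) = h (?p b - ?b1) / (b - base)" .
        have "{1..<n} = insert (n - 1) {1..<n - 1}" using n2 by auto
        then have "(\<Prod>j\<in>{1..<n}. gamma_factor (\<beta> j) (?p b)) = (h (?p b - ?b1) / (b - base)) * (\<Prod>j\<in>{1..<n - 1}. gamma_factor (\<beta> j) (?p b))"
          using G by simp
        then show "?H (pinch_point 3 b) = c b / (b - base)"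
          by (simp add: pinch_point_def c_def)
      qed
    qed
  qed
  moreover have "c base = 0" if "m = n"
  proof -
    have "base - 2 * pi * \<i> - (\<beta>(n := base)) (n - 1) + pi * \<i> = 0" using n2 by (simp add: base_def)
    moreover have "n - 1 \<in> {1..<n}" using n2 by auto
    ultimately have "(\<Prod>j=1..<n. (base - 2 * pi * \<i> - (\<beta>(n := base)) j + pi * \<i>) / (base - 2 * pi * \<i> - (\<beta>(n := base)) j)) = 0"
      by (intro prod_zero) auto
    then show ?thesis using that by (simp add: c_def rational_factor_def)
  qed
  ultimately show ?thesis by blast
qed

end

section \<open>Polynomials in \<open>\<alpha>\<close> and \<open>exp (- \<alpha>)\<close>\<close>

lemma prod_sum_PiE:
  fixes t :: "'a \<Rightarrow> 'b \<Rightarrow> 'c :: comm_semiring_1"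
  assumes "finite I" "finite J"
  shows "(\<Prod>a\<in>I. \<Sum>s\<in>J. t a s) = (\<Sum>f\<in>I \<rightarrow>\<^sub>E J. \<Prod>a\<in>I. t a (f a))"
  using assms(1)
proof (induction I)
  case (insert x I)
  have "(\<Sum>f\<in>insert x I \<rightarrow>\<^sub>E J. \<Prod>a\<in>insert x I. t a (f a)) =
      (\<Sum>(y, h)\<in>J \<times> (I \<rightarrow>\<^sub>E J). \<Prod>a\<in>insert x I. t a ((h(x := y)) a))"
    unfolding PiE_insert_eq using insert.hyps
    by (subst sum.reindex[OF inj_combinator]) (simp_all add: case_prod_beta o_def)
  also have "\<dots> = (\<Sum>(y, h)\<in>J \<times> (I \<rightarrow>\<^sub>E J). t x y * (\<Prod>a\<in>I. t a (h a)))"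
  proof (intro sum.cong refl, clarify)
    fix y h
    have "(\<Prod>a\<in>I. t a ((h(x := y)) a)) = (\<Prod>a\<in>I. t a (h a))"
      using insert.hyps by (intro prod.cong) auto
    then show "(\<Prod>a\<in>insert x I. t a ((h(x := y)) a)) = t x y * (\<Prod>a\<in>I. t a (h a))"
      using insert.hyps by simp
  qed
  also have "\<dots> = (\<Sum>y\<in>J. t x y) * (\<Sum>h\<in>I \<rightarrow>\<^sub>E J. \<Prod>a\<in>I. t a (h a))"
    by (simp add: sum_product sum.cartesian_product)
  finally show ?case using insert by simp
qed simp

lemma poly_sum_monom_coeff: "coeff (\<Sum>p\<in>S. monom (u p) (d p)) k = (\<Sum>p | p \<in> S \<and> d p = k. u p)"
  if "finite S" for u :: "'a \<Rightarrow> complex"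
  using that by (simp add: coeff_sum sum.If_cases Int_def if_distrib cong: if_cong)

text \<open>Shifting \<open>\<alpha>\<close> by multiples of \<open>2 \<pi> \<i>\<close> decouples \<open>\<alpha>\<close> from \<open>exp (- \<alpha>)\<close>.\<close>

lemma monom_exp_independent:
  assumes S: "finite S" and zero: "\<And>z. (\<Sum>p\<in>S. e p * monom_exp (fst p) (snd p) z) = 0" and p: "p \<in> S"
  shows "e p = 0"
proof -
  have inf: "q = 0" if "\<And>x. x \<in> X \<Longrightarrow> poly q x = 0" "infinite X" for q :: "complex poly" and X
  proof (rule ccontr)
    assume "q \<noteq> 0"
    then have "finite {x. poly q x = 0}" by (rule poly_roots_finite)
    moreover have "X \<subseteq> {x. poly q x = 0}" using that(1) by blast
    ultimately show False using that(2) finite_subset by blast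
  qed
  have step1: "(\<Sum>p | p \<in> S \<and> fst p = k. e p * X ^ snd p) = 0" if X: "X \<noteq> 0" for X k
  proof -
    obtain z0 where z0: "exp (- z0) = X" using X by (metis exp_Ln minus_minus)
    let ?q = "\<Sum>p\<in>S. monom (e p * X ^ snd p) (fst p)"
    have "?q = 0"
    proof (rule inf)
      show "infinite (range (\<lambda>s::nat. z0 + 2 * of_nat s * pi * \<i>))"
        by (rule range_inj_infinite) (auto simp: inj_def)
      fix x assume "x \<in> range (\<lambda>s::nat. z0 + 2 * of_nat s * pi * \<i>)"
      then obtain s :: nat where x: "x = z0 + 2 * of_nat s * pi * \<i>" by blast
      have "exp (2 * of_nat s * pi * \<i>) = 1"
        by (auto simp: exp_eq_1 intro!: exI[of _ "int s"])
      then have "exp (- x) = X" unfolding x minus_add_distrib exp_add using z0 by (simp add: exp_minus)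
      then show "poly ?q x = 0" using zero[of x] by (simp add: poly_sum poly_monom monom_exp_def mult_ac)
    qed
    then have "coeff ?q k = 0" by simp
    then show ?thesis unfolding poly_sum_monom_coeff[OF S] .
  qed
  let ?S = "{p' \<in> S. fst p' = fst p}"
  have fS: "finite ?S" using S by simp
  have "(\<Sum>p'\<in>?S. monom (e p') (snd p')) = 0"
  proof (rule inf)
    show "infinite (UNIV - {0 :: complex})" using infinite_UNIV_char_0 by (simp add: infinite_remove)
    fix X :: complex assume "X \<in> UNIV - {0}"
    then show "poly (\<Sum>p'\<in>?S. monom (e p') (snd p')) X = 0"
      using step1[of X "fst p"] by (simp add: poly_sum poly_monom)
  qed
  then have "coeff (\<Sum>p'\<in>?S. monom (e p') (snd p')) (snd p) = 0" by simp
  then have "(\<Sum>p' | p' \<in> ?S \<and> snd p' = snd p. e p') = 0" unfolding poly_sum_monom_coeff[OF fS] .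
  moreover have "{p'. p' \<in> ?S \<and> snd p' = snd p} = {p}" using p by (auto simp: prod_eq_iff)
  ultimately show ?thesis by simp
qed

text \<open>Linear independence turns any assignment of numbers to pairs \<open>(k, i)\<close> into
  a well-defined linear functional on the span of these functions. \<open>E\<close> collects the
  coefficients of those indices that carry the same pair.\<close>

lemma monom_exp_relation:
  fixes \<Lambda> :: "nat \<Rightarrow> nat \<Rightarrow> complex"
  assumes R: "finite R" and zero: "\<And>z. (\<Sum>r\<in>R. e r * monom_exp (k r) (i r) z) = 0"
  shows "(\<Sum>r\<in>R. e r * \<Lambda> (k r) (i r)) = 0"
proof -
  let ?g = "\<lambda>r. (k r, i r)"
  define E where "E = (\<lambda>p. \<Sum>r | r \<in> R \<and> ?g r = p. e r)"
  have grp: "(\<Sum>r\<in>R. e r * h (k r) (i r)) = (\<Sum>p\<in>?g ` R. E p * h (fst p) (snd p))" for h :: "nat \<Rightarrow> nat \<Rightarrow> complex"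
    unfolding sum.image_gen[OF R, of _ ?g] E_def sum_distrib_right
    by (intro sum.cong refl) auto
  have "E p = 0" if "p \<in> ?g ` R" for p
    using monom_exp_independent[of "?g ` R" E p] R that zero grp[of "\<lambda>k i. monom_exp k i _"] by simp
  then show ?thesis unfolding grp by simp
qed

text \<open>The functionals are applied to one variable after the other while the remaining
  variables are frozen.\<close>

lemma tensor_relation_all:
  fixes \<Lambda> :: "nat \<Rightarrow> nat \<Rightarrow> nat \<Rightarrow> complex"
  assumes R: "finite R" and A: "finite A"
    and zero: "\<And>\<alpha>. (\<Sum>r\<in>R. d r * (\<Prod>a\<in>A. monom_exp (k r a) (i r a) (\<alpha> a))) = 0"
  shows "(\<Sum>r\<in>R. d r * (\<Prod>a\<in>A. \<Lambda> a (k r a) (i r a))) = 0"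
  using A zero
proof (induction A arbitrary: d)
  case (insert x A)
  let ?d = "\<lambda>r. d r * \<Lambda> x (k r x) (i r x)"
  have "(\<Sum>r\<in>R. ?d r * (\<Prod>a\<in>A. monom_exp (k r a) (i r a) (\<alpha> a))) = 0" for \<alpha>
  proof -
    let ?e = "\<lambda>r. d r * (\<Prod>a\<in>A. monom_exp (k r a) (i r a) (\<alpha> a))"
    have "(\<Sum>r\<in>R. ?e r * monom_exp (k r x) (i r x) z) = 0" for z
    proof -
      have "(\<Prod>a\<in>A. monom_exp (k r a) (i r a) ((\<alpha>(x := z)) a)) = (\<Prod>a\<in>A. monom_exp (k r a) (i r a) (\<alpha> a))" for r
        using insert.hyps by (intro prod.cong) auto
      then show ?thesis using insert.prems[of "\<alpha>(x := z)"] insert.hyps by (simp add: mult_ac)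
    qed
    from monom_exp_relation[OF R this, of "\<Lambda> x"] show ?thesis by (simp add: mult_ac)
  qed
  from insert.IH[OF this] show ?case using insert.hyps by (simp add: mult_ac)
qed simp

text \<open>The evaluated variables are absorbed into the coefficients. Vanishing is required only
  where those variables sit at \<open>pt\<close>: this is how the vanishing of \<open>P\<close> at a
  pinching point becomes a statement about the regular parts in the other variables.\<close>

lemma tensor_relation:
  fixes \<Lambda> :: "nat \<Rightarrow> nat \<Rightarrow> nat \<Rightarrow> complex"
  assumes R: "finite R" and A: "finite A"
    and zero: "\<And>\<alpha>. (\<And>a. a \<in> A \<Longrightarrow> Q a \<Longrightarrow> \<alpha> a = pt a) \<Longrightarrow>
      (\<Sum>r\<in>R. d r * (\<Prod>a\<in>A. monom_exp (k r a) (i r a) (\<alpha> a))) = 0"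
  shows "(\<Sum>r\<in>R. d r * (\<Prod>a\<in>A. if Q a then monom_exp (k r a) (i r a) (pt a) else \<Lambda> a (k r a) (i r a))) = 0"
proof -
  let ?S = "A \<inter> {a. Q a}" and ?N = "A \<inter> - {a. Q a}"
  define d' where "d' = (\<lambda>r. d r * (\<Prod>a\<in>?S. monom_exp (k r a) (i r a) (pt a)))"
  have "(\<Sum>r\<in>R. d' r * (\<Prod>a\<in>?N. \<Lambda> a (k r a) (i r a))) = 0"
  proof (rule tensor_relation_all[OF R])
    fix \<alpha>
    let ?\<alpha> = "\<lambda>a. if Q a then pt a else \<alpha> a"
    have "(\<Prod>a\<in>A. monom_exp (k r a) (i r a) (?\<alpha> a)) =
        (\<Prod>a\<in>?S. monom_exp (k r a) (i r a) (pt a)) * (\<Prod>a\<in>?N. monom_exp (k r a) (i r a) (\<alpha> a))" for r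
      using A by (subst prod.If_cases[OF A, symmetric]) (auto intro!: prod.cong)
    then show "(\<Sum>r\<in>R. d' r * (\<Prod>a\<in>?N. monom_exp (k r a) (i r a) (\<alpha> a))) = 0"
      using zero[of ?\<alpha>] by (simp add: d'_def mult.assoc)
  qed (use A in simp)
  moreover have "(\<Prod>a\<in>A. if Q a then monom_exp (k r a) (i r a) (pt a) else \<Lambda> a (k r a) (i r a)) =
     (\<Prod>a\<in>?S. monom_exp (k r a) (i r a) (pt a)) * (\<Prod>a\<in>?N. \<Lambda> a (k r a) (i r a))" for r
    by (rule prod.If_cases[OF A])
  ultimately show ?thesis by (simp add: d'_def mult.assoc)
qed

text \<open>Each factor raises the exponent of a variable by at most one, so its degree is bounded
  by the number of pairs that contain it; this is the origin of the degree \<open>l - 1\<close>. A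
  list is used because equal monomials may recur.\<close>

lemma prod_linear_expansion:
  fixes E :: "(nat \<times> nat) set" and c :: complex
  assumes "finite E" "finite A" "\<And>a b. (a, b) \<in> E \<Longrightarrow> a \<in> A \<and> b \<in> A"
  shows "\<exists>L :: (complex \<times> (nat \<Rightarrow> nat)) list.
     (\<forall>\<alpha>. (\<Prod>(a, b)\<in>E. \<alpha> a - \<alpha> b + c) = (\<Sum>(u, k)\<leftarrow>L. u * (\<Prod>a\<in>A. \<alpha> a ^ k a))) \<and>
     (\<forall>(u, k)\<in>set L. \<forall>a. k a \<le> card {p \<in> E. fst p = a \<or> snd p = a})"
  using assms(1,3)
proof (induction E)
  case empty
  show ?case by (intro exI[of _ "[(1, \<lambda>_. 0)]"]) simp
next
  case (insert p E)
  obtain x y where p: "p = (x, y)" by (cases p)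
  have xy: "x \<in> A" "y \<in> A" using insert.prems p by auto
  obtain L where L: "\<And>\<alpha>. (\<Prod>(a, b)\<in>E. \<alpha> a - \<alpha> b + c) = (\<Sum>(u, k)\<leftarrow>L. u * (\<Prod>a\<in>A. \<alpha> a ^ k a))"
    "\<And>u k a. (u, k) \<in> set L \<Longrightarrow> k a \<le> card {p \<in> E. fst p = a \<or> snd p = a}"
    using insert.IH insert.prems by fastforce
  \<comment> \<open>The expansion multiplied by the scalar \<open>u\<close> and the variable with
    index \<open>x\<close>.\<close>
  define up where "up = (\<lambda>x u. map (\<lambda>(v, k). (u * v, k(x := Suc (k x)))) L)"
  define L' where "L' = up x 1 @ up y (- 1) @ map (\<lambda>(v, k). (c * v, k)) L"
  have mono: "(\<Prod>a\<in>A. \<alpha> a ^ (k(x := Suc (k x))) a) = \<alpha> x * (\<Prod>a\<in>A. \<alpha> a ^ k a)"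
    if "x \<in> A" for \<alpha> :: "nat \<Rightarrow> complex" and k :: "nat \<Rightarrow> nat" and x
  proof -
    have "(\<Prod>a\<in>A - {x}. \<alpha> a ^ (k(x := Suc (k x))) a) = (\<Prod>a\<in>A - {x}. \<alpha> a ^ k a)" by (intro prod.cong) auto
    then show ?thesis using assms(2) that by (simp add: prod.remove[of A x])
  qed
  have ups: "(\<Sum>(u, k)\<leftarrow>up x v. u * (\<Prod>a\<in>A. \<alpha> a ^ k a)) = v * \<alpha> x * (\<Sum>(u, k)\<leftarrow>L. u * (\<Prod>a\<in>A. \<alpha> a ^ k a))"
    if "x \<in> A" for \<alpha> x v
    unfolding up_def by (induction L) (auto simp: mono[OF that] algebra_simps simp del: fun_upd_apply)
  have cs: "(\<Sum>(u, k)\<leftarrow>map (\<lambda>(v, k). (c * v, k)) L. u * (\<Prod>a\<in>A. \<alpha> a ^ k a)) = c * (\<Sum>(u, k)\<leftarrow>L. u * (\<Prod>a\<in>A. \<alpha> a ^ k a))" for \<alpha>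
    by (induction L) (auto simp: algebra_simps)
  have card: "card {q \<in> insert p E. fst q = a \<or> snd q = a} =
     (if a = x \<or> a = y then Suc else id) (card {q \<in> E. fst q = a \<or> snd q = a})" for a
  proof -
    have "{q \<in> insert p E. fst q = a \<or> snd q = a} =
       (if a = x \<or> a = y then insert p {q \<in> E. fst q = a \<or> snd q = a} else {q \<in> E. fst q = a \<or> snd q = a})"
      using p by auto
    then show ?thesis using insert.hyps by simp
  qed
  show ?case
  proof (rule exI[of _ L'], intro conjI allI ballI)
    fix \<alpha>
    show "(\<Prod>(a, b)\<in>insert p E. \<alpha> a - \<alpha> b + c) = (\<Sum>(u, k)\<leftarrow>L'. u * (\<Prod>a\<in>A. \<alpha> a ^ k a))"
      unfolding L'_def map_append sum_list_append ups[OF xy(1)] ups[OF xy(2)] cs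
      using insert.hyps by (simp add: p L(1)) (simp add: algebra_simps)
  next
    fix q assume "q \<in> set L'"
    then show "case q of (u, k) \<Rightarrow> \<forall>a. k a \<le> card {q \<in> insert p E. fst q = a \<or> snd q = a}"
      unfolding card using L(2) by (auto simp: L'_def up_def le_SucI)
  qed
qed

section \<open>Expansion of the polynomial into monomials in the \<open>X a\<close>\<close>

definition X_exp :: "((nat + nat) \<Rightarrow>\<^sub>0 nat) \<Rightarrow> nat \<Rightarrow> nat" where
  "X_exp m a = Poly_Mapping.lookup m (Inl a)"

definition x_part :: "nat \<Rightarrow> ((nat + nat) \<Rightarrow>\<^sub>0 nat) \<Rightarrow> (nat \<Rightarrow> complex) \<Rightarrow> complex" where
  "x_part n m x = (\<Prod>j=1..n. x j ^ Poly_Mapping.lookup m (Inr j))"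

lemma eval_poly_expand:
  assumes keys: "\<forall>m\<in>Poly_Mapping.keys P. Poly_Mapping.keys m \<subseteq> Inl ` {1..l} \<union> Inr ` {1..n}"
  shows "eval_poly P X x = (\<Sum>m\<in>Poly_Mapping.keys P. Poly_Mapping.lookup P m * x_part n m x * (\<Prod>a=1..l. X a ^ X_exp m a))"
  unfolding eval_poly_def
proof (rule sum.cong[OF refl])
  fix m assume m: "m \<in> Poly_Mapping.keys P"
  let ?t = "\<lambda>v. (case v of Inl a \<Rightarrow> X a | Inr j \<Rightarrow> x j) ^ Poly_Mapping.lookup m v"
  have "(\<Prod>v\<in>Poly_Mapping.keys m. ?t v) = (\<Prod>v\<in>Inl ` {1..l} \<union> Inr ` {1..n}. ?t v)"
    by (rule prod.mono_neutral_left[OF _ bspec[OF keys m]]) (auto simp: in_keys_iff)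
  also have "\<dots> = (\<Prod>v\<in>Inl ` {1..l}. ?t v) * (\<Prod>v\<in>Inr ` {1..n}. ?t v)"
    by (rule prod.union_disjoint) auto
  also have "(\<Prod>v\<in>Inl ` {1..l}. ?t v) = (\<Prod>a=1..l. X a ^ X_exp m a)"
    by (subst prod.reindex) (auto simp: X_exp_def)
  also have "(\<Prod>v\<in>Inr ` {1..n}. ?t v) = x_part n m x"
    by (subst prod.reindex) (auto simp: x_part_def)
  finally show "Poly_Mapping.lookup P m * (\<Prod>v\<in>Poly_Mapping.keys m. ?t v) =
      Poly_Mapping.lookup P m * x_part n m x * (\<Prod>a=1..l. X a ^ X_exp m a)" by (simp add: mult_ac)
qed

text \<open>Setting \<open>X a = 0\<close> leaves exactly the monomials free of \<open>X a\<close>,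
  so these add up to 0 for all values of the other variables and may be dropped as a group, one
  variable after the other.\<close>

lemma drop_constant_monomials:
  fixes M :: "'m set" and e :: "'m \<Rightarrow> nat \<Rightarrow> nat" and w :: "'m \<Rightarrow> complex"
  assumes M: "finite M" and A: "finite A"
    and zero: "\<And>X a. a \<in> A \<Longrightarrow> X a = 0 \<Longrightarrow> (\<Sum>m\<in>M. w m * (\<Prod>a\<in>A. X a ^ e m a)) = 0"
  shows "(\<Sum>m\<in>M. w m * (\<Prod>a\<in>A. X a ^ e m a)) = (\<Sum>m | m \<in> M \<and> (\<forall>a\<in>A. e m a \<ge> 1). w m * (\<Prod>a\<in>A. X a ^ e m a))"
proof -
  let ?t = "\<lambda>X m. w m * (\<Prod>a\<in>A. X a ^ e m a)"
  have "(\<Sum>m\<in>M. ?t X m) = (\<Sum>m | m \<in> M \<and> (\<forall>a\<in>S. e m a \<ge> 1). ?t X m)" if "S \<subseteq> A" for S X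
    using finite_subset[OF that A] that
  proof (induction S arbitrary: X)
    case (insert x S)
    have x: "x \<in> A" and SA: "S \<subseteq> A" using insert.prems by auto
    let ?M = "{m \<in> M. \<forall>a\<in>S. e m a \<ge> 1}"
    have fM: "finite ?M" using M by simp
    have t0: "?t (X(x := 0)) m = (if e m x \<ge> 1 then 0 else ?t X m)" for m
    proof (cases "e m x \<ge> 1")
      case True
      then have "(\<Prod>a\<in>A. (X(x := 0)) a ^ e m a) = 0" using A x by (intro prod_zero) auto
      then show ?thesis using True by simp
    next
      case False
      then have "(\<Prod>a\<in>A. (X(x := 0)) a ^ e m a) = (\<Prod>a\<in>A. X a ^ e m a)"
        by (intro prod.cong) (auto simp: not_le)
      then show ?thesis using False by simp
    qed
    have "0 = (\<Sum>m\<in>M. ?t (X(x := 0)) m)" using zero[OF x, of "X(x := 0)"] by simp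
    also have "\<dots> = (\<Sum>m\<in>?M. ?t (X(x := 0)) m)" using insert.IH[OF SA] .
    also have "\<dots> = (\<Sum>m\<in>?M. if e m x \<ge> 1 then 0 else ?t X m)" unfolding t0 ..
    finally have z: "(\<Sum>m\<in>?M. if e m x \<ge> 1 then 0 else ?t X m) = 0" by simp
    have "(\<Sum>m\<in>?M. ?t X m) = (\<Sum>m\<in>?M. (if e m x \<ge> 1 then ?t X m else 0) + (if e m x \<ge> 1 then 0 else ?t X m))"
      by (intro sum.cong) auto
    also have "\<dots> = (\<Sum>m\<in>?M. if e m x \<ge> 1 then ?t X m else 0)" unfolding sum.distrib z by simp
    also have "\<dots> = (\<Sum>m | m \<in> M \<and> (\<forall>a\<in>insert x S. e m a \<ge> 1). ?t X m)"
      using fM by (subst sum.inter_filter[symmetric]) (auto intro!: sum.cong)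
    finally show ?case using insert.IH[OF SA, of X] by simp
  qed simp
  from this[of A] show ?thesis by simp
qed

section \<open>The one-variable integrals near the pinching\<close>

text \<open>For \<open>Re \<alpha>\<close> tending to infinity the weight decays like \<open>\<alpha>\<close> to the power \<open>- 1 - n/2\<close>; in the opposite
  direction it decays like \<open>exp (n \<alpha>)\<close> up to a power of \<open>\<alpha>\<close>.\<close>

definition admissible :: "nat \<Rightarrow> nat \<Rightarrow> nat \<Rightarrow> nat \<Rightarrow> bool" where
  "admissible n D k i \<longleftrightarrow> k \<le> D \<and> i < n \<and> (2 * k + 1 \<le> n \<or> 1 \<le> i)"

section \<open>The two families of points and their motion with \<open>b\<close>\<close>

lemma lower_pointsI: "j \<in> {1..n} \<Longrightarrow> \<beta> j - 2 * of_nat k * pi * \<i> \<in> lower_points n \<beta>"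
  unfolding lower_points_def by blast

lemma upper_pointsI: "j \<in> {1..n} \<Longrightarrow> \<beta> j - pi * \<i> + 2 * of_nat k * pi * \<i> \<in> upper_points n \<beta>"
  unfolding upper_points_def by blast

lemma lower_pointsE:
  assumes "p \<in> lower_points n \<beta>"
  obtains j k where "j \<in> {1..n}" "p = \<beta> j - 2 * of_nat k * pi * \<i>"
  using assms unfolding lower_points_def by blast

lemma upper_pointsE:
  assumes "p \<in> upper_points n \<beta>"
  obtains j k where "j \<in> {1..n}" "p = \<beta> j - pi * \<i> + 2 * of_nat k * pi * \<i>"
  using assms unfolding upper_points_def by blast

lemma finite_points_in_strip: "finite {p \<in> lower_points n \<beta> \<union> upper_points n \<beta>. \<bar>Im p\<bar> < H}"
proof -
  define M where "M = H + (\<Sum>j=1..n. norm (\<beta> j)) + pi"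
  obtain N :: nat where N: "M \<le> real N" using real_arch_simple by blast
  have Mb: "norm (\<beta> j) \<le> M - H - pi" if "j \<in> {1..n}" for j
    unfolding M_def using member_le_sum[of j "{1..n}" "\<lambda>j. norm (\<beta> j)"] that by simp
  let ?S = "(\<lambda>(j, k). \<beta> j - 2 * of_nat k * pi * \<i>) ` ({1..n} \<times> {..N}) \<union>
     (\<lambda>(j, k). \<beta> j - pi * \<i> + 2 * of_nat k * pi * \<i>) ` ({1..n} \<times> {..N})"
  have k_le: "k \<le> N" if "2 * real k * pi < M" for k
  proof -
    have "real k \<le> 2 * real k * pi" using pi_gt3 mult_left_mono[of 1 "2 * pi" "real k"] by simp
    then show ?thesis using that N by linarith
  qed
  have mem: "p \<in> ?S" if p: "p \<in> lower_points n \<beta> \<union> upper_points n \<beta>" "\<bar>Im p\<bar> < H" for p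
  proof -
    consider j k where "j \<in> {1..n}" "p = \<beta> j - 2 * of_nat k * pi * \<i>"
      | j k where "j \<in> {1..n}" "p = \<beta> j - pi * \<i> + 2 * of_nat k * pi * \<i>"
      using p(1) by (elim UnE lower_pointsE upper_pointsE) blast+
    then show ?thesis
    proof cases
      case (1 j k)
      have "Im p = Im (\<beta> j) - 2 * real k * pi" using 1(2) by simp
      then have "2 * real k * pi < M"
        using p(2) Mb[OF 1(1)] abs_Im_le_cmod[of "\<beta> j"] pi_gt3 by linarith
      then show ?thesis using 1 k_le by (intro UnI1 image_eqI[of _ _ "(j, k)"]) auto
    next
      case (2 j k)
      have "Im p = Im (\<beta> j) - pi + 2 * real k * pi" using 2(2) by simp
      then have "2 * real k * pi < M"
        using p(2) Mb[OF 2(1)] abs_Im_le_cmod[of "\<beta> j"] pi_gt3 by linarith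
      then show ?thesis using 2 k_le by (intro UnI2 image_eqI[of _ _ "(j, k)"]) auto
    qed
  qed
  have "{p \<in> lower_points n \<beta> \<union> upper_points n \<beta>. \<bar>Im p\<bar> < H} \<subseteq> ?S"
    by (rule subsetI, rule mem) simp_all
  moreover have "finite ?S" by (intro finite_UnI finite_imageI finite_cartesian_product) simp_all
  ultimately show ?thesis by (rule finite_subset)
qed

lemma points_bounds:
  assumes "\<And>j. j \<in> {1..n} \<Longrightarrow> norm (\<beta> j) \<le> Bd"
  shows "p \<in> lower_points n \<beta> \<Longrightarrow> Im p \<le> Bd" "p \<in> upper_points n \<beta> \<Longrightarrow> Im p \<ge> - Bd - pi"
proof -
  { assume "p \<in> lower_points n \<beta>"
    then obtain j k where jk: "j \<in> {1..n}" "p = \<beta> j - 2 * of_nat k * pi * \<i>" by (rule lower_pointsE)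
    have "Im p = Im (\<beta> j) - 2 * real k * pi" using jk(2) by simp
    moreover have "0 \<le> 2 * real k * pi" by simp
    ultimately show "Im p \<le> Bd" using assms[OF jk(1)] abs_Im_le_cmod[of "\<beta> j"] by linarith }
  { assume "p \<in> upper_points n \<beta>"
    then obtain j k where jk: "j \<in> {1..n}" "p = \<beta> j - pi * \<i> + 2 * of_nat k * pi * \<i>" by (rule upper_pointsE)
    have "Im p = Im (\<beta> j) - pi + 2 * real k * pi" using jk(2) by simp
    moreover have "0 \<le> 2 * real k * pi" by simp
    ultimately show "Im p \<ge> - Bd - pi" using assms[OF jk(1)] abs_Im_le_cmod[of "\<beta> j"] by linarith }
qed

lemma points_unbounded:
  assumes "n \<ge> 1"
  shows "\<exists>p\<in>lower_points n \<beta>. Im p < H" "\<exists>p\<in>upper_points n \<beta>. Im p > H"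
proof -
  have one: "1 \<in> {1..n}" using assms by simp
  obtain k :: nat where k: "\<bar>H\<bar> + norm (\<beta> 1) + 4 < real k" using reals_Archimedean2 by blast
  have k2: "real k \<le> 2 * real k * pi" using pi_gt3 mult_left_mono[of 1 "2 * pi" "real k"] by simp
  have im: "\<bar>Im (\<beta> 1)\<bar> \<le> norm (\<beta> 1)" by (rule abs_Im_le_cmod)
  have "Im (\<beta> 1 - 2 * of_nat k * pi * \<i>) = Im (\<beta> 1) - 2 * real k * pi" by simp
  then have "Im (\<beta> 1 - 2 * of_nat k * pi * \<i>) < H" using k k2 im by linarith
  then show "\<exists>p\<in>lower_points n \<beta>. Im p < H" using lower_pointsI[OF one] by blast
  have "Im (\<beta> 1 - pi * \<i> + 2 * of_nat k * pi * \<i>) = Im (\<beta> 1) - pi + 2 * real k * pi" by simp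
  then have "Im (\<beta> 1 - pi * \<i> + 2 * of_nat k * pi * \<i>) > H" using k k2 im pi_less_4 by linarith
  then show "\<exists>p\<in>upper_points n \<beta>. Im p > H" using upper_pointsI[OF one] by blast
qed

lemma monom_exp_analytic: "f analytic_on A \<Longrightarrow> (\<lambda>z. monom_exp k i (f z)) analytic_on A"
  unfolding monom_exp_def by (intro analytic_intros)

lemma monom_exp_continuous: "continuous_on A f \<Longrightarrow> continuous_on A (\<lambda>z. monom_exp k i (f z))"
  unfolding monom_exp_def by (intro continuous_intros)

text \<open>Together with \<open>generic\<close> this implies that at \<open>b = base\<close> the
  two families meet only in pinched points. The condition concerns the parameters that stay fixed
  and is inherited from any contour for a nearby \<open>b\<close>.\<close>

locale regular_pinching = pinching +
  assumes disjoint_points: "lower_points (n - 1) \<beta> \<inter> upper_points (n - 1) \<beta> = {}"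
begin

abbreviation "L \<equiv> \<lambda>b. lower_points n (\<beta>(n := b))"
abbreviation "U \<equiv> \<lambda>b. upper_points n (\<beta>(n := b))"

definition pinched :: "complex set" where "pinched = {base, \<beta> (n - 1), base - 2 * pi * \<i>}"

lemma lattice_inj: "c + of_int k * pi * \<i> = c + of_int k' * pi * \<i> \<longleftrightarrow> k = k'"
  by simp

text \<open>Positions are compared on the lattice of points \<beta> (n - 1) + s \<pi> i: pinched
  points have \<open>s\<close> equal to 1, 0 or -1, lower points of \<beta> (n - 1) have
  \<open>- 2 * k\<close> and those of \<open>base\<close> have \<open>1 - 2 * k\<close>.\<close>

lemma lower_point_classification:
  assumes j: "j \<in> {1..n}" and p0: "(\<beta>(n := base)) j - 2 * of_nat k * pi * \<i> \<in> pinched"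
  shows "j = n - 1 \<and> k = 0 \<or> j = n \<and> k = 0 \<or> j = n \<and> k = 1"
proof -
  let ?c = "\<beta> (n - 1)"
  obtain s :: int where s: "s \<in> {0, 1, -1}" "(\<beta>(n := base)) j - 2 * of_nat k * pi * \<i> = ?c + of_int s * pi * \<i>"
  proof -
    have "base = ?c + of_int 1 * pi * \<i>" "?c = ?c + of_int 0 * pi * \<i>" "base - 2 * pi * \<i> = ?c + of_int (-1) * pi * \<i>"
      by (simp_all add: base_def algebra_simps)
    then show thesis using p0 that unfolding pinched_def by (metis empty_iff insert_iff)
  qed
  consider "j \<in> {1..<n - 1}" | "j = n - 1" | "j = n" using j by force
  then show ?thesis
  proof cases
    case 1
    then have "(\<beta>(n := base)) j = \<beta> j" by auto
    then have "?c + of_int s * pi * \<i> = \<beta> j + of_int (- 2 * int k) * pi * \<i>"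
      using s(2) by (simp add: algebra_simps)
    then show ?thesis using generic_lattice[OF 1] by blast
  next
    case 2
    then have "(\<beta>(n := base)) j = ?c" using n2 by auto
    then have "?c + of_int s * pi * \<i> = ?c + of_int (- 2 * int k) * pi * \<i>"
      using s(2) by (simp add: algebra_simps)
    then have "s = - 2 * int k" unfolding lattice_inj .
    then show ?thesis using 2 s(1) by auto
  next
    case 3
    then have "(\<beta>(n := base)) j = ?c + of_int 1 * pi * \<i>" by (simp add: base_def)
    then have "?c + of_int s * pi * \<i> = ?c + of_int (1 - 2 * int k) * pi * \<i>"
      using s(2) by (simp add: algebra_simps)
    then have "s = 1 - 2 * int k" unfolding lattice_inj .
    then show ?thesis using 3 s(1) by auto
  qed
qed

text \<open>The partner at \<open>base\<close> has the same indices \<open>j\<close> and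
  \<open>k\<close>. In this way the geometry at \<open>base\<close> controls the configuration for
  all nearby \<open>b\<close>.\<close>

lemma lower_points_move:
  assumes "p \<in> L b"
  obtains p0 where "p0 \<in> L base" "norm (p - p0) \<le> norm (b - base)"
    "p0 \<in> pinched \<longrightarrow> p \<in> {b, \<beta> (n - 1), b - 2 * pi * \<i>}"
proof -
  obtain j k where jk: "j \<in> {1..n}" "p = (\<beta>(n := b)) j - 2 * of_nat k * pi * \<i>"
    using assms by (rule lower_pointsE)
  let ?p0 = "(\<beta>(n := base)) j - 2 * of_nat k * pi * \<i>"
  show thesis
  proof (rule that[of ?p0])
    show "?p0 \<in> L base" using jk(1) by (rule lower_pointsI)
    show "norm (p - ?p0) \<le> norm (b - base)" unfolding jk(2) by auto
    show "?p0 \<in> pinched \<longrightarrow> p \<in> {b, \<beta> (n - 1), b - 2 * pi * \<i>}"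
    proof
      assume "?p0 \<in> pinched"
      then have "j = n - 1 \<and> k = 0 \<or> j = n \<and> k = 0 \<or> j = n \<and> k = 1"
        using lower_point_classification[OF jk(1)] by blast
      moreover have "n - 1 \<noteq> n" using n2 by linarith
      ultimately show "p \<in> {b, \<beta> (n - 1), b - 2 * pi * \<i>}" unfolding jk(2) by auto
    qed
  qed
qed

lemma upper_points_move:
  assumes "p \<in> U b"
  obtains p0 where "p0 \<in> U base" "norm (p - p0) \<le> norm (b - base)"
proof -
  obtain j k where jk: "j \<in> {1..n}" "p = (\<beta>(n := b)) j - pi * \<i> + 2 * of_nat k * pi * \<i>"
    using assms by (rule upper_pointsE)
  show thesis
    using upper_pointsI[OF jk(1), of "\<beta>(n := base)" k] by (rule that) (auto simp: jk(2))
qed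

text \<open>When \<open>base\<close> is involved, equality becomes an equation between integers.
  Parity excludes that both points belong to \<open>base\<close>, and in the mixed cases
  nonnegativity of \<open>k\<close> and \<open>k'\<close> leaves only the pinched points.\<close>

lemma lower_upper_meet_pinched:
  assumes q: "q \<in> L base" "q \<in> U base"
  shows "q \<in> pinched"
proof -
  let ?c = "\<beta> (n - 1)"
  obtain j k where jk: "j \<in> {1..n}" "q = (\<beta>(n := base)) j - 2 * of_nat k * pi * \<i>"
    using q(1) by (rule lower_pointsE)
  obtain i k' where ik: "i \<in> {1..n}" "q = (\<beta>(n := base)) i - pi * \<i> + 2 * of_nat k' * pi * \<i>"
    using q(2) by (rule upper_pointsE)
  have nn: "n - 1 \<noteq> n" using n2 by linarith
  consider "j < n" "i < n" | "j = n" "i = n" | "j = n" "i < n" | "j < n" "i = n" using jk(1) ik(1) by force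
  then show ?thesis
  proof cases
    case 1
    then have "q \<in> lower_points (n - 1) \<beta>" "q \<in> upper_points (n - 1) \<beta>"
      using lower_pointsI[of j "n - 1" \<beta> k] upper_pointsI[of i "n - 1" \<beta> k'] jk ik by auto
    then show ?thesis using disjoint_points by blast
  next
    case 2
    then have "base + of_int (- 2 * int k) * pi * \<i> = base + of_int (2 * int k' - 1) * pi * \<i>"
      using jk(2) ik(2) by (simp add: algebra_simps)
    then have "- 2 * int k = 2 * int k' - 1" unfolding lattice_inj .
    then have False by presburger
    then show ?thesis ..
  next
    case 3
    then have e: "?c + of_int (1 - 2 * int k) * pi * \<i> = \<beta> i + of_int (2 * int k' - 1) * pi * \<i>"
      using jk(2) ik(2) by (simp add: base_def algebra_simps)
    have "i = n - 1"
    proof (rule ccontr)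
      assume "i \<noteq> n - 1"
      then have "i \<in> {1..<n - 1}" using ik(1) 3 by auto
      from generic_lattice[OF this] e show False by blast
    qed
    then have "1 - 2 * int k = 2 * int k' - 1" using e unfolding \<open>i = n - 1\<close> lattice_inj by simp
    then have "k = 0 \<or> k = 1" by presburger
    then show ?thesis using jk(2) 3 by (auto simp: pinched_def)
  next
    case 4
    then have e: "?c + of_int (2 * int k') * pi * \<i> = \<beta> j + of_int (- 2 * int k) * pi * \<i>"
      using jk(2) ik(2) by (simp add: base_def algebra_simps)
    have "j = n - 1"
    proof (rule ccontr)
      assume "j \<noteq> n - 1"
      then have "j \<in> {1..<n - 1}" using jk(1) 4 by auto
      from generic_lattice[OF this] e show False by blast
    qed
    then have "2 * int k' = - 2 * int k" using e unfolding \<open>j = n - 1\<close> lattice_inj by simp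
    then have "k = 0" by presburger
    then show ?thesis using jk(2) 4 \<open>j = n - 1\<close> by (auto simp: pinched_def)
  qed
qed

lemma separating_radii:
  fixes H :: real
  obtains y d Q where "y < - H" "d > 0" "d < 1" "Q = {q \<in> L base. Im q > y \<and> q \<notin> pinched}" "finite Q"
    "\<forall>p\<in>L base. d \<le> \<bar>Im p - y\<bar>" "\<forall>q\<in>Q. \<forall>p\<in>L base \<union> U base. p \<noteq> q \<longrightarrow> d \<le> dist q p"
proof -
  define F where "F = Im ` {p \<in> L base \<union> U base. \<bar>Im p\<bar> < \<bar>H\<bar> + 4}"
  have finF: "finite F" unfolding F_def by (intro finite_imageI finite_points_in_strip)
  \<comment> \<open>The height \<open>y\<close> is picked in a unit interval below - H, avoiding
    finitely many imaginary parts. \<open>F\<close> covers a strip reaching two units further, so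
    points outside it keep their distance from \<open>y\<close> by themselves.\<close>
  have "infinite {- \<bar>H\<bar> - 2<..<- \<bar>H\<bar> - 1}" by (rule infinite_Ioo) simp
  then obtain y where y: "y \<in> {- \<bar>H\<bar> - 2<..<- \<bar>H\<bar> - 1}" "y \<notin> F"
    using finF by (meson finite_subset subsetI)
  obtain d1 where d1: "d1 > 0" "\<forall>x\<in>F. x \<noteq> y \<longrightarrow> d1 \<le> dist y x" using finite_set_avoid[OF finF] by blast
  define Q where "Q = {q \<in> L base. Im q > y \<and> q \<notin> pinched}"
  define Bd where "Bd = (\<Sum>j=1..n. norm ((\<beta>(n := base)) j))"
  have Bd: "norm ((\<beta>(n := base)) j) \<le> Bd" if "j \<in> {1..n}" for j
    unfolding Bd_def using member_le_sum[of j "{1..n}" "\<lambda>j. norm ((\<beta>(n := base)) j)"] that by simp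
  have "Q \<subseteq> {p \<in> L base \<union> U base. \<bar>Im p\<bar> < \<bar>y\<bar> + \<bar>Bd\<bar> + 1}"
    using points_bounds(1)[of n "\<beta>(n := base)", OF Bd] unfolding Q_def by fastforce
  then have finQ: "finite Q" using finite_points_in_strip by (rule finite_subset)
  have "\<exists>d0>0. \<forall>p\<in>L base \<union> U base. p \<noteq> q \<longrightarrow> d0 \<le> dist q p" for q
  proof -
    let ?S = "{p \<in> L base \<union> U base. \<bar>Im p\<bar> < \<bar>Im q\<bar> + 1}"
    obtain d0 where d0: "d0 > 0" "\<forall>x\<in>?S. x \<noteq> q \<longrightarrow> d0 \<le> dist q x"
      using finite_set_avoid[OF finite_points_in_strip] by blast
    have "min d0 1 \<le> dist q p" if "p \<in> L base \<union> U base" "p \<noteq> q" for p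
    proof (cases "p \<in> ?S")
      case False
      then have "\<bar>Im p\<bar> \<ge> \<bar>Im q\<bar> + 1" using that by auto
      then have "1 \<le> \<bar>Im (q - p)\<bar>" by simp
      also have "\<dots> \<le> dist q p" unfolding dist_norm by (rule abs_Im_le_cmod)
      finally show ?thesis by simp
    qed (use d0(2) that in force)
    then show ?thesis using d0(1) by (intro exI[of _ "min d0 1"]) auto
  qed
  then have "\<forall>q. \<exists>d0>0. \<forall>p\<in>L base \<union> U base. p \<noteq> q \<longrightarrow> d0 \<le> dist q p" by blast
  then have "\<forall>\<^sub>F d in at_right 0. \<forall>q\<in>Q. \<forall>p\<in>L base \<union> U base. p \<noteq> q \<longrightarrow> d \<le> dist q p"
  proof (intro eventually_ball_finite[OF finQ] ballI)
    fix q assume "\<forall>q. \<exists>d0>0. \<forall>p\<in>L base \<union> U base. p \<noteq> q \<longrightarrow> d0 \<le> dist q p"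
    then obtain d0 where d0: "d0 > 0" "\<forall>p\<in>L base \<union> U base. p \<noteq> q \<longrightarrow> d0 \<le> dist q p" by blast
    have ev: "\<forall>\<^sub>F d in at_right (0::real). d < d0"
      using d0(1) by (intro eventually_at_rightI[of 0 d0]) auto
    show "\<forall>\<^sub>F d in at_right 0. \<forall>p\<in>L base \<union> U base. p \<noteq> q \<longrightarrow> d \<le> dist q p"
      using ev
    proof eventually_elim
      case (elim d)
      then show ?case using d0(2) by force
    qed
  qed
  moreover have "\<forall>\<^sub>F d in at_right (0::real). d < min d1 1"
    using d1(1) by (intro eventually_at_rightI[of 0 "min d1 1"]) auto
  moreover have "\<forall>\<^sub>F d in at_right (0::real). d > 0" by (rule eventually_at_right_less)
  ultimately have "\<forall>\<^sub>F d in at_right 0. (\<forall>q\<in>Q. \<forall>p\<in>L base \<union> U base. p \<noteq> q \<longrightarrow> d \<le> dist q p) \<and> d < min d1 1 \<and> d > 0"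
    by eventually_elim blast
  then obtain d where d: "\<forall>q\<in>Q. \<forall>p\<in>L base \<union> U base. p \<noteq> q \<longrightarrow> d \<le> dist q p" "d < min d1 1" "d > 0"
    using eventually_happens[of _ "at_right (0::real)"] trivial_limit_at_right_real by blast
  have "d \<le> \<bar>Im p - y\<bar>" if p: "p \<in> L base" for p
  proof (cases "\<bar>Im p\<bar> < \<bar>H\<bar> + 4")
    case True
    then have "Im p \<in> F" using p unfolding F_def by blast
    then have "d1 \<le> dist y (Im p)" using d1(2) y(2) by metis
    then show ?thesis using d(2) by (simp add: dist_real_def abs_minus_commute)
  next
    case False
    then show ?thesis using y(1) d(2) by auto
  qed
  then show thesis using that[of y d Q] y(1) d finQ Q_def by auto
qed

text \<open>The analytic part \<open>A\<close> consists of the integral over the fixed line and of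
  circles around the lower points that do not collide; the three remaining residues stay explicit.
  The curve is quantified inside the \<open>eventually\<close>, so one neighbourhood of
  \<open>base\<close> serves all curves.\<close>

lemma one_variable_integral:
  assumes c: "\<And>s m. s \<in> {1,2,3} \<Longrightarrow> m \<in> {1..n} \<Longrightarrow> pinch_coeff s m (c s m)"
  shows "\<exists>A. (\<forall>m\<in>{1..n}. \<forall>k i. admissible n D k i \<longrightarrow> A m k i analytic_on {base}) \<and>
    (\<forall>\<^sub>F b in at base. \<forall>C m k i. contour n (\<beta>(n := b)) C \<longrightarrow> m \<in> {1..n} \<longrightarrow> admissible n D k i \<longrightarrow>
       integrable lborel (\<lambda>t. vector_derivative C (at t) * (weight n (\<beta>(n := b)) m (C t) * monom_exp k i (C t))) \<and>
       (LINT t|lborel. vector_derivative C (at t) * (weight n (\<beta>(n := b)) m (C t) * monom_exp k i (C t))) =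
         A m k i b - 2 * pi * \<i> * (\<Sum>s\<in>{1,2,3}. c s m b / (b - base) * monom_exp k i (pinch_point s b)))"
proof -
  \<comment> \<open>One bound for all parameters while \<open>b\<close> ranges over the unit ball
    around \<open>base\<close>.\<close>
  define Bd where "Bd = (\<Sum>j=1..n. norm (\<beta> j)) + norm base + 1"
  have S0: "0 \<le> (\<Sum>j=1..n. norm (\<beta> j))" by (intro sum_nonneg) auto
  have Bd0: "Bd \<ge> 1" unfolding Bd_def using S0 norm_ge_zero[of base] by linarith
  have Bdj: "norm ((\<beta>(n := b)) j) \<le> Bd" if b: "b \<in> ball base 1" and j: "j \<in> {1..n}" for b j
  proof (cases "j = n")
    case True
    then have "norm ((\<beta>(n := b)) j) = norm b" by simp
    also have "\<dots> \<le> norm base + norm (b - base)" using norm_triangle_ineq[of base "b - base"] by simp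
    also have "\<dots> \<le> norm base + 1" using b by (simp add: dist_norm norm_minus_commute)
    finally show ?thesis using S0 unfolding Bd_def by linarith
  next
    case False
    have "norm (\<beta> j) \<le> (\<Sum>j=1..n. norm (\<beta> j))"
      by (rule member_le_sum) (use j in auto)
    then have "norm (\<beta> j) \<le> Bd" unfolding Bd_def using norm_ge_zero[of base] by linarith
    then show ?thesis using False by simp
  qed
  \<comment> \<open>The margin 10 exceeds 2 \<pi>, which puts all three pinching points above the
    line; upper points have imaginary part at least \<open>- Bd - pi\<close> and stay more than 5
    above it.\<close>
  obtain y d Q where y: "y < - (Bd + 10)" and d: "d > 0" "d < 1" and Q: "Q = {q \<in> L base. Im q > y \<and> q \<notin> pinched}"
    and finQ: "finite Q" and dy: "\<forall>p\<in>L base. d \<le> \<bar>Im p - y\<bar>"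
    and dQ: "\<forall>q\<in>Q. \<forall>p\<in>L base \<union> U base. p \<noteq> q \<longrightarrow> d \<le> dist q p"
    by (rule separating_radii[of "Bd + 10"])
  have y0: "y < 0" using y Bd0 by linarith
  \<comment> \<open>Points move by less than \<epsilon>. A lower point near some \<open>q\<close>
    therefore stays within \<epsilon> of it, and every other point stays beyond
    \<open>d - \<epsilon>\<close>; since \<open>r\<close> lies strictly between these radii, the
    circles are never hit.\<close>
  define \<epsilon> where "\<epsilon> = d / 4"
  define r where "r = d / 2"
  have er: "\<epsilon> > 0" "r > 0" "\<epsilon> < 1" "\<epsilon> < r" "r + \<epsilon> < d" "\<epsilon> < d" using d by (auto simp: \<epsilon>_def r_def)
  let ?O = "ball base \<epsilon>"
  have O1: "b \<in> ball base 1" if "b \<in> ?O" for b using that er by auto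
  have O\<epsilon>: "norm (b - base) < \<epsilon>" if "b \<in> ?O" for b using that by (simp add: dist_norm norm_minus_commute)
  have QU: "q \<notin> U base" if "q \<in> Q" for q using that lower_upper_meet_pinched unfolding Q by blast
  have Lq: "dist q p < \<epsilon> \<and> p0 = q \<or> d - \<epsilon> < dist q p \<and> p0 \<noteq> q"
    if "q \<in> Q" "p0 \<in> L base \<union> U base" "norm (p - p0) < \<epsilon>" for q p p0
  proof (cases "p0 = q")
    case True
    then show ?thesis using that(3) by (simp add: dist_norm norm_minus_commute)
  next
    case False
    then have "d \<le> dist q p0" using dQ that by blast
    also have "\<dots> \<le> dist q p + dist p p0" by (rule dist_triangle)
    finally show ?thesis using that(3) False by (simp add: dist_norm)
  qed
  have far: "dist q p < \<epsilon> \<or> d - \<epsilon> < dist q p" if "q \<in> Q" "p \<in> L b \<union> U b" "b \<in> ?O" for q p b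
    using that(2)
  proof
    assume "p \<in> L b"
    then obtain p0 where "p0 \<in> L base" "norm (p - p0) \<le> norm (b - base)" by (rule lower_points_move)
    then show ?thesis using Lq[OF that(1), of p0 p] O\<epsilon>[OF that(3)] by fastforce
  next
    assume "p \<in> U b"
    then obtain p0 where "p0 \<in> U base" "norm (p - p0) \<le> norm (b - base)" by (rule upper_points_move)
    then show ?thesis using Lq[OF that(1), of p0 p] O\<epsilon>[OF that(3)] by fastforce
  qed
  have farU: "d - \<epsilon> < dist q p" if "q \<in> Q" and p: "p \<in> U b" and "b \<in> ?O" for q p b
  proof -
    obtain p0 where "p0 \<in> U base" "norm (p - p0) \<le> norm (b - base)" using p by (rule upper_points_move)
    then show ?thesis using Lq[OF that(1), of p0 p] O\<epsilon>[OF that(3)] QU[OF that(1)] by fastforce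
  qed
  have circ: "\<alpha> \<notin> L b \<union> U b" if "q \<in> Q" "b \<in> ?O" "\<alpha> \<in> sphere q r" for q b \<alpha>
    using far[OF that(1) _ that(2), of \<alpha>] that(3) er by auto
  have yU: "y + 5 < Im p" if "p \<in> U b" "b \<in> ?O" for p b
    using points_bounds(2)[of n "\<beta>(n := b)", OF Bdj[OF O1[OF that(2)]] that(1)] y pi_less_4 by linarith
  have yL: "(Im p > y \<longleftrightarrow> Im p0 > y) \<and> Im p \<noteq> y"
    if "p0 \<in> L base" "norm (p - p0) \<le> norm (b - base)" "b \<in> ?O" for p p0 b
  proof -
    have "\<bar>Im p - Im p0\<bar> < d" using abs_Im_le_cmod[of "p - p0"] that(2) O\<epsilon>[OF that(3)] er by simp
    moreover have "d \<le> \<bar>Im p0 - y\<bar>" using dy that(1) by blast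
    ultimately show ?thesis by linarith
  qed
  have yL': "Im p \<noteq> y" if "p \<in> L b" "b \<in> ?O" for p b
    using lower_points_move[OF that(1)] yL[OF _ _ that(2)] by metis
  have line: "\<alpha> \<notin> L b \<union> U b" if "Im \<alpha> = y" "b \<in> ?O" for \<alpha> b
    using yU[of \<alpha> b] yL'[of \<alpha> b] that by auto
  define f where "f = (\<lambda>m k i b \<alpha>. weight n (\<beta>(n := b)) m \<alpha> * monom_exp k i \<alpha>)"
  have bj: "(\<lambda>b. (\<beta>(n := b)) j) analytic_on S" for j S by (cases "j = n") (auto intro: analytic_intros)
  have bjc: "continuous_on S (\<lambda>x. (\<beta>(n := fst x)) j)" for j and S :: "(complex \<times> complex) set"
    by (cases "j = n") (auto intro: continuous_intros)
  have f_cont: "continuous_on S (\<lambda>(b, \<alpha>). f m k i b \<alpha>)"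
    if m: "m \<in> {1..n}" and S: "\<And>b \<alpha>. (b, \<alpha>) \<in> S \<Longrightarrow> \<alpha> \<notin> L b \<union> U b" for m k i S
  proof -
    have "snd x \<notin> L (fst x) \<union> U (fst x)" if "x \<in> S" for x using S[of "fst x" "snd x"] that by simp
    then show ?thesis
      unfolding f_def case_prod_beta
      by (intro continuous_on_mult weight_continuous[OF bjc _ m] monom_exp_continuous continuous_intros)
  qed
  have f_holo_b: "(\<lambda>b. f m k i b \<alpha>) holomorphic_on ?O"
    if m: "m \<in> {1..n}" and S: "\<And>b. b \<in> ?O \<Longrightarrow> \<alpha> \<notin> L b \<union> U b" for m k i \<alpha>
    unfolding f_def
    by (intro analytic_imp_holomorphic analytic_on_mult weight_analytic[OF bj _ m] analytic_on_const S)
  have f_holo: "f m k i b analytic_on S"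
    if m: "m \<in> {1..n}" and S: "\<And>\<alpha>. \<alpha> \<in> S \<Longrightarrow> \<alpha> \<notin> L b \<union> U b" for m k i b S
    unfolding f_def
    by (intro analytic_on_mult weight_analytic[OF _ _ m] monom_exp_analytic analytic_on_ident analytic_on_const S)
  obtain K where K: "\<forall>(\<beta> :: nat \<Rightarrow> complex) \<alpha> m k i. (\<forall>j\<in>{1..n}. norm (\<beta> j) \<le> Bd) \<longrightarrow> \<bar>Im \<alpha>\<bar> \<le> - y \<longrightarrow>
     2 * Bd + (- y) + 20 \<le> \<bar>Re \<alpha>\<bar> \<longrightarrow> m \<in> {1..n} \<longrightarrow> k \<le> D \<longrightarrow> i < n \<longrightarrow> 2 * k + 1 \<le> n \<or> 1 \<le> i \<longrightarrow>
     norm (weight n \<beta> m \<alpha> * monom_exp k i \<alpha>) \<le> K * decay (Re \<alpha>)"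
    using weight_decay[of Bd "- y" n D] Bd0 y0 by auto
  let ?T0 = "2 * Bd + (- y) + 20"
  have fK: "norm (f m k i b \<alpha>) \<le> K * decay (Re \<alpha>)"
    if "b \<in> ?O" "m \<in> {1..n}" "admissible n D k i" "\<bar>Im \<alpha>\<bar> \<le> - y" "?T0 \<le> \<bar>Re \<alpha>\<bar>" for m k i b \<alpha>
    unfolding f_def using K that Bdj[OF O1[OF that(1)]] by (auto simp: admissible_def simp del: fun_upd_apply)
  \<comment> \<open>The circles run counterclockwise while the curve closed up below runs clockwise,
    hence the subtraction.\<close>
  define A where "A = (\<lambda>m k i b. (LINT t|lborel. f m k i b (Complex t y)) - (\<Sum>q\<in>Q. contour_integral (circlepath q r) (f m k i b)))"
  have A_analytic: "A m k i analytic_on {base}" if m: "m \<in> {1..n}" and a: "admissible n D k i" for m k i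
  proof -
    have "(\<lambda>b. LINT t|lborel. f m k i b (Complex t y)) holomorphic_on ?O"
    proof (rule line_integral_param_holomorphic(1))
      show "continuous_on (?O \<times> {\<alpha>. Im \<alpha> = y}) (\<lambda>(b, \<alpha>). f m k i b \<alpha>)" by (rule f_cont[OF m]) (use line in auto)
      show "\<And>\<alpha>. Im \<alpha> = y \<Longrightarrow> (\<lambda>b. f m k i b \<alpha>) holomorphic_on ?O" by (rule f_holo_b[OF m]) (use line in auto)
      show "\<And>b t. b \<in> ?O \<Longrightarrow> ?T0 \<le> \<bar>t\<bar> \<Longrightarrow> norm (f m k i b (Complex t y)) \<le> K * decay t"
        using fK[OF _ m a, of _ "Complex _ y"] y0 by simp
    qed simp
    moreover have "(\<lambda>b. contour_integral (circlepath q r) (f m k i b)) holomorphic_on ?O" if q: "q \<in> Q" for q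
    proof (rule contour_integral_param_holomorphic)
      show "continuous_on (?O \<times> path_image (circlepath q r)) (\<lambda>(b, \<alpha>). f m k i b \<alpha>)"
        by (rule f_cont[OF m]) (use circ[OF q] er in auto)
      show "\<And>\<alpha>. \<alpha> \<in> path_image (circlepath q r) \<Longrightarrow> (\<lambda>b. f m k i b \<alpha>) holomorphic_on ?O"
        by (rule f_holo_b[OF m]) (use circ[OF q] er in auto)
      show "continuous_on {0..1} (\<lambda>t. vector_derivative (circlepath q r) (at t))"
        unfolding vector_derivative_circlepath by (intro continuous_intros)
    qed auto
    ultimately have "A m k i holomorphic_on ?O" unfolding A_def by (intro holomorphic_intros)
    then show ?thesis using er(1) unfolding analytic_at by (intro exI[of _ ?O]) auto
  qed
  have evc: "\<forall>\<^sub>F b in at base. \<forall>s\<in>{1,2,3}. \<forall>m\<in>{1..n}. \<exists>H. H analytic_on {pinch_point s b} \<and>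
        (\<forall>\<^sub>F \<alpha> in at (pinch_point s b). weight n (\<beta>(n := b)) m \<alpha> = H \<alpha> / (\<alpha> - pinch_point s b)) \<and>
        H (pinch_point s b) = c s m b / (b - base)"
  proof (intro eventually_ball_finite ballI)
    fix s m :: nat assume "s \<in> {1,2,3}" "m \<in> {1..n}"
    from c[OF this] show "\<forall>\<^sub>F b in at base. \<exists>H. H analytic_on {pinch_point s b} \<and>
        (\<forall>\<^sub>F \<alpha> in at (pinch_point s b). weight n (\<beta>(n := b)) m \<alpha> = H \<alpha> / (\<alpha> - pinch_point s b)) \<and>
        H (pinch_point s b) = c s m b / (b - base)" unfolding pinch_coeff_def by blast
  qed simp_all
  have evO: "\<forall>\<^sub>F b in at base. b \<in> ?O \<and> b \<noteq> base"
    using er(1) by (auto simp: eventually_at dist_commute intro!: exI[of _ \<epsilon>])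
  show ?thesis
  proof (rule exI[of _ A], intro conjI)
    show "\<forall>m\<in>{1..n}. \<forall>k i. admissible n D k i \<longrightarrow> A m k i analytic_on {base}" using A_analytic by blast
    show "\<forall>\<^sub>F b in at base. \<forall>C m k i. contour n (\<beta>(n := b)) C \<longrightarrow> m \<in> {1..n} \<longrightarrow> admissible n D k i \<longrightarrow>
       integrable lborel (\<lambda>t. vector_derivative C (at t) * (weight n (\<beta>(n := b)) m (C t) * monom_exp k i (C t))) \<and>
       (LINT t|lborel. vector_derivative C (at t) * (weight n (\<beta>(n := b)) m (C t) * monom_exp k i (C t))) =
         A m k i b - 2 * pi * \<i> * (\<Sum>s\<in>{1,2,3}. c s m b / (b - base) * monom_exp k i (pinch_point s b))"
      using evc evO
    proof (eventually_elim, intro allI impI)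
      fix b C m k i
      assume cc: "\<forall>s\<in>{1,2,3}. \<forall>m\<in>{1..n}. \<exists>H. H analytic_on {pinch_point s b} \<and>
        (\<forall>\<^sub>F \<alpha> in at (pinch_point s b). weight n (\<beta>(n := b)) m \<alpha> = H \<alpha> / (\<alpha> - pinch_point s b)) \<and>
        H (pinch_point s b) = c s m b / (b - base)"
        and bO: "b \<in> ?O \<and> b \<noteq> base" and con: "contour n (\<beta>(n := b)) C" and m: "m \<in> {1..n}" and a: "admissible n D k i"
      have b: "b \<in> ?O" using bO by simp
      let ?f = "f m k i b"
      obtain R where R: "\<forall>t. R \<le> \<bar>t\<bar> \<longrightarrow> C t = of_real t" using con unfolding contour_def by blast
      have n1: "n \<ge> 1" using n2 by simp
      have holo: "?f holomorphic_on - (L b \<union> U b)"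
        by (rule analytic_imp_holomorphic, rule f_holo[OF m]) auto
      have cs: "C C1_differentiable_on UNIV" "inj C" "separates C (L b) (U b)"
        using con unfolding contour_def by blast+
      have bd: "\<And>p. p \<in> L b \<Longrightarrow> Im p \<le> Bd" by (rule points_bounds(1)[OF Bdj[OF O1[OF b]]])
      have yU2: "\<And>p. p \<in> U b \<Longrightarrow> Im p > y" using yU[OF _ b] by fastforce
      have yL2: "\<And>p. p \<in> L b \<Longrightarrow> Im p \<noteq> y" by (rule yL'[OF _ b])
      have Kb: "\<And>\<alpha>. \<bar>Im \<alpha>\<bar> \<le> - y \<Longrightarrow> ?T0 \<le> \<bar>Re \<alpha>\<bar> \<Longrightarrow> norm (?f \<alpha>) \<le> K * decay (Re \<alpha>)"
        by (rule fK[OF b m a])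
      note shift = contour_shift[where L = "L b" and U = "U b" and HL = Bd and ?T0.0 = ?T0 and K = K and y = y and f = ?f,
          OF cs(1,2) R cs(3) points_unbounded[OF n1] finite_points_in_strip]
      have CS: "integrable lborel (\<lambda>t. vector_derivative C (at t) * ?f (C t))"
        "(LINT t|lborel. vector_derivative C (at t) * ?f (C t)) =
         (LINT t|lborel. ?f (Complex t y)) - 2 * pi * \<i> * (\<Sum>p\<in>{p \<in> L b. Im p > y}. residue ?f p)"
        by (rule shift(1); fact bd y0 yU2 yL2 holo Kb) (rule shift(3); fact bd y0 yU2 yL2 holo Kb)
      let ?PP = "{b, \<beta> (n - 1), b - 2 * pi * \<i>}"
      have ptsL: "p \<in> L b \<and> Im p > y" if p: "p \<in> ?PP" for p
      proof -
        have nn: "n \<in> {1..n}" "n - 1 \<in> {1..n}" "n - 1 \<noteq> n" using n2 by auto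
        have "norm b \<le> Bd" using Bdj[OF O1[OF b] nn(1)] by simp
        moreover have "norm (\<beta> (n - 1)) \<le> Bd" using Bdj[OF O1[OF b] nn(2)] nn(3) by simp
        ultimately have "Im p > y"
          using p abs_Im_le_cmod[of b] abs_Im_le_cmod[of "\<beta> (n - 1)"] y pi_less_4 by auto
        moreover have "b \<in> L b" "b - 2 * pi * \<i> \<in> L b" "\<beta> (n - 1) \<in> L b"
          using lower_pointsI[OF nn(1), of "\<beta>(n := b)" 0] lower_pointsI[OF nn(1), of "\<beta>(n := b)" 1]
            lower_pointsI[OF nn(2), of "\<beta>(n := b)" 0] nn(3) by auto
        ultimately show ?thesis using p by blast
      qed
      have Lcl: "p \<in> ?PP \<or> (\<exists>q\<in>Q. dist q p < \<epsilon>)" if p: "p \<in> L b" "Im p > y" for p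
      proof -
        obtain p0 where p0: "p0 \<in> L base" "norm (p - p0) \<le> norm (b - base)" "p0 \<in> pinched \<longrightarrow> p \<in> ?PP"
          by (rule lower_points_move[OF p(1)])
        show ?thesis
        proof (cases "p0 \<in> pinched")
          case False
          then have "p0 \<in> Q" using p0 yL[OF p0(1,2) b] p(2) unfolding Q by blast
          moreover have "dist p0 p < \<epsilon>" using p0(2) O\<epsilon>[OF b] by (simp add: dist_norm norm_minus_commute)
          ultimately show ?thesis by blast
        qed (use p0 in blast)
      qed
      have PPfar: "d - \<epsilon> < dist q p" if q: "q \<in> Q" and p: "p \<in> ?PP" for p q
      proof -
        obtain p0 where p0: "p0 \<in> pinched" "p0 \<in> L base" "norm (p - p0) \<le> norm (b - base)"
        proof -
          have nn: "n \<in> {1..n}" "n - 1 \<in> {1..n}" "n - 1 \<noteq> n" using n2 by auto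
          have "base \<in> L base" "base - 2 * pi * \<i> \<in> L base" "\<beta> (n - 1) \<in> L base"
            using lower_pointsI[OF nn(1), of "\<beta>(n := base)" 0] lower_pointsI[OF nn(1), of "\<beta>(n := base)" 1]
              lower_pointsI[OF nn(2), of "\<beta>(n := base)" 0] nn(3) by auto
          then show thesis using p that[of base] that[of "\<beta> (n - 1)"] that[of "base - 2 * pi * \<i>"]
            by (auto simp: pinched_def)
        qed
        have "p0 \<noteq> q" using p0(1) q unfolding Q by blast
        then show ?thesis using Lq[OF q, of p0 p] p0 O\<epsilon>[OF b] by fastforce
      qed
      define N where "N = (\<lambda>q. {p \<in> L b. dist q p < \<epsilon>})"
      have finN: "finite (N q)" for q
      proof (rule finite_subset[OF _ finite_points_in_strip[of n "\<beta>(n := b)" "\<bar>Im q\<bar> + \<epsilon>"]], rule subsetI)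
        fix p assume p: "p \<in> N q"
        then have "\<bar>Im q - Im p\<bar> < \<epsilon>" using abs_Im_le_cmod[of "q - p"] by (simp add: N_def dist_norm)
        then have "\<bar>Im p\<bar> < \<bar>Im q\<bar> + \<epsilon>" by linarith
        then show "p \<in> {p \<in> L b \<union> U b. \<bar>Im p\<bar> < \<bar>Im q\<bar> + \<epsilon>}" using p by (simp add: N_def)
      qed
      \<comment> \<open>Each lower point above the line either is a pinching point or stems from
        exactly one \<open>q\<close>; the two disjointness facts below let the residue sum split
        accordingly.\<close>
      have part: "{p \<in> L b. Im p > y} = ?PP \<union> (\<Union>q\<in>Q. N q)"
      proof (intro set_eqI iffI)
        fix p assume "p \<in> {p \<in> L b. Im p > y}"
        then show "p \<in> ?PP \<union> (\<Union>q\<in>Q. N q)" using Lcl[of p] unfolding N_def by blast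
      next
        fix p assume "p \<in> ?PP \<union> (\<Union>q\<in>Q. N q)"
        then show "p \<in> {p \<in> L b. Im p > y}"
        proof
          assume "p \<in> (\<Union>q\<in>Q. N q)"
          then obtain q where q: "q \<in> Q" "p \<in> L b" "dist q p < \<epsilon>" unfolding N_def by blast
          have "q \<in> L base" "Im q > y" using q(1) unfolding Q by blast+
          then have "d \<le> \<bar>Im q - y\<bar>" using dy by blast
          moreover have "\<bar>Im q - Im p\<bar> < \<epsilon>" using q(3) abs_Im_le_cmod[of "q - p"] by (simp add: dist_norm)
          ultimately have "Im p > y" using \<open>Im q > y\<close> er by linarith
          then show ?thesis using q(2) by blast
        qed (use ptsL in blast)
      qed
      have disj1: "?PP \<inter> (\<Union>q\<in>Q. N q) = {}"
      proof -
        have False if "p \<in> ?PP" "q \<in> Q" "p \<in> N q" for p q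
          using PPfar[OF that(2,1)] that(3) d unfolding N_def \<epsilon>_def by simp
        then show ?thesis by blast
      qed
      have disj2: "N q \<inter> N q' = {}" if "q \<in> Q" "q' \<in> Q" "q \<noteq> q'" for q q'
      proof -
        have "q' \<in> L base" using that(2) unfolding Q by blast
        then have dqq: "d \<le> dist q q'" using dQ[rule_format, OF that(1), of q'] that(3) by simp
        have "False" if "p \<in> N q" "p \<in> N q'" for p
          using dist_triangle2[of q q' p] that dqq d unfolding N_def \<epsilon>_def by simp
        then show ?thesis by blast
      qed
      have circle: "contour_integral (circlepath q r) ?f = 2 * pi * \<i> * (\<Sum>p\<in>N q. residue ?f p)" if q: "q \<in> Q" for q
      proof -
        let ?B = "ball q (d - \<epsilon>)"
        have cl: "p \<in> N q" if "p \<in> ?B" "p \<in> L b \<union> U b" for p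
          using far[OF q that(2) b] farU[OF q _ b, of p] that er unfolding N_def by fastforce
        have "contour_integral (circlepath q r) ?f =
            2 * pi * \<i> * (\<Sum>p\<in>N q. winding_number (circlepath q r) p * residue ?f p)"
        proof (rule Residue_theorem)
          show "?f holomorphic_on ?B - N q"
            by (rule analytic_imp_holomorphic, rule f_holo[OF m]) (use cl in blast)
          have "sphere q r \<subseteq> ?B - N q" using er unfolding N_def by auto
          then show "path_image (circlepath q r) \<subseteq> ?B - N q" using er by simp
          show "\<forall>z. z \<notin> ?B \<longrightarrow> winding_number (circlepath q r) z = 0"
            using er by (intro allI impI winding_number_zero_outside[of _ ?B]) auto
        qed (auto intro: finN)
        also have "(\<Sum>p\<in>N q. winding_number (circlepath q r) p * residue ?f p) = (\<Sum>p\<in>N q. residue ?f p)"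
        proof (rule sum.cong[OF refl])
          fix p assume "p \<in> N q"
          then have "norm (p - q) < r" using er unfolding N_def by (auto simp: dist_norm norm_minus_commute)
          then show "winding_number (circlepath q r) p * residue ?f p = residue ?f p"
            by (simp add: winding_number_circlepath)
        qed
        finally show ?thesis .
      qed
      have distinct: "b \<noteq> \<beta> (n - 1)" "b \<noteq> b - 2 * pi * \<i>" "\<beta> (n - 1) \<noteq> b - 2 * pi * \<i>"
      proof -
        have "\<bar>Im b - Im base\<bar> < 1" using O\<epsilon>[OF b] er abs_Im_le_cmod[of "b - base"] by simp
        then show "b \<noteq> \<beta> (n - 1)" "\<beta> (n - 1) \<noteq> b - 2 * pi * \<i>"
          using pi_gt3 by (auto simp: base_def complex_eq_iff)
      qed simp
      have res: "residue ?f (pinch_point s b) = c s m b / (b - base) * monom_exp k i (pinch_point s b)"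
        if s: "s \<in> {1,2,3}" for s
      proof -
        obtain H where H: "H analytic_on {pinch_point s b}"
          "\<forall>\<^sub>F \<alpha> in at (pinch_point s b). weight n (\<beta>(n := b)) m \<alpha> = H \<alpha> / (\<alpha> - pinch_point s b)"
          "H (pinch_point s b) = c s m b / (b - base)" using cc s m by blast
        have "monom_exp k i analytic_on {pinch_point s b}"
          using monom_exp_analytic[OF analytic_on_ident] .
        from residue_simple_pole_mult[OF H(1) this H(2)] show ?thesis unfolding f_def H(3) .
      qed
      have "(\<Sum>p\<in>{p \<in> L b. Im p > y}. residue ?f p) = (\<Sum>p\<in>?PP. residue ?f p) + (\<Sum>p\<in>(\<Union>q\<in>Q. N q). residue ?f p)"
        unfolding part by (rule sum.union_disjoint[OF _ _ disj1]) (auto simp: finQ finN)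
      also have "(\<Sum>p\<in>(\<Union>q\<in>Q. N q). residue ?f p) = (\<Sum>q\<in>Q. \<Sum>p\<in>N q. residue ?f p)"
        by (rule sum.UNION_disjoint) (use finQ finN disj2 in auto)
      also have "(\<Sum>p\<in>?PP. residue ?f p) = (\<Sum>s\<in>{1,2,3}. residue ?f (pinch_point s b))"
        using distinct by (simp add: pinch_point_def)
      also have "\<dots> = (\<Sum>s\<in>{1,2,3}. c s m b / (b - base) * monom_exp k i (pinch_point s b))"
        by (intro sum.cong refl res)
      finally have SS: "(\<Sum>p\<in>{p \<in> L b. Im p > y}. residue ?f p) =
          (\<Sum>s\<in>{1,2,3}. c s m b / (b - base) * monom_exp k i (pinch_point s b)) +
          (\<Sum>q\<in>Q. \<Sum>p\<in>N q. residue ?f p)" .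
      have cs: "(\<Sum>q\<in>Q. contour_integral (circlepath q r) ?f) = 2 * pi * \<i> * (\<Sum>q\<in>Q. \<Sum>p\<in>N q. residue ?f p)"
        unfolding sum_distrib_left[of _ _ Q] by (intro sum.cong refl circle)
      have "2 * pi * \<i> * (\<Sum>p\<in>{p \<in> L b. Im p > y}. residue ?f p) =
          2 * pi * \<i> * (\<Sum>s\<in>{1,2,3}. c s m b / (b - base) * monom_exp k i (pinch_point s b)) +
          (\<Sum>q\<in>Q. contour_integral (circlepath q r) ?f)"
        unfolding SS cs by (rule distrib_left)
      then have "(LINT t|lborel. vector_derivative C (at t) * ?f (C t)) =
         A m k i b - 2 * pi * \<i> * (\<Sum>s\<in>{1,2,3}. c s m b / (b - base) * monom_exp k i (pinch_point s b))"
        unfolding CS(2) A_def by (simp only: diff_diff_eq add.commute)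
      then show "integrable lborel (\<lambda>t. vector_derivative C (at t) * (weight n (\<beta>(n := b)) m (C t) * monom_exp k i (C t))) \<and>
       (LINT t|lborel. vector_derivative C (at t) * (weight n (\<beta>(n := b)) m (C t) * monom_exp k i (C t))) =
         A m k i b - 2 * pi * \<i> * (\<Sum>s\<in>{1,2,3}. c s m b / (b - base) * monom_exp k i (pinch_point s b))"
        using CS(1) unfolding f_def by blast
    qed
  qed
qed

end

section \<open>The multiple integral\<close>

lemma wedge_HD:
  assumes "P \<in> wedge_H n l"
  shows "\<forall>m\<in>Poly_Mapping.keys P. Poly_Mapping.keys m \<subseteq> Inl ` {1..l} \<union> Inr ` {1..n}"
    "\<And>m a. m \<in> Poly_Mapping.keys P \<Longrightarrow> a \<in> {1..l} \<Longrightarrow> X_exp m a < n"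
    "\<And>\<sigma> X x. \<sigma> permutes {1..l} \<Longrightarrow> eval_poly P (X \<circ> \<sigma>) x = of_int (sign \<sigma>) * eval_poly P X x"
  using assms unfolding wedge_H_def X_exp_def by blast+

lemma eval_poly_transpose:
  assumes P: "P \<in> wedge_H n l" and ab: "a \<in> {1..l}" "b \<in> {1..l}" "a \<noteq> b"
  shows "eval_poly P (X \<circ> Transposition.transpose a b) x = - eval_poly P X x"
  using wedge_HD(3)[OF P permutes_swap_id[OF ab(1,2)], of X x] ab(3) by (simp add: sign_swap_id)

lemma eval_poly_eq_args:
  assumes P: "P \<in> wedge_H n l" and ab: "a \<in> {1..l}" "b \<in> {1..l}" "a \<noteq> b" and eq: "X a = X b"
  shows "eval_poly P X x = 0"
proof -
  have "X \<circ> Transposition.transpose a b = X" using eq by (auto simp: fun_eq_iff Transposition.transpose_def)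
  then have "eval_poly P X x = - eval_poly P X x" using eval_poly_transpose[OF P ab, of X x] by simp
  then show ?thesis by simp
qed

text \<open>Exchanging two arguments costs only a sign, so vanishing at a value in one slot passes
  to every slot. It is applied to the first slot with value 0 and to the last slot, the one that
  \<open>rho\<close> substitutes.\<close>

lemma eval_poly_zero_any_arg:
  assumes P: "P \<in> wedge_H n l" and ab: "a \<in> {1..l}" "b \<in> {1..l}"
    and zero: "\<And>X. X b = c \<Longrightarrow> eval_poly P X x = 0" and Xa: "X a = c"
  shows "eval_poly P X x = 0"
proof (cases "a = b")
  case False
  have "eval_poly P (X \<circ> Transposition.transpose a b) x = 0" by (rule zero) (simp add: Xa)
  then show ?thesis using eval_poly_transpose[OF P ab False, of X x] by simp
qed (use zero Xa in simp)

section \<open>Reduction of the multiple integral to one-variable integrals\<close>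

definition pairs :: "nat \<Rightarrow> (nat \<times> nat) set" where
  "pairs l = {(a, b). 1 \<le> a \<and> a < b \<and> b \<le> l}"

lemma finite_pairs: "finite (pairs l)"
  by (rule finite_subset[of _ "{1..l} \<times> {1..l}"]) (auto simp: pairs_def)

lemma prod_pairs: "(\<Prod>b=1..l. \<Prod>a=1..<b. h a b) = (\<Prod>(a, b)\<in>pairs l. h a b)"
proof -
  have "(\<Prod>b=1..l. \<Prod>a=1..<b. h a b) = (\<Prod>(b, a)\<in>(SIGMA b:{1..l}. {1..<b}). h a b)"
    by (rule prod.Sigma) auto
  also have "\<dots> = (\<Prod>(a, b)\<in>pairs l. h a b)"
    by (rule prod.reindex_bij_witness[of _ prod.swap prod.swap]) (auto simp: pairs_def)
  finally show ?thesis .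
qed

text \<open>A pair containing \<open>a\<close> is determined by its other member.\<close>

lemma card_pairs_at:
  assumes "a \<in> {1..l}"
  shows "card {p \<in> pairs l. fst p = a \<or> snd p = a} \<le> l - 1"
proof -
  let ?S = "{p \<in> pairs l. fst p = a \<or> snd p = a}" and ?g = "\<lambda>p. if fst p = a then snd p else fst p"
  have "card ?S \<le> card ({1..l} - {a})"
  proof (rule card_inj_on_le)
    show "inj_on ?g ?S" by (auto simp: inj_on_def pairs_def)
    show "?g ` ?S \<subseteq> {1..l} - {a}" by (auto simp: pairs_def)
  qed simp
  then show ?thesis using assms by simp
qed

text \<open>The factor exactly as it stands in \<open>I_M\<close>: where some \<open>1 - X x\<close>
  is 0 it takes the value 0 of a division by zero, whereas \<open>weight\<close> has no such gaps on
  an admissible contour.\<close>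

definition raw_weight :: "nat \<Rightarrow> (nat \<Rightarrow> complex) \<Rightarrow> nat \<Rightarrow> complex \<Rightarrow> complex" where
  "raw_weight n \<beta> m \<alpha> = phi n \<beta> \<alpha> * rational_factor \<beta> m \<alpha> / (\<Prod>j=1..n. 1 - exp (- \<alpha>) * exp (\<beta> j))"

lemma I_M_integrand:
  "(\<Prod>a=1..l. phi n \<beta> (\<alpha> a)) * g l \<beta> M \<alpha> *
     (eval_poly P (\<lambda>a. exp (- \<alpha> a)) x / (\<Prod>a=1..l. \<Prod>j=1..n. 1 - exp (- \<alpha> a) * exp (\<beta> j))) =
   (\<Prod>a=1..l. raw_weight n \<beta> (M ! (a - 1)) (\<alpha> a)) *
     ((\<Prod>(a, b)\<in>pairs l. \<alpha> a - \<alpha> b + pi * \<i>) * eval_poly P (\<lambda>a. exp (- \<alpha> a)) x)"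
  unfolding g_def prod_pairs raw_weight_def prod_dividef prod.distrib rational_factor_def
  by (simp add: mult_ac)

text \<open>The two weights differ only where some \<open>1 - X x\<close> is 0, which is a countable
  set of values of \<alpha>, and an injective curve takes each value at most once. Integrals along
  the curve cannot see the difference.\<close>

lemma raw_weight_exceptions:
  fixes C :: "real \<Rightarrow> complex"
  assumes inj: "inj C"
  shows "countable {t :: real. raw_weight n \<beta> m (C t) \<noteq> weight n \<beta> m (C t)}"
proof -
  let ?Z = "(\<lambda>(j, k). \<beta> j + of_int (2 * k) * pi * \<i>) ` ({1..n} \<times> (UNIV :: int set))"
  have "C t \<in> ?Z" if neq: "raw_weight n \<beta> m (C t) \<noteq> weight n \<beta> m (C t)" for t
  proof -
    obtain j where j: "j \<in> {1..n}" "1 - exp (- C t) * exp (\<beta> j) = 0"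
    proof -
      have "\<not> (\<forall>j\<in>{1..n}. 1 - exp (- C t) * exp (\<beta> j) \<noteq> 0)"
      proof
        assume "\<forall>j\<in>{1..n}. 1 - exp (- C t) * exp (\<beta> j) \<noteq> 0"
        then have "weight n \<beta> m (C t) = raw_weight n \<beta> m (C t)"
          unfolding raw_weight_def by (intro weight_eq) blast
        then show False using neq by simp
      qed
      then show thesis using that by blast
    qed
    then have "exp (\<beta> j) = exp (C t)" by (simp add: exp_minus field_simps)
    then obtain k :: int where "\<beta> j = C t + of_int (2 * k) * pi * \<i>" unfolding exp_eq by blast
    then have "C t = \<beta> j + of_int (2 * (- k)) * pi * \<i>" by simp
    then show ?thesis using j(1) by (intro image_eqI[of _ _ "(j, - k)"]) auto
  qed
  then have "C ` {t. raw_weight n \<beta> m (C t) \<noteq> weight n \<beta> m (C t)} \<subseteq> ?Z" by blast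
  moreover have "countable ?Z" by (intro countable_image countable_SIGMA) auto
  ultimately have "countable (C ` {t. raw_weight n \<beta> m (C t) \<noteq> weight n \<beta> m (C t)})"
    by (rule countable_subset)
  then show ?thesis using inj by (auto dest: countable_image_inj_on inj_on_subset)
qed

lemma raw_weight_integral:
  fixes C :: "real \<Rightarrow> complex"
  assumes inj: "inj C"
  shows "integrable lborel (\<lambda>t. D t * (raw_weight n \<beta> m (C t) * u t)) \<longleftrightarrow>
           integrable lborel (\<lambda>t. D t * (weight n \<beta> m (C t) * u t))"
    "(LINT t|lborel. D t * (raw_weight n \<beta> m (C t) * u t)) = (LINT t|lborel. D t * (weight n \<beta> m (C t) * u t))"
  by (rule integrable_discrete_difference[OF raw_weight_exceptions[OF inj, of n \<beta> m]]; auto)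
     (rule integral_discrete_difference[OF raw_weight_exceptions[OF inj, of n \<beta> m]]; auto)

text \<open>Fubini's theorem, monomial by monomial. It demands that every single monomial be
  integrable, although \<open>I_M\<close> only involves their sum; this is why the monomials of the
  representation have to be chosen with care.\<close>

lemma I_M_tensor:
  fixes C :: "real \<Rightarrow> complex"
  assumes inj: "inj C" and R: "finite R"
    and rep: "\<And>\<alpha>. (\<Prod>(a, b)\<in>pairs l. \<alpha> a - \<alpha> b + pi * \<i>) * eval_poly P (\<lambda>a. exp (- \<alpha> a)) (\<lambda>j. exp (\<beta> j)) =
       (\<Sum>r\<in>R. d r * (\<Prod>a=1..l. monom_exp (k r a) (i r a) (\<alpha> a)))"
    and int: "\<And>r a. r \<in> R \<Longrightarrow> a \<in> {1..l} \<Longrightarrow>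
       integrable lborel (\<lambda>t. vector_derivative C (at t) * (weight n \<beta> (M ! (a - 1)) (C t) * monom_exp (k r a) (i r a) (C t)))"
  shows "I_M n l P C \<beta> M = (\<Sum>r\<in>R. d r * (\<Prod>a=1..l.
     LINT t|lborel. vector_derivative C (at t) * (weight n \<beta> (M ! (a - 1)) (C t) * monom_exp (k r a) (i r a) (C t))))"
proof -
  interpret product_sigma_finite "\<lambda>_::nat. lborel :: real measure" by unfold_locales
  let ?u = "\<lambda>r a t. vector_derivative C (at t) * (raw_weight n \<beta> (M ! (a - 1)) (C t) * monom_exp (k r a) (i r a) (C t))"
  have ir: "integrable lborel (?u r a)" if "r \<in> R" "a \<in> {1..l}" for r a
    unfolding raw_weight_integral(1)[OF inj] using int[OF that] .
  have "I_M n l P C \<beta> M = (LINT t|PiM {1..l} (\<lambda>_. lborel). (\<Sum>r\<in>R. d r * (\<Prod>a=1..l. ?u r a (t a))))"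
    unfolding I_M_def integral_over_power_def I_M_integrand rep
    by (rule Bochner_Integration.integral_cong[OF refl])
       (simp add: sum_distrib_left prod.distrib mult_ac)
  also have "\<dots> = (\<Sum>r\<in>R. LINT t|PiM {1..l} (\<lambda>_. lborel). d r * (\<Prod>a=1..l. ?u r a (t a)))"
    by (rule Bochner_Integration.integral_sum) (intro integrable_mult_right product_integrable_prod ir; simp)
  also have "\<dots> = (\<Sum>r\<in>R. d r * (\<Prod>a=1..l. LINT t|lborel. ?u r a t))"
  proof (rule sum.cong[OF refl])
    fix r assume r: "r \<in> R"
    have "(LINT t|PiM {1..l} (\<lambda>_. lborel). (\<Prod>a=1..l. ?u r a (t a))) = (\<Prod>a=1..l. LINT t|lborel. ?u r a t)"
      by (rule product_integral_prod[OF finite_atLeastAtMost ir[OF r]])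
    then show "(LINT t|PiM {1..l} (\<lambda>_. lborel). d r * (\<Prod>a=1..l. ?u r a (t a))) = d r * (\<Prod>a=1..l. LINT t|lborel. ?u r a t)"
      by (simp only: integral_mult_right_zero)
  qed
  finally show ?thesis unfolding raw_weight_integral(2)[OF inj] .
qed

section \<open>Divergence when the degree is too high\<close>

lemma eval_poly_Lipschitz:
  assumes keys: "\<forall>m\<in>Poly_Mapping.keys P. Poly_Mapping.keys m \<subseteq> Inl ` {1..l} \<union> Inr ` {1..n}"
  shows "\<exists>K\<ge>0. \<forall>X Y. (\<forall>a\<in>{1..l}. norm (X a) \<le> 1 \<and> norm (Y a) \<le> 1) \<longrightarrow>
     norm (eval_poly P X x - eval_poly P Y x) \<le> K * (\<Sum>a=1..l. norm (X a - Y a))"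
proof -
  let ?c = "\<lambda>m. Poly_Mapping.lookup P m * x_part n m x"
  define K where "K = (\<Sum>m\<in>Poly_Mapping.keys P. norm (?c m) * (\<Sum>a=1..l. real (X_exp m a)))"
  have "K \<ge> 0" unfolding K_def by (intro sum_nonneg mult_nonneg_nonneg) auto
  moreover have "norm (eval_poly P X x - eval_poly P Y x) \<le> K * (\<Sum>a=1..l. norm (X a - Y a))"
    if XY: "\<forall>a\<in>{1..l}. norm (X a) \<le> 1 \<and> norm (Y a) \<le> 1" for X Y
  proof -
    let ?D = "\<Sum>a=1..l. norm (X a - Y a)"
    have one: "norm ((\<Prod>a=1..l. X a ^ X_exp m a) - (\<Prod>a=1..l. Y a ^ X_exp m a)) \<le> (\<Sum>a=1..l. real (X_exp m a)) * ?D" for m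
    proof -
      have "norm ((\<Prod>a=1..l. X a ^ X_exp m a) - (\<Prod>a=1..l. Y a ^ X_exp m a)) \<le>
          (\<Sum>a=1..l. norm (X a ^ X_exp m a - Y a ^ X_exp m a))"
        by (rule norm_prod_diff) (use XY in \<open>auto simp: norm_power intro: power_le_one\<close>)
      also have "\<dots> \<le> (\<Sum>a=1..l. real (X_exp m a) * ?D)"
      proof (rule sum_mono)
        fix a assume a: "a \<in> {1..l}"
        have "norm (X a ^ X_exp m a - Y a ^ X_exp m a) \<le> real (X_exp m a) * norm (X a - Y a)"
          using XY a by (intro norm_power_diff) auto
        also have "\<dots> \<le> real (X_exp m a) * ?D"
          using a by (intro mult_left_mono member_le_sum) auto
        finally show "norm (X a ^ X_exp m a - Y a ^ X_exp m a) \<le> real (X_exp m a) * ?D" .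
      qed
      finally show ?thesis by (simp add: sum_distrib_right)
    qed
    have e: "eval_poly P X x - eval_poly P Y x =
        (\<Sum>m\<in>Poly_Mapping.keys P. ?c m * ((\<Prod>a=1..l. X a ^ X_exp m a) - (\<Prod>a=1..l. Y a ^ X_exp m a)))"
      unfolding eval_poly_expand[OF keys] by (simp add: sum_subtractf right_diff_distrib)
    have "norm (eval_poly P X x - eval_poly P Y x) \<le>
        (\<Sum>m\<in>Poly_Mapping.keys P. norm (?c m) * ((\<Sum>a=1..l. real (X_exp m a)) * ?D))"
      unfolding e
    proof (rule sum_norm_le)
      fix m
      show "norm (?c m * ((\<Prod>a=1..l. X a ^ X_exp m a) - (\<Prod>a=1..l. Y a ^ X_exp m a))) \<le>
          norm (?c m) * ((\<Sum>a=1..l. real (X_exp m a)) * ?D)"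
        unfolding norm_mult[of "?c m"] by (intro mult_left_mono one) simp
    qed
    also have "\<dots> = K * ?D" unfolding K_def by (simp add: sum_distrib_right mult.assoc)
    finally show ?thesis .
  qed
  ultimately show ?thesis by blast
qed

lemma eval_poly_update_holomorphic:
  assumes keys: "\<forall>m\<in>Poly_Mapping.keys P. Poly_Mapping.keys m \<subseteq> Inl ` {1..l} \<union> Inr ` {1..n}"
    and h: "\<And>a. a \<in> {1..l} \<Longrightarrow> (\<lambda>z. X z a) holomorphic_on S" "\<And>j. j \<in> {1..n} \<Longrightarrow> (\<lambda>z. x z j) holomorphic_on S"
  shows "(\<lambda>z. eval_poly P (X z) (x z)) holomorphic_on S"
  unfolding eval_poly_expand[OF keys] x_part_def
  by (intro holomorphic_intros h)

text \<open>The coordinates are changed one at a time: in each of them the polynomial is an entire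
  function that is not identically 0, so it cannot vanish at all points \<open>exp (- t)\<close>
  with \<open>t > T\<close>, which accumulate at 0.\<close>

lemma eval_poly_nonzero_small:
  assumes P: "P \<in> wedge_H n l" and X: "eval_poly P X x \<noteq> 0" "X 1 = 0"
  shows "\<exists>\<tau>. (\<forall>a\<in>{2..l}. \<tau> a > T) \<and> eval_poly P (\<lambda>a. if a = 1 then 0 else exp (- complex_of_real (\<tau> a))) x \<noteq> 0"
proof -
  note keys = wedge_HD(1)[OF P]
  have "\<exists>X. X 1 = 0 \<and> eval_poly P X x \<noteq> 0 \<and> (\<forall>a\<in>S. \<exists>\<tau>>T. X a = exp (- complex_of_real \<tau>))"
    if "S \<subseteq> {2..l}" for S
    using finite_subset[OF that finite_atLeastAtMost] that
  proof (induction S)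
    case empty
    then show ?case using X by blast
  next
    case (insert s S)
    obtain Y where Y: "Y 1 = 0" "eval_poly P Y x \<noteq> 0" "\<forall>a\<in>S. \<exists>\<tau>>T. Y a = exp (- complex_of_real \<tau>)"
      using insert by auto
    let ?f = "\<lambda>z. eval_poly P (Y(s := z)) x"
    have "\<exists>\<tau>>T. ?f (exp (- complex_of_real \<tau>)) \<noteq> 0"
    proof (rule ccontr)
      assume "\<not> (\<exists>\<tau>>T. ?f (exp (- complex_of_real \<tau>)) \<noteq> 0)"
      then have z: "?f w = 0" if "w \<in> {exp (- complex_of_real t) |t. t > T}" for w using that by blast
      have "?f (Y s) = 0"
      proof (rule analytic_continuation[of ?f UNIV "{exp (- complex_of_real t) |t. t > T}" 0])
        show "?f holomorphic_on UNIV"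
        proof (rule eval_poly_update_holomorphic[OF keys])
          show "(\<lambda>z. (Y(s := z)) a) holomorphic_on UNIV" for a
            by (cases "a = s") (auto intro: holomorphic_intros)
        qed (intro holomorphic_intros)
        show "0 islimpt {exp (- complex_of_real t) |t. t > T}"
          unfolding islimpt_approachable
        proof (intro allI impI)
          fix e :: real assume e: "e > 0"
          define \<tau> where "\<tau> = max (T + 1) (1 - ln e)"
          have "- \<tau> < ln e" unfolding \<tau>_def by simp
          then have "exp (- \<tau>) < e" using e by (metis exp_less_cancel_iff exp_ln)
          then have "dist (exp (- complex_of_real \<tau>)) 0 < e" by (simp add: norm_exp_eq_Re)
          moreover have "\<tau> > T" unfolding \<tau>_def by simp
          ultimately show "\<exists>x'\<in>{exp (- complex_of_real t) |t. t > T}. x' \<noteq> 0 \<and> dist x' 0 < e"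
            by (intro bexI[of _ "exp (- complex_of_real \<tau>)"]) auto
        qed
      qed (use z in auto)
      then show False using Y(2) by simp
    qed
    then obtain \<tau> where \<tau>: "\<tau> > T" "?f (exp (- complex_of_real \<tau>)) \<noteq> 0" by blast
    have "s \<noteq> 1" using insert.prems by auto
    show ?case
    proof (intro exI[of _ "Y(s := exp (- complex_of_real \<tau>))"] conjI ballI)
      show "(Y(s := exp (- complex_of_real \<tau>))) 1 = 0" using Y(1) \<open>s \<noteq> 1\<close> by simp
      show "?f (exp (- complex_of_real \<tau>)) \<noteq> 0" by (rule \<tau>(2))
      fix a assume "a \<in> insert s S"
      then show "\<exists>t>T. (Y(s := exp (- complex_of_real \<tau>))) a = exp (- complex_of_real t)"
        using Y(3) \<tau>(1) by (cases "a = s") auto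
    qed
  qed
  from this[of "{2..l}"] obtain Y where Y: "Y 1 = 0" "eval_poly P Y x \<noteq> 0"
    "\<forall>a\<in>{2..l}. \<exists>\<tau>>T. Y a = exp (- complex_of_real \<tau>)" by auto
  from Y(3) obtain \<tau> where \<tau>: "\<forall>a\<in>{2..l}. \<tau> a > T \<and> Y a = exp (- complex_of_real (\<tau> a))" by metis
  have "eval_poly P (\<lambda>a. if a = 1 then 0 else exp (- complex_of_real (\<tau> a))) x = eval_poly P Y x"
    unfolding eval_poly_expand[OF keys] using \<tau> Y(1)
    by (intro sum.cong refl arg_cong2[of _ _ _ _ "(*)"] prod.cong) (auto simp: not_less)
  then show ?thesis using Y(2) \<tau> by (intro exI[of _ \<tau>]) auto
qed

lemma nn_integral_inverse_atLeast:
  assumes "T > 0"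
  shows "(\<integral>\<^sup>+t. ennreal (indicator {T..} t * (1 / t)) \<partial>lborel) = top"
proof -
  have "ennreal (ln N - ln T) \<le> (\<integral>\<^sup>+t. ennreal (indicator {T..} t * (1 / t)) \<partial>lborel)" if N: "N \<ge> T" for N
  proof -
    have "(\<integral>\<^sup>+t. ennreal (1 / t) * indicator {T..N} t \<partial>lborel) = ennreal (ln N - ln T)"
      by (rule nn_integral_FTC_Icc) (use assms N in \<open>auto intro!: derivative_eq_intros\<close>)
    moreover have "(\<integral>\<^sup>+t. ennreal (1 / t) * indicator {T..N} t \<partial>lborel) \<le> (\<integral>\<^sup>+t. ennreal (indicator {T..} t * (1 / t)) \<partial>lborel)"
      by (rule nn_integral_mono) (auto simp: indicator_def)
    ultimately show ?thesis by simp
  qed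
  \<comment> \<open>For \<open>N = T * exp x\<close> the difference of the logarithms is
    \<open>x\<close>.\<close>
  then have le: "ennreal x \<le> (\<integral>\<^sup>+t. ennreal (indicator {T..} t * (1 / t)) \<partial>lborel)" if "x \<ge> 0" for x
    using assms that by (auto simp: ln_mult dest!: meta_spec[of _ "T * exp x"])
  show ?thesis
  proof (rule ccontr)
    assume "(\<integral>\<^sup>+t. ennreal (indicator {T..} t * (1 / t)) \<partial>lborel) \<noteq> top"
    then obtain r where r: "r \<ge> 0" "(\<integral>\<^sup>+t. ennreal (indicator {T..} t * (1 / t)) \<partial>lborel) = ennreal r"
      by (cases "\<integral>\<^sup>+t. ennreal (indicator {T..} t * (1 / t)) \<partial>lborel") auto
    have "ennreal (r + 1) \<le> ennreal r" using le[of "r + 1"] r by simp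
    then show False using r(1) by simp
  qed
qed

lemma exp_minus_Lipschitz:
  fixes s t :: real
  assumes "0 \<le> s" "s \<le> t"
  shows "\<bar>exp (- t) - exp (- s)\<bar> \<le> t - s"
proof -
  have "exp (- s) - exp (- t) = exp (- s) * (1 - exp (- (t - s)))"
    by (simp add: right_diff_distrib exp_add[symmetric])
  also have "\<dots> \<le> 1 * (1 - exp (- (t - s)))" using assms by (intro mult_right_mono) auto
  also have "\<dots> = 1 - exp (s - t)" by simp
  also have "\<dots> \<le> t - s" using exp_ge_add_one_self[of "s - t"] by linarith
  finally have "exp (- s) - exp (- t) \<le> t - s" .
  moreover have "exp (- t) \<le> exp (- s)" using assms by simp
  ultimately show ?thesis by (simp add: abs_if)
qed

lemma prod_pairs_first:
  fixes q :: real
  shows "(\<Prod>(a, b)\<in>pairs l. if a = 1 then q else 1) = q ^ (l - 1)"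
proof -
  have "(\<Prod>(a, b)\<in>pairs l. if a = 1 then q else 1) = (\<Prod>b=1..l. \<Prod>a=1..<b. if a = 1 then q else 1)"
    by (rule prod_pairs[symmetric])
  also have "\<dots> = (\<Prod>b=1..l. if b \<in> {2..l} then q else 1)"
    by (intro prod.cong refl) (auto simp: prod.delta)
  also have "\<dots> = (\<Prod>b\<in>{2..l}. q)"
    by (subst prod.inter_restrict[symmetric]) (auto intro!: prod.cong)
  finally show ?thesis by simp
qed

text \<open>The first variable tends to infinity and the others are confined to short intervals. The
  weight is then of order \<open>t powr (- 1 - n/2)\<close>, while the \<open>l - 1\<close> pair
  factors with the first variable grow like \<open>t\<close>. With
  \<open>2 * (l - 1) \<ge> n\<close> the integrand is at least of order \<open>1 / t\<close>,
  because \<open>P\<close> stays away from 0 near a suitable point with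
  \<open>X 1 = 0\<close>.\<close>

lemma I_M_eq_0_of_slow_decay:
  fixes C :: "real \<Rightarrow> complex"
  assumes P: "P \<in> wedge_H n l" and l: "l \<ge> 1" "n + 2 \<le> 2 * l"
    and con: "contour n \<beta> C" and M: "M \<in> indices n l"
    and X: "eval_poly P X (\<lambda>j. exp (\<beta> j)) \<noteq> 0" "X 1 = 0"
  shows "I_M n l P C \<beta> M = 0"
proof -
  interpret product_sigma_finite "\<lambda>_::nat. lborel :: real measure" by unfold_locales
  let ?x = "\<lambda>j. exp (\<beta> j)"
  let ?f = "\<lambda>t. (\<Prod>a=1..l. vector_derivative C (at (t a))) *
     ((\<Prod>a=1..l. raw_weight n \<beta> (M ! (a - 1)) (C (t a))) *
      ((\<Prod>(a, b)\<in>pairs l. C (t a) - C (t b) + pi * \<i>) * eval_poly P (\<lambda>a. exp (- C (t a))) ?x))"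
  have I: "I_M n l P C \<beta> M = (LINT t|PiM {1..l} (\<lambda>_. lborel). ?f t)"
    unfolding I_M_def integral_over_power_def I_M_integrand ..
  obtain R where R: "\<forall>t. R \<le> \<bar>t\<bar> \<longrightarrow> C t = of_real t" using con unfolding contour_def by blast
  define Bd where "Bd = (\<Sum>j=1..n. norm (\<beta> j))"
  have Bd: "norm (\<beta> j) \<le> Bd" if "j \<in> {1..n}" for j
    unfolding Bd_def by (rule member_le_sum) (use that in auto)
  have Bd0: "Bd \<ge> 0" unfolding Bd_def by (intro sum_nonneg) auto
  \<comment> \<open>Beyond \<open>T0\<close> the curve is the real line with derivative 1, and the
    bounds for the weight apply.\<close>
  define T0 where "T0 = 2 * Bd + 20 + \<bar>R\<bar> + 1"
  have Mm: "M ! (a - 1) \<in> {1..n}" if "a \<in> {1..l}" for a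
  proof -
    have "a - 1 < length M" using M that unfolding indices_def by auto
    then show ?thesis using M nth_mem unfolding indices_def by blast
  qed
  have Creal: "C t = of_real t" "vector_derivative C (at t) = 1" if t: "t \<ge> T0" for t
  proof -
    show "C t = of_real t" using R t Bd0 unfolding T0_def by auto
    have "((\<lambda>t. of_real t) has_vector_derivative (1::complex)) (at t)" by (auto intro!: derivative_eq_intros)
    then have "(C has_vector_derivative 1) (at t)"
    proof (rule has_vector_derivative_transform_within_open)
      show "open {t. \<bar>R\<bar> < t}" by (intro open_Collect_less continuous_intros)
    qed (use t R Bd0 in \<open>auto simp: T0_def\<close>)
    then show "vector_derivative C (at t) = 1" by (rule vector_derivative_at)
  qed
  define w0 where "w0 = (sqrt Gamma_quot_lower / 2) ^ n / 2 ^ (n + 1)"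
  have w0: "w0 > 0" unfolding w0_def Gamma_quot_lower_def by simp
  have W: "norm (raw_weight n \<beta> m (of_real t)) \<ge> w0 / (t * sqrt t ^ n)" if m: "m \<in> {1..n}" and t: "t \<ge> T0" for m t
  proof -
    have "raw_weight n \<beta> m (of_real t) = weight n \<beta> m (of_real t)"
      unfolding raw_weight_def
    proof (rule weight_eq[symmetric])
      fix j assume j: "j \<in> {1..n}"
      show "1 - exp (- complex_of_real t) * exp (\<beta> j) \<noteq> 0"
        by (rule gamma_factor_bounds(1)[of Bd 0]) (use t Bd[OF j] Bd0 in \<open>auto simp: T0_def\<close>)
    qed
    then show ?thesis unfolding w0_def using weight_lower_bound[OF Bd m, where t = t] t by (simp add: T0_def)
  qed
  obtain \<tau> where \<tau>: "\<forall>a\<in>{2..l}. \<tau> a > T0"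
    "eval_poly P (\<lambda>a. if a = 1 then 0 else exp (- complex_of_real (\<tau> a))) ?x \<noteq> 0"
    using eval_poly_nonzero_small[OF P X, of T0] by blast
  let ?Y = "\<lambda>a. if a = 1 then 0 else exp (- complex_of_real (\<tau> a))"
  define p0 where "p0 = norm (eval_poly P ?Y ?x)"
  have p0: "p0 > 0" unfolding p0_def using \<tau>(2) by simp
  obtain K where K: "K \<ge> 0" "\<forall>X Y. (\<forall>a\<in>{1..l}. norm (X a) \<le> 1 \<and> norm (Y a) \<le> 1) \<longrightarrow>
     norm (eval_poly P X ?x - eval_poly P Y ?x) \<le> K * (\<Sum>a=1..l. norm (X a - Y a))"
    using eval_poly_Lipschitz[OF wedge_HD(1)[OF P], of ?x] by blast
  \<comment> \<open>If each \<open>X a\<close> moves by at most \<delta>, the Lipschitz bound lets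
    \<open>P\<close> change by at most \<open>p0 / 2\<close>.\<close>
  define \<delta> where "\<delta> = p0 / (2 * (K + 1) * real l)"
  have \<delta>: "\<delta> > 0" unfolding \<delta>_def using p0 K(1) l by (intro divide_pos_pos mult_pos_pos) auto
  define B where "B = (\<Sum>a=2..l. \<bar>\<tau> a\<bar>) + \<delta> + T0"
  have T00: "T0 \<ge> 20" unfolding T0_def using Bd0 by simp
  have "0 \<le> (\<Sum>a=2..l. \<bar>\<tau> a\<bar>)" by (intro sum_nonneg) auto
  then have B0: "B \<ge> 20" unfolding B_def using \<delta> T00 by linarith
  have \<tau>B: "\<tau> a + \<delta> \<le> B" if "a \<in> {2..l}" for a
  proof -
    have "\<bar>\<tau> a\<bar> \<le> (\<Sum>a=2..l. \<bar>\<tau> a\<bar>)" by (rule member_le_sum) (use that in auto)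
    then show ?thesis unfolding B_def using T00 by linarith
  qed
  \<comment> \<open>The term \<open>2 * B\<close> ensures \<open>t 1 - t b \<ge> t 1 / 2\<close> for
    the confined variables, and \<open>- ln \<delta>\<close> makes the first argument of
    \<open>P\<close> at most \<delta> in norm.\<close>
  define T1 where "T1 = max (2 * B) (max T0 (- ln \<delta>))"
  have T1: "T1 \<ge> 2 * B" "T1 \<ge> T0" "exp (- T1) \<le> \<delta>" "T1 > 0"
  proof -
    show "T1 \<ge> 2 * B" "T1 \<ge> T0" "T1 > 0" unfolding T1_def using T00 by auto
    have "- T1 \<le> ln \<delta>" unfolding T1_def by simp
    then have "exp (- T1) \<le> exp (ln \<delta>)" by simp
    then show "exp (- T1) \<le> \<delta>" using \<delta> by simp
  qed
  \<comment> \<open>A product of one-variable functions as a minorant, so that its integral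
    factorises: the first factor has integral infinity, each other one \<delta>.\<close>
  define h where "h = (\<lambda>a::nat. \<lambda>t::real. if a = 1 then indicator {T1..} t * (1 / t) else indicator {\<tau> a..\<tau> a + \<delta>} t :: real)"
  have h0: "h a t \<ge> 0" for a t unfolding h_def using T1(4) by (auto simp: indicator_def)
  define w1 where "w1 = w0 / (B * sqrt B ^ n)"
  have w1: "w1 > 0" unfolding w1_def using w0 B0 by (intro divide_pos_pos mult_pos_pos) auto
  define c0 where "c0 = w0 * w1 ^ (l - 1) / 2 ^ (l - 1) * (p0 / 2)"
  have c0: "c0 > 0" unfolding c0_def using w0 w1 p0 by (intro mult_pos_pos divide_pos_pos) auto
  have lower: "c0 * (\<Prod>a=1..l. h a (t a)) \<le> norm (?f t)" for t
  proof (cases "\<forall>a\<in>{1..l}. h a (t a) \<noteq> 0")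
    case False
    then have z: "(\<Prod>a=1..l. h a (t a)) = 0" by (intro prod_zero) auto
    show ?thesis unfolding z by simp
  next
    case True
    have t1: "t 1 \<ge> T1" using True l unfolding h_def by (auto simp: indicator_def split: if_splits)
    have ta: "\<tau> a \<le> t a" "t a \<le> \<tau> a + \<delta>" if "a \<in> {2..l}" for a
    proof -
      have "h a (t a) \<noteq> 0" "a \<noteq> 1" using True that by auto
      then show "\<tau> a \<le> t a" "t a \<le> \<tau> a + \<delta>" unfolding h_def by (auto simp: indicator_def split: if_splits)
    qed
    have taB: "T0 \<le> t a" "t a \<le> B" if "a \<in> {2..l}" for a
      using ta[OF that] \<tau>B[OF that] \<tau>(1) that by force+
    have all: "t a \<ge> T0" if "a \<in> {1..l}" for a
      using t1 T1(2) taB(1)[of a] that by (cases "a = 1") auto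
    have eq1: "(\<Prod>a=1..l. vector_derivative C (at (t a))) = 1"
      using Creal(2)[OF all] by (intro prod.neutral) auto
    have s1: "{1..l} = insert 1 {2..l}" using l by auto
    have WW: "w0 / (t 1 * sqrt (t 1) ^ n) * w1 ^ (l - 1) \<le> norm (\<Prod>a=1..l. raw_weight n \<beta> (M ! (a - 1)) (C (t a)))"
    proof -
      have "w1 \<le> norm (raw_weight n \<beta> (M ! (a - 1)) (C (t a)))" if a: "a \<in> {2..l}" for a
      proof -
        have tp: "t a > 0" using taB(1)[OF a] T00 by linarith
        have "w1 \<le> w0 / (t a * sqrt (t a) ^ n)"
          unfolding w1_def using tp taB(2)[OF a] w0 B0
          by (intro divide_left_mono mult_mono power_mono mult_pos_pos) auto
        also have "\<dots> \<le> norm (raw_weight n \<beta> (M ! (a - 1)) (C (t a)))"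
          using W[OF Mm taB(1)[OF a]] Creal(1)[OF taB(1)[OF a]] a by auto
        finally show ?thesis .
      qed
      then have "(\<Prod>a\<in>{2..l}. w1) \<le> (\<Prod>a\<in>{2..l}. norm (raw_weight n \<beta> (M ! (a - 1)) (C (t a))))"
        using w1 by (intro prod_mono) auto
      then have "w1 ^ (l - 1) \<le> (\<Prod>a\<in>{2..l}. norm (raw_weight n \<beta> (M ! (a - 1)) (C (t a))))" by simp
      moreover have "w0 / (t 1 * sqrt (t 1) ^ n) \<le> norm (raw_weight n \<beta> (M ! (1 - 1)) (C (t 1)))"
        using W[OF Mm[of 1], of "t 1"] Creal(1)[of "t 1"] t1 T1(2) l by auto
      ultimately have "w0 / (t 1 * sqrt (t 1) ^ n) * w1 ^ (l - 1) \<le>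
          norm (raw_weight n \<beta> (M ! (1 - 1)) (C (t 1))) * (\<Prod>a\<in>{2..l}. norm (raw_weight n \<beta> (M ! (a - 1)) (C (t a))))"
        using w1 by (intro mult_mono) auto
      then show ?thesis unfolding prod_norm[symmetric] s1 by simp
    qed
    have VV: "(t 1 / 2) ^ (l - 1) \<le> norm (\<Prod>(a, b)\<in>pairs l. C (t a) - C (t b) + pi * \<i>)"
    proof -
      \<comment> \<open>Only pairs with the index 1 grow. For real arguments the remaining factors
        have imaginary part \<pi>, hence norm at least 1.\<close>
      have "(\<Prod>(a, b)\<in>pairs l. if a = 1 then t 1 / 2 else 1) \<le> (\<Prod>p\<in>pairs l. norm (case p of (a, b) \<Rightarrow> C (t a) - C (t b) + pi * \<i>))"
      proof (rule prod_mono, intro conjI)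
        fix p assume "p \<in> pairs l"
        then obtain a b where p: "p = (a, b)" "1 \<le> a" "a < b" "b \<le> l" unfolding pairs_def by blast
        have Cab: "C (t a) = of_real (t a)" "C (t b) = of_real (t b)" using Creal(1) all p by auto
        show "0 \<le> (case p of (a, b) \<Rightarrow> if a = 1 then t 1 / 2 else 1)" using p t1 T1(4) by auto
        show "(case p of (a, b) \<Rightarrow> if a = 1 then t 1 / 2 else 1) \<le> norm (case p of (a, b) \<Rightarrow> C (t a) - C (t b) + pi * \<i>)"
        proof (cases "a = 1")
          case True
          have "t b \<le> B" using taB(2)[of b] p True by auto
          then have "t 1 / 2 \<le> t a - t b" using t1 T1(1) True by simp
          also have "\<dots> \<le> \<bar>Re (C (t a) - C (t b) + pi * \<i>)\<bar>" unfolding Cab by simp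
          also have "\<dots> \<le> norm (C (t a) - C (t b) + pi * \<i>)" by (rule abs_Re_le_cmod)
          finally show ?thesis using p True by simp
        next
          case False
          have "1 \<le> \<bar>Im (C (t a) - C (t b) + pi * \<i>)\<bar>" using pi_gt3 by (simp add: Cab)
          also have "\<dots> \<le> norm (C (t a) - C (t b) + pi * \<i>)" by (rule abs_Im_le_cmod)
          finally show ?thesis using p False by simp
        qed
      qed
      then show ?thesis unfolding prod_pairs_first by (simp add: prod_norm case_prod_beta)
    qed
    have PP: "p0 / 2 \<le> norm (eval_poly P (\<lambda>a. exp (- C (t a))) ?x)"
    proof -
      let ?X = "\<lambda>a. exp (- C (t a))"
      have Xa: "?X a = of_real (exp (- t a))" if "a \<in> {1..l}" for a
        using Creal(1)[OF all[OF that]] by (simp flip: exp_of_real)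
      have Ya: "?Y a = of_real (exp (- \<tau> a))" if "a \<in> {2..l}" for a using that by (auto simp flip: exp_of_real)
      have d: "norm (?X a - ?Y a) \<le> \<delta>" if a: "a \<in> {1..l}" for a
      proof (cases "a = 1")
        case True
        have "exp (- t 1) \<le> exp (- T1)" using t1 by simp
        then have "exp (- t 1) \<le> \<delta>" using T1(3) by (rule order_trans)
        then show ?thesis using Xa[OF a] True by simp
      next
        case False
        then have a2: "a \<in> {2..l}" using a by auto
        have "norm (?X a - ?Y a) = \<bar>exp (- t a) - exp (- \<tau> a)\<bar>"
          unfolding Xa[OF a] Ya[OF a2] of_real_diff[symmetric] norm_of_real ..
        also have "\<dots> \<le> t a - \<tau> a"
        proof (rule exp_minus_Lipschitz)
          have "\<tau> a > T0" using \<tau>(1) a2 by blast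
          then show "0 \<le> \<tau> a" using T00 by linarith
        qed (rule ta(1)[OF a2])
        finally show ?thesis using ta(2)[OF a2] by linarith
      qed
      have "norm (?X a) \<le> 1 \<and> norm (?Y a) \<le> 1" if a: "a \<in> {1..l}" for a
      proof
        show "norm (?X a) \<le> 1" using Xa[OF a] all[OF a] T00 by simp
        show "norm (?Y a) \<le> 1"
        proof (cases "a = 1")
          case False
          then have a2: "a \<in> {2..l}" using a by auto
          have "\<tau> a > T0" using \<tau>(1) a2 by blast
          then have "\<tau> a > 0" using T00 by linarith
          then show ?thesis using Ya[OF a2] by simp
        qed simp
      qed
      then have "\<forall>a\<in>{1..l}. norm (?X a) \<le> 1 \<and> norm (?Y a) \<le> 1" by blast
      then have "norm (eval_poly P ?X ?x - eval_poly P ?Y ?x) \<le> K * (\<Sum>a=1..l. norm (?X a - ?Y a))"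
        by (rule K(2)[THEN spec[of _ ?X], THEN spec[of _ ?Y], THEN mp])
      also have "\<dots> \<le> K * (\<Sum>a=1..l. \<delta>)" using K(1) d by (intro mult_left_mono sum_mono) auto
      also have "\<dots> \<le> p0 / 2"
      proof -
        have "real l * \<delta> = p0 / (2 * (K + 1))" unfolding \<delta>_def using l by simp
        then have "K * (real l * \<delta>) = K / (K + 1) * (p0 / 2)" by simp
        also have "\<dots> \<le> 1 * (p0 / 2)" using K(1) p0 by (intro mult_right_mono) auto
        finally show ?thesis by simp
      qed
      finally have "norm (eval_poly P ?X ?x - eval_poly P ?Y ?x) \<le> p0 / 2" .
      moreover have "p0 \<le> norm (eval_poly P ?X ?x) + norm (eval_poly P ?X ?x - eval_poly P ?Y ?x)"
        unfolding p0_def using norm_triangle_ineq4[of "eval_poly P ?X ?x" "eval_poly P ?X ?x - eval_poly P ?Y ?x"] by simp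
      ultimately show ?thesis by linarith
    qed
    have t1p: "t 1 \<ge> 1" using t1 T1(1) B0 by linarith
    have "(\<Prod>a\<in>{2..l}. h a (t a)) = 1"
      by (rule prod.neutral) (use ta in \<open>auto simp: h_def\<close>)
    then have hh: "(\<Prod>a=1..l. h a (t a)) = 1 / t 1" unfolding s1 using t1 by (simp add: h_def)
    \<comment> \<open>Here \<open>n \<le> 2 * (l - 1)\<close> enters: the growth of the pair factors
      makes up for the \<open>n\<close> square roots and leaves \<open>1 / t 1\<close>.\<close>
    have sq: "sqrt (t 1) ^ n \<le> t 1 ^ (l - 1)"
    proof -
      have "sqrt (t 1) ^ n \<le> sqrt (t 1) ^ (2 * (l - 1))" using t1p l(2) by (intro power_increasing) auto
      also have "\<dots> = t 1 ^ (l - 1)" using t1p by (simp add: power_mult)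
      finally show ?thesis .
    qed
    have sq0: "sqrt (t 1) ^ n > 0" using t1p by simp
    have "c0 * (\<Prod>a=1..l. h a (t a)) = w0 / (t 1 * sqrt (t 1) ^ n) * w1 ^ (l - 1) * (sqrt (t 1) ^ n / 2 ^ (l - 1)) * (p0 / 2)"
      unfolding hh c0_def using sq0 t1p by (simp add: field_simps)
    also have "\<dots> \<le> w0 / (t 1 * sqrt (t 1) ^ n) * w1 ^ (l - 1) * (t 1 / 2) ^ (l - 1) * (p0 / 2)"
      unfolding power_divide using sq w0 w1 p0 t1p
      by (intro mult_right_mono mult_left_mono divide_right_mono) auto
    also have "\<dots> \<le> norm (\<Prod>a=1..l. raw_weight n \<beta> (M ! (a - 1)) (C (t a))) *
        norm (\<Prod>(a, b)\<in>pairs l. C (t a) - C (t b) + pi * \<i>) * norm (eval_poly P (\<lambda>a. exp (- C (t a))) ?x)"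
      using WW VV PP w0 w1 p0 t1p by (intro mult_mono mult_nonneg_nonneg) auto
    also have "\<dots> = norm (?f t)" unfolding eq1 norm_mult by (simp add: mult.assoc)
    finally show ?thesis .
  qed
  have "\<not> integrable (PiM {1..l} (\<lambda>_. lborel)) ?f"
  proof
    assume "integrable (PiM {1..l} (\<lambda>_. lborel)) ?f"
    then have fin: "(\<integral>\<^sup>+t. ennreal (norm (?f t)) \<partial>PiM {1..l} (\<lambda>_. lborel)) < \<infinity>"
      unfolding integrable_iff_bounded by blast
    have hm: "(\<lambda>t. ennreal (h a t)) \<in> borel_measurable lborel" for a unfolding h_def by (cases "a = 1") simp_all
    have h1: "(\<integral>\<^sup>+t. ennreal (h 1 t) \<partial>lborel) = top"
      using nn_integral_inverse_atLeast[OF T1(4)] by (simp add: h_def)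
    have h2: "(\<integral>\<^sup>+t. ennreal (h a t) \<partial>lborel) \<noteq> 0" if "a \<in> {2..l}" for a
    proof -
      have "(\<integral>\<^sup>+t. ennreal (h a t) \<partial>lborel) = ennreal \<delta>"
        using that \<delta> by (simp add: h_def ennreal_indicator)
      then show ?thesis using \<delta> by simp
    qed
    have s1: "{1..l} = insert 1 {2..l}" using l by auto
    have "(\<integral>\<^sup>+t. (\<Prod>a\<in>{1..l}. ennreal (h a (t a))) \<partial>PiM {1..l} (\<lambda>_. lborel)) = (\<Prod>a\<in>{1..l}. \<integral>\<^sup>+t. ennreal (h a t) \<partial>lborel)"
      by (rule product_nn_integral_prod) (use hm in auto)
    also have "\<dots> = top"
      unfolding s1 using h1 h2 by (simp add: ennreal_top_mult)
    finally have inf: "(\<integral>\<^sup>+t. (\<Prod>a\<in>{1..l}. ennreal (h a (t a))) \<partial>PiM {1..l} (\<lambda>_. lborel)) = top" .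
    have meas: "(\<lambda>t. ennreal (h a (t a))) \<in> borel_measurable (PiM {1..l} (\<lambda>_. lborel))" if a: "a \<in> {1..l}" for a
    proof -
      have "(\<lambda>t. t a) \<in> measurable (PiM {1..l} (\<lambda>_. lborel)) (lborel :: real measure)"
        using measurable_component_singleton[OF a, of "\<lambda>_. lborel"] by simp
      then show ?thesis by (rule measurable_compose) (rule hm)
    qed
    have "(\<lambda>t. \<Prod>a\<in>{1..l}. ennreal (h a (t a))) \<in> borel_measurable (PiM {1..l} (\<lambda>_. lborel))"
      by (intro borel_measurable_prod_ennreal meas)
    from nn_integral_cmult[OF this, of "ennreal c0"]
    have "(\<integral>\<^sup>+t. ennreal c0 * (\<Prod>a\<in>{1..l}. ennreal (h a (t a))) \<partial>PiM {1..l} (\<lambda>_. lborel)) = ennreal c0 * top"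
      unfolding inf .
    also have "\<dots> = top" using c0 by (simp add: ennreal_mult_top)
    finally have "top = (\<integral>\<^sup>+t. ennreal c0 * (\<Prod>a\<in>{1..l}. ennreal (h a (t a))) \<partial>PiM {1..l} (\<lambda>_. lborel))" by simp
    also have "\<dots> \<le> (\<integral>\<^sup>+t. ennreal (norm (?f t)) \<partial>PiM {1..l} (\<lambda>_. lborel))"
    proof (rule nn_integral_mono)
      fix t
      have "ennreal c0 * (\<Prod>a\<in>{1..l}. ennreal (h a (t a))) = ennreal (c0 * (\<Prod>a=1..l. h a (t a)))"
        using h0 c0 by (simp add: prod_ennreal ennreal_mult' prod_nonneg)
      also have "\<dots> \<le> ennreal (norm (?f t))" using lower by (rule ennreal_leI)
      finally show "ennreal c0 * (\<Prod>a\<in>{1..l}. ennreal (h a (t a))) \<le> ennreal (norm (?f t))" .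
    qed
    finally show False using fin by simp
  qed
  then show ?thesis unfolding I by (rule not_integrable_integral_eq)
qed

section \<open>Cancellation of the poles\<close>

text \<open>Only a punctured neighbourhood counts. In the application the two families of points
  meet at \<open>z\<close> itself, so that no contour exists there and the value of the integral
  carries no meaning.\<close>

definition removable :: "complex \<Rightarrow> (complex \<Rightarrow> complex) \<Rightarrow> bool" where
  "removable z F \<longleftrightarrow> (\<exists>h. h analytic_on {z} \<and> (\<forall>\<^sub>F b in at z. F b = h b))"

lemma removable_analytic: "F analytic_on {z} \<Longrightarrow> removable z F"
  unfolding removable_def by (intro exI[of _ F]) auto

lemma removable_cong:
  assumes "removable z G" "\<forall>\<^sub>F b in at z. F b = G b"
  shows "removable z F"
proof -
  obtain h where h: "h analytic_on {z}" "\<forall>\<^sub>F b in at z. G b = h b" using assms(1) unfolding removable_def by blast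
  from assms(2) h(2) have "\<forall>\<^sub>F b in at z. F b = h b" by eventually_elim simp
  then show ?thesis using h(1) unfolding removable_def by blast
qed

lemma removable_mult:
  assumes "removable z F" "removable z G"
  shows "removable z (\<lambda>b. F b * G b)"
proof -
  obtain f h where f: "f analytic_on {z}" "\<forall>\<^sub>F b in at z. F b = f b"
    and h: "h analytic_on {z}" "\<forall>\<^sub>F b in at z. G b = h b" using assms unfolding removable_def by blast
  from f(2) h(2) have "\<forall>\<^sub>F b in at z. F b * G b = f b * h b" by eventually_elim simp
  then show ?thesis using f(1) h(1) unfolding removable_def by (intro exI[of _ "\<lambda>b. f b * h b"]) (auto intro: analytic_intros)
qed

lemma removable_sum:
  assumes "\<And>i. i \<in> I \<Longrightarrow> removable z (F i)"
  shows "removable z (\<lambda>b. \<Sum>i\<in>I. F i b)"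
  using assms
proof (induction I rule: infinite_finite_induct)
  case (insert i I)
  have rem: "removable z (F i)" "removable z (\<lambda>b. \<Sum>i\<in>I. F i b)"
    using insert by simp_all
  obtain f h where f: "f analytic_on {z}" "\<forall>\<^sub>F b in at z. F i b = f b"
    and h: "h analytic_on {z}" "\<forall>\<^sub>F b in at z. (\<Sum>i\<in>I. F i b) = h b"
    using rem unfolding removable_def by blast
  from f(2) h(2) have "\<forall>\<^sub>F b in at z. (\<Sum>i\<in>insert i I. F i b) = f b + h b"
    by eventually_elim (use insert.hyps in simp)
  then show ?case using f(1) h(1) unfolding removable_def by (intro exI[of _ "\<lambda>b. f b + h b"]) (auto intro: analytic_intros)
qed (auto intro!: removable_analytic analytic_intros)

lemma removable_divide:
  assumes "F analytic_on {z}" "F z = 0"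
  shows "removable z (\<lambda>b. F b / (b - z))"
proof -
  obtain S where S: "open S" "z \<in> S" "F holomorphic_on S" using assms(1) unfolding analytic_at by blast
  let ?h = "\<lambda>b. if b = z then deriv F z else (F b - F z) / (b - z)"
  have "?h holomorphic_on S"
    using S by (intro pole_lemma) (simp_all add: interior_open)
  then have "?h analytic_on {z}" unfolding analytic_at using S by blast
  moreover have "\<forall>\<^sub>F b in at z. F b / (b - z) = ?h b"
    using eventually_neq_at_within[of z z UNIV] by eventually_elim (simp add: assms(2))
  ultimately show ?thesis unfolding removable_def by blast
qed

lemma residue_removable:
  assumes "removable z F"
  shows "residue F z = 0"
proof -
  obtain h where h: "h analytic_on {z}" "\<forall>\<^sub>F b in at z. F b = h b" using assms unfolding removable_def by blast
  obtain S where S: "open S" "z \<in> S" "h holomorphic_on S" using h(1) unfolding analytic_at by blast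
  have "residue F z = residue h z" by (rule residue_cong[OF h(2) refl])
  also have "\<dots> = 0" by (rule residue_holo[OF S])
  finally show ?thesis .
qed

text \<open>Otherwise the zeros would accumulate at \<open>z\<close>, and the identity theorem would
  apply.\<close>

lemma eventually_nonzero_entire:
  fixes F :: "complex \<Rightarrow> complex"
  assumes "F holomorphic_on UNIV" "F w \<noteq> 0"
  shows "\<forall>\<^sub>F b in at z. F b \<noteq> 0"
proof (rule ccontr)
  assume "\<not> (\<forall>\<^sub>F b in at z. F b \<noteq> 0)"
  then have "z islimpt {b. F b = 0}"
    unfolding islimpt_conv_frequently_at frequently_def by simp
  then have "F w = 0"
    by (rule analytic_continuation[OF assms(1) open_UNIV connected_UNIV _ _ _ _ UNIV_I, rotated 2]) auto
  then show False using assms(2) by simp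
qed

section \<open>The polynomial at the pinching points\<close>

context regular_pinching
begin

definition args :: "complex \<Rightarrow> nat \<Rightarrow> complex" where
  "args b = (\<lambda>j. exp ((\<beta>(n := b)) j))"

lemma args_holomorphic: "(\<lambda>b. args b j) holomorphic_on S"
  unfolding args_def by (cases "j = n") (auto intro!: holomorphic_intros)

text \<open>Since \<open>exp (pi * \<i>) = - 1\<close>, the last two arguments at
  \<open>b = base\<close> already have the shape \<open>x, - x\<close> that \<open>rho\<close>
  substitutes.\<close>

lemma args_base: "(args base)(n := - args base (n - 1)) = args base" "args base (n - 1) \<noteq> 0"
  "args base (n - 1) = exp (\<beta> (n - 1))"
proof -
  have nn: "n - 1 \<noteq> n" using n2 by linarith
  have "exp base = - exp (\<beta> (n - 1))" by (simp add: base_def exp_add)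
  then show "(args base)(n := - args base (n - 1)) = args base"
    using nn by (auto simp: args_def fun_eq_iff)
  show "args base (n - 1) \<noteq> 0" "args base (n - 1) = exp (\<beta> (n - 1))" using nn by (simp_all add: args_def)
qed

text \<open>The class records which of its two possible values \<open>X\<close> takes at a pinching
  point. Being a truth value, it limits a selection with distinct classes to two variables.\<close>

definition exp_class :: "nat \<Rightarrow> bool" where "exp_class s \<longleftrightarrow> s = 2"

lemma exp_pinch_point:
  assumes "s \<in> {1,2,3}"
  shows "exp (- pinch_point s b) = (if exp_class s then exp (- \<beta> (n - 1)) else exp (- b))"
proof -
  have "- (b - 2 * pi * \<i>) = - b + 2 * pi * \<i>" by simp
  then have "exp (- (b - 2 * pi * \<i>)) = exp (- b) * exp (2 * pi * \<i>)" by (simp only: exp_add)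
  also have "exp (2 * pi * \<i>) = 1" using exp_two_pi_i by (simp add: mult_ac)
  finally have e: "exp (- (b - 2 * pi * \<i>)) = exp (- b)" by simp
  consider "s = 1" | "s = 2" | "s = 3" using assms by auto
  then show ?thesis
  proof cases
    case 3
    then have "pinch_point s b = b - 2 * pi * \<i>" by (simp add: pinch_point_def)
    then show ?thesis unfolding exp_class_def using 3 e by (simp only:) simp
  qed (simp_all add: pinch_point_def exp_class_def)
qed

lemma pinch_point_exp:
  assumes "s \<in> {1,2,3}"
  shows "exp (- pinch_point s base) = (if s = 2 then 1 else - 1) * inverse (args base (n - 1))"
proof -
  have "exp (- base) = - inverse (exp (\<beta> (n - 1)))"
    unfolding exp_minus base_def by (simp add: exp_add)
  moreover have "exp (- \<beta> (n - 1)) = inverse (exp (\<beta> (n - 1)))" by (rule exp_minus)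
  ultimately show ?thesis unfolding exp_pinch_point[OF assms] args_base(3) exp_class_def by (simp only:) simp
qed

text \<open>At the limit \<open>X\<close> equals 1/x or -1/x, where the hypotheses speak about the
  last slot; antisymmetry provides for the others.\<close>

lemma vanishes_at_pinch:
  assumes P: "P \<in> wedge_H n l" and rho: "rho_vanishes n l 1 P" "rho_vanishes n l (- 1) P"
    and a: "a \<in> {1..l}" "s \<in> {1,2,3}" "\<alpha> a = pinch_point s base"
  shows "eval_poly P (\<lambda>a. exp (- \<alpha> a)) (args base) = 0"
proof (rule eval_poly_zero_any_arg[OF P a(1), of l])
  let ?c = "(if s = 2 then 1 else - 1) * inverse (args base (n - 1))"
  show "l \<in> {1..l}" using a(1) by simp
  show "exp (- \<alpha> a) = ?c" unfolding a(3) by (rule pinch_point_exp[OF a(2)])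
  fix X :: "nat \<Rightarrow> complex" assume X: "X l = ?c"
  have "rho n l (if s = 2 then 1 else - 1) P X (args base) = 0"
    using rho args_base(2) unfolding rho_vanishes_def by (cases "s = 2") auto
  moreover have "X(l := ?c) = X" using X by (auto simp: fun_eq_iff)
  ultimately show "eval_poly P X (args base) = 0" unfolding rho_def args_base(1) by simp
qed

lemma vanishes_same_class:
  assumes P: "P \<in> wedge_H n l" and a: "a \<in> {1..l}" "a' \<in> {1..l}" "a \<noteq> a'"
    and s: "s \<in> {1,2,3}" "s' \<in> {1,2,3}" "exp_class s = exp_class s'"
    and \<alpha>: "\<alpha> a = pinch_point s b" "\<alpha> a' = pinch_point s' b"
  shows "eval_poly P (\<lambda>a. exp (- \<alpha> a)) x = 0"
proof (rule eval_poly_eq_args[OF P a])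
  show "exp (- \<alpha> a) = exp (- \<alpha> a')"
    unfolding \<alpha> exp_pinch_point[OF s(1)] exp_pinch_point[OF s(2)] s(3) ..
qed

text \<open>The set \<open>E\<close> is a parameter so that a pair can be removed when its factor is
  split off. The coefficients carry all dependence on \<open>b\<close>, and admissible exponents
  guarantee integrability of every monomial.\<close>

definition tensor_rep where
  "tensor_rep P l E R d k i \<longleftrightarrow> finite R \<and> (\<forall>r\<in>R. d r analytic_on {base}) \<and>
     (\<forall>r\<in>R. \<forall>a\<in>{1..l}. admissible n (l - 1) (k r a) (i r a)) \<and>
     (\<forall>b \<alpha>. (\<Prod>(a, a')\<in>E. \<alpha> a - \<alpha> a' + pi * \<i>) * eval_poly P (\<lambda>a. exp (- \<alpha> a)) (args b) =
        (\<Sum>r\<in>R. d r b * (\<Prod>a=1..l. monom_exp (k r a) (i r a) (\<alpha> a))))"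

lemma tensor_repD:
  assumes "tensor_rep P l E R d k i"
  shows "(\<Prod>(a, a')\<in>E. \<alpha> a - \<alpha> a' + pi * \<i>) * eval_poly P (\<lambda>a. exp (- \<alpha> a)) (args b) =
     (\<Sum>r\<in>R. d r b * (\<Prod>a=1..l. monom_exp (k r a) (i r a) (\<alpha> a)))"
  by (rule assms[unfolded tensor_rep_def, THEN conjunct2, THEN conjunct2, THEN conjunct2, THEN spec[of _ b], THEN spec[of _ \<alpha>]])

lemma tensor_rep_exists:
  assumes P: "P \<in> wedge_H n l" and l: "l \<ge> 1"
    and fast: "2 * l \<le> n + 1 \<or> (\<forall>X b. eval_poly P (X(1 := 0)) (args b) = 0)"
    and E: "E \<subseteq> pairs l"
  shows "\<exists>(R :: (nat \<times> ((nat + nat) \<Rightarrow>\<^sub>0 nat)) set) d k i. tensor_rep P l E R d k i"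
proof -
  note keys = wedge_HD(1)[OF P]
  \<comment> \<open>If \<open>2 * l \<le> n + 1\<close>, every degree \<open>k \<le> l - 1\<close>
    satisfies \<open>2 * k + 1 \<le> n\<close>. Otherwise \<open>P\<close> vanishes at
    \<open>X 1 = 0\<close>, the monomials lacking some variable add up to 0, and those kept have all
    exponents at least 1.\<close>
  define Ms where "Ms = (if 2 * l \<le> n + 1 then Poly_Mapping.keys P
     else {m \<in> Poly_Mapping.keys P. \<forall>a\<in>{1..l}. X_exp m a \<ge> 1})"
  have finMs: "finite Ms" unfolding Ms_def by simp
  let ?w = "\<lambda>m b. Poly_Mapping.lookup P m * x_part n m (args b)"
  have repP: "eval_poly P X (args b) = (\<Sum>m\<in>Ms. ?w m b * (\<Prod>a=1..l. X a ^ X_exp m a))" for X b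
  proof (cases "2 * l \<le> n + 1")
    case True
    then show ?thesis unfolding Ms_def eval_poly_expand[OF keys] by simp
  next
    case False
    then have z: "eval_poly P (X(1 := 0)) (args b) = 0" for X b using fast by blast
    have "(\<Sum>m\<in>Poly_Mapping.keys P. ?w m b * (\<Prod>a=1..l. X a ^ X_exp m a)) =
        (\<Sum>m | m \<in> Poly_Mapping.keys P \<and> (\<forall>a\<in>{1..l}. X_exp m a \<ge> 1). ?w m b * (\<Prod>a=1..l. X a ^ X_exp m a))"
    proof (rule drop_constant_monomials)
      fix X :: "nat \<Rightarrow> complex" and a assume a: "a \<in> {1..l}" "X a = 0"
      have "eval_poly P X (args b) = 0"
      proof (rule eval_poly_zero_any_arg[OF P a(1), of 1 0])
        show "1 \<in> {1..l}" using l by simp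
        show "X a = 0" by (rule a(2))
      next
        fix Y :: "nat \<Rightarrow> complex" assume "Y 1 = 0"
        then have "Y(1 := 0) = Y" by (auto simp: fun_eq_iff)
        then show "eval_poly P Y (args b) = 0" using z[of Y b] by simp
      qed
      then show "(\<Sum>m\<in>Poly_Mapping.keys P. ?w m b * (\<Prod>a=1..l. X a ^ X_exp m a)) = 0"
        unfolding eval_poly_expand[OF keys] .
    qed simp_all
    then show ?thesis unfolding Ms_def eval_poly_expand[OF keys] using False by simp
  qed
  have finE: "finite E" using E finite_pairs by (rule finite_subset)
  obtain L where L: "\<forall>\<alpha>. (\<Prod>(a, b)\<in>E. \<alpha> a - \<alpha> b + pi * \<i>) = (\<Sum>(u, k)\<leftarrow>L. u * (\<Prod>a\<in>{1..l}. \<alpha> a ^ k a))"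
     "\<forall>(u, k)\<in>set L. \<forall>a. k a \<le> card {p \<in> E. fst p = a \<or> snd p = a}"
    using prod_linear_expansion[OF finE finite_atLeastAtMost[of 1 l], of "pi * \<i>"] E
    by (fastforce simp: pairs_def)
  define R where "R = {..<length L} \<times> Ms"
  define d where "d = (\<lambda>(r, m) b. fst (L ! r) * ?w m b)"
  define k where "k = (\<lambda>(r, m :: (nat + nat) \<Rightarrow>\<^sub>0 nat). snd (L ! r))"
  define i where "i = (\<lambda>(r :: nat, m). X_exp m)"
  have k_le: "snd (L ! r) a \<le> l - 1" if "r < length L" "a \<in> {1..l}" for r a
  proof -
    have "L ! r \<in> set L" using that(1) by simp
    then have "snd (L ! r) a \<le> card {p \<in> E. fst p = a \<or> snd p = a}" using L(2) by (auto simp: case_prod_beta)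
    also have "\<dots> \<le> card {p \<in> pairs l. fst p = a \<or> snd p = a}"
      using E finite_pairs[of l] by (intro card_mono) auto
    also have "\<dots> \<le> l - 1" by (rule card_pairs_at[OF that(2)])
    finally show ?thesis .
  qed
  have "tensor_rep P l E R d k i"
    unfolding tensor_rep_def
  proof (intro conjI ballI allI)
    show "finite R" unfolding R_def using finMs by simp
  next
    fix r assume "r \<in> R"
    have "(\<lambda>b. fst (L ! q) * ?w m b) analytic_on {base}" for q m
    proof -
      have "(\<lambda>b. fst (L ! q) * ?w m b) holomorphic_on UNIV"
        unfolding x_part_def by (intro holomorphic_intros args_holomorphic)
      then show ?thesis using analytic_on_open[of UNIV] analytic_on_subset by blast
    qed
    then show "d r analytic_on {base}" unfolding d_def by (cases r) simp
  next
    fix r a assume r: "r \<in> R" and a: "a \<in> {1..l}"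
    obtain q m where qm: "r = (q, m)" "q < length L" "m \<in> Ms" using r unfolding R_def by blast
    have "m \<in> Poly_Mapping.keys P" using qm(3) unfolding Ms_def by (auto split: if_splits)
    then have "X_exp m a < n" using wedge_HD(2)[OF P _ a] by blast
    moreover have "2 * snd (L ! q) a + 1 \<le> n \<or> 1 \<le> X_exp m a"
    proof (cases "2 * l \<le> n + 1")
      case True
      then show ?thesis using k_le[OF qm(2) a] l by linarith
    next
      case False
      then show ?thesis using qm(3) a unfolding Ms_def by auto
    qed
    ultimately show "admissible n (l - 1) (k r a) (i r a)"
      using k_le[OF qm(2) a] unfolding admissible_def k_def i_def qm(1) by simp
  next
    fix b \<alpha>
    have V: "(\<Prod>(a, b)\<in>E. \<alpha> a - \<alpha> b + pi * \<i>) = (\<Sum>r<length L. fst (L ! r) * (\<Prod>a\<in>{1..l}. \<alpha> a ^ snd (L ! r) a))"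
      using L(1) by (simp add: sum_list_sum_nth case_prod_beta atLeast0LessThan)
    have "(\<Sum>r\<in>R. d r b * (\<Prod>a=1..l. monom_exp (k r a) (i r a) (\<alpha> a))) =
       (\<Sum>q<length L. \<Sum>m\<in>Ms. fst (L ! q) * ?w m b * (\<Prod>a=1..l. \<alpha> a ^ snd (L ! q) a * exp (- \<alpha> a) ^ X_exp m a))"
      unfolding R_def sum.cartesian_product d_def k_def i_def monom_exp_def by (simp add: case_prod_beta)
    also have "\<dots> = (\<Sum>q<length L. fst (L ! q) * (\<Prod>a\<in>{1..l}. \<alpha> a ^ snd (L ! q) a)) *
       (\<Sum>m\<in>Ms. ?w m b * (\<Prod>a=1..l. exp (- \<alpha> a) ^ X_exp m a))"
      unfolding sum_product prod.distrib by (simp add: mult_ac)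
    finally show "(\<Prod>(a, a')\<in>E. \<alpha> a - \<alpha> a' + pi * \<i>) * eval_poly P (\<lambda>a. exp (- \<alpha> a)) (args b) =
        (\<Sum>r\<in>R. d r b * (\<Prod>a=1..l. monom_exp (k r a) (i r a) (\<alpha> a)))"
      unfolding V repP by simp
  qed
  then show ?thesis by blast
qed

text \<open>The term of the expansion of the multiple integral in which the variables with \<open>f a \<noteq> 0\<close> are
  evaluated at a pinching point; \<open>A\<close> stands for the regular part of the one-variable integrals.\<close>

definition partial_eval where
  "partial_eval A M l f R d k i b = (\<Sum>r\<in>R. d r b * (\<Prod>a=1..l.
     if f a \<noteq> 0 then monom_exp (k r a) (i r a) (pinch_point (f a) b) else A (M ! (a - 1)) (k r a) (i r a) b))"

lemma partial_eval_analytic: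
  assumes rep: "tensor_rep P l E R d k i" and M: "\<And>a. a \<in> {1..l} \<Longrightarrow> M ! (a - 1) \<in> {1..n}"
    and A: "\<forall>m\<in>{1..n}. \<forall>k i. admissible n (l - 1) k i \<longrightarrow> A m k i analytic_on {base}"
  shows "partial_eval A M l f R d k i analytic_on {base}"
proof -
  have pa: "pinch_point s analytic_on {base}" for s
    unfolding pinch_point_def by (cases "s = 1"; cases "s = 2") (auto intro!: analytic_intros)
  have "(\<lambda>b. if f a \<noteq> 0 then monom_exp (k r a) (i r a) (pinch_point (f a) b) else A (M ! (a - 1)) (k r a) (i r a) b) analytic_on {base}"
    if "r \<in> R" "a \<in> {1..l}" for r a
  proof (cases "f a = 0")
    case True
    then show ?thesis using A M[OF that(2)] rep that unfolding tensor_rep_def by simp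
  next
    case False
    then show ?thesis using monom_exp_analytic[OF pa] by simp
  qed
  then show ?thesis
    unfolding partial_eval_def using rep
    by (intro analytic_on_sum analytic_on_mult analytic_on_prod) (auto simp: tensor_rep_def)
qed

lemma partial_eval_zero:
  assumes rep: "tensor_rep P l E R d k i"
    and zero: "\<And>\<alpha>. (\<And>a. a \<in> {1..l} \<Longrightarrow> f a \<noteq> 0 \<Longrightarrow> \<alpha> a = pinch_point (f a) b) \<Longrightarrow>
       eval_poly P (\<lambda>a. exp (- \<alpha> a)) (args b) = 0"
  shows "partial_eval A M l f R d k i b = 0"
  unfolding partial_eval_def
proof (rule tensor_relation)
  show "finite R" using rep unfolding tensor_rep_def by blast
  fix \<alpha> :: "nat \<Rightarrow> complex"
  assume "\<And>a. a \<in> {1..l} \<Longrightarrow> f a \<noteq> 0 \<Longrightarrow> \<alpha> a = pinch_point (f a) b"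
  then have "eval_poly P (\<lambda>a. exp (- \<alpha> a)) (args b) = 0" by (rule zero)
  then show "(\<Sum>r\<in>R. d r b * (\<Prod>a=1..l. monom_exp (k r a) (i r a) (\<alpha> a))) = 0"
    using tensor_repD[OF rep, of \<alpha> b] by simp
qed simp

text \<open>At the selected points the factor of the removed pair is constant. The difference of
  both sides is a single tensor sum over the disjoint union of the index sets, and the function it
  represents vanishes there.\<close>

lemma partial_eval_factor:
  assumes rep: "tensor_rep P l (insert (a1, a2) E) R d k i" and rep': "tensor_rep P l E R' d' k' i'"
    and E: "(a1, a2) \<notin> E" "finite E" and a: "a1 \<in> {1..l}" "a2 \<in> {1..l}" "f a1 \<noteq> 0" "f a2 \<noteq> 0"
  shows "partial_eval A M l f R d k i b =
     (pinch_point (f a1) b - pinch_point (f a2) b + pi * \<i>) * partial_eval A M l f R' d' k' i' b"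
proof -
  let ?q = "pinch_point (f a1) b - pinch_point (f a2) b + pi * \<i>"
  have fin: "finite R" "finite R'" using rep rep' unfolding tensor_rep_def by blast+
  let ?d = "case_sum (\<lambda>r. d r b) (\<lambda>r. - (?q * d' r b))" and ?k = "case_sum k k'" and ?i = "case_sum i i'"
  have plus: "(\<Sum>r\<in>R <+> R'. ?d r * (\<Prod>a=1..l. G a (?k r a) (?i r a))) =
     (\<Sum>r\<in>R. d r b * (\<Prod>a=1..l. G a (k r a) (i r a))) - ?q * (\<Sum>r\<in>R'. d' r b * (\<Prod>a=1..l. G a (k' r a) (i' r a)))"
    for G :: "nat \<Rightarrow> nat \<Rightarrow> nat \<Rightarrow> complex"
    unfolding sum.Plus[OF fin] by (simp add: o_def sum_negf sum_distrib_left mult.assoc)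
  have "(\<Sum>r\<in>R <+> R'. ?d r * (\<Prod>a=1..l. if f a \<noteq> 0 then monom_exp (?k r a) (?i r a) (pinch_point (f a) b)
      else A (M ! (a - 1)) (?k r a) (?i r a) b)) = 0"
  proof (rule tensor_relation)
    show "finite (R <+> R')" using fin by simp
    fix \<alpha> :: "nat \<Rightarrow> complex"
    assume "\<And>a. a \<in> {1..l} \<Longrightarrow> f a \<noteq> 0 \<Longrightarrow> \<alpha> a = pinch_point (f a) b"
    then have q: "\<alpha> a1 - \<alpha> a2 + pi * \<i> = ?q" using a by simp
    have "(\<Sum>r\<in>R. d r b * (\<Prod>a=1..l. monom_exp (k r a) (i r a) (\<alpha> a))) =
       (\<Prod>(a, a')\<in>insert (a1, a2) E. \<alpha> a - \<alpha> a' + pi * \<i>) * eval_poly P (\<lambda>a. exp (- \<alpha> a)) (args b)"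
      by (rule tensor_repD[OF rep, symmetric])
    also have "\<dots> = ?q * ((\<Prod>(a, a')\<in>E. \<alpha> a - \<alpha> a' + pi * \<i>) * eval_poly P (\<lambda>a. exp (- \<alpha> a)) (args b))"
      using E by (simp add: q mult.assoc)
    also have "(\<Prod>(a, a')\<in>E. \<alpha> a - \<alpha> a' + pi * \<i>) * eval_poly P (\<lambda>a. exp (- \<alpha> a)) (args b) =
       (\<Sum>r\<in>R'. d' r b * (\<Prod>a=1..l. monom_exp (k' r a) (i' r a) (\<alpha> a)))"
      by (rule tensor_repD[OF rep'])
    finally show "(\<Sum>r\<in>R <+> R'. ?d r * (\<Prod>a=1..l. monom_exp (?k r a) (?i r a) (\<alpha> a))) = 0"
      using plus[of "\<lambda>a k i. monom_exp k i (\<alpha> a)"] by simp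
  qed simp
  then show ?thesis
    using plus[of "\<lambda>a k i. if f a \<noteq> 0 then monom_exp k i (pinch_point (f a) b) else A (M ! (a - 1)) k i b"]
    unfolding partial_eval_def by simp
qed

text \<open>Every selected variable brings at most a simple pole, and as soon as one is selected the
  partial evaluation vanishes at \<open>base\<close>. This settles a single selection; for two
  selections one further order has to be gained.\<close>

lemma removable_term:
  assumes P: "P \<in> wedge_H n l" and rho: "rho_vanishes n l 1 P" "rho_vanishes n l (- 1) P"
    and M: "\<And>a. a \<in> {1..l} \<Longrightarrow> M ! (a - 1) \<in> {1..n}"
      "\<And>a a'. a \<in> {1..l} \<Longrightarrow> a' \<in> {1..l} \<Longrightarrow> a < a' \<Longrightarrow> M ! (a - 1) < M ! (a' - 1)"
    and A: "\<forall>m\<in>{1..n}. \<forall>k i. admissible n (l - 1) k i \<longrightarrow> A m k i analytic_on {base}"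
    and c: "\<And>s m. s \<in> {1,2,3} \<Longrightarrow> m \<in> {1..n} \<Longrightarrow> c s m analytic_on {base}"
      "\<And>m. m \<in> {1..n} \<Longrightarrow> m < n \<Longrightarrow> c 1 m = (\<lambda>_. 0)"
      "\<And>m. m \<in> {1..n} \<Longrightarrow> m < n - 1 \<Longrightarrow> c 2 m = (\<lambda>_. 0)" "c 3 n base = 0"
    and rep: "tensor_rep P l (pairs l) R d k i"
    and reps: "\<And>E. E \<subseteq> pairs l \<Longrightarrow> \<exists>(R' :: 'r set) d' k' i'. tensor_rep P l E R' d' k' i'"
    and f: "f \<in> {1..l} \<rightarrow>\<^sub>E {0,1,2,3}"
  shows "removable base (\<lambda>b. (\<Prod>a=1..l. if f a \<noteq> 0 then - (2 * pi * \<i>) * (c (f a) (M ! (a - 1)) b / (b - base)) else 1) *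
     partial_eval A M l f R d k i b)"
proof -
  define S where "S = {a \<in> {1..l}. f a \<noteq> 0}"
  define \<kappa> where "\<kappa> = (\<lambda>a b. - (2 * pi * \<i>) * (c (f a) (M ! (a - 1)) b / (b - base)))"
  let ?B = "partial_eval A M l f R d k i"
  have finS: "finite S" unfolding S_def by simp
  have fS: "f a \<in> {1,2,3}" if "a \<in> S" for a using PiE_mem[OF f, of a] that unfolding S_def by auto
  have SM: "M ! (a - 1) \<in> {1..n}" if "a \<in> S" for a using M(1) that unfolding S_def by blast
  have prodS: "(\<Prod>a=1..l. if f a \<noteq> 0 then \<kappa> a b else 1) = (\<Prod>a\<in>S. \<kappa> a b)" for b
    unfolding S_def by (rule prod.inter_filter[symmetric]) simp
  have B_an: "?B analytic_on {base}" by (rule partial_eval_analytic[OF rep M(1) A])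
  have vanish: "partial_eval A M l f R' d' k' i' base = 0"
    if rep': "tensor_rep P l E R' d' k' i'" and ne: "S \<noteq> {}" for E and R' :: "'s set" and d' k' i'
  proof (rule partial_eval_zero[OF rep'])
    fix \<alpha> :: "nat \<Rightarrow> complex"
    assume \<alpha>: "\<And>a. a \<in> {1..l} \<Longrightarrow> f a \<noteq> 0 \<Longrightarrow> \<alpha> a = pinch_point (f a) base"
    obtain a where a: "a \<in> S" using ne by blast
    then show "eval_poly P (\<lambda>a. exp (- \<alpha> a)) (args base) = 0"
      using vanishes_at_pinch[OF P rho, of a "f a" \<alpha>] \<alpha>[of a] fS[OF a] unfolding S_def by blast
  qed
  have c_an: "(\<lambda>b. - (2 * pi * \<i>) * c (f a) (M ! (a - 1)) b) analytic_on {base}" if "a \<in> S" for a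
    by (intro analytic_on_mult analytic_on_const c(1) fS SM that)
  have "removable base (\<lambda>b. (\<Prod>a\<in>S. \<kappa> a b) * ?B b)"
  proof (cases "\<exists>a\<in>S. c (f a) (M ! (a - 1)) = (\<lambda>_. 0)")
    case True
    then obtain a where a: "a \<in> S" "c (f a) (M ! (a - 1)) = (\<lambda>_. 0)" by blast
    have "(\<Prod>a\<in>S. \<kappa> a b) = 0" for b
    proof (rule prod_zero[OF finS])
      show "\<exists>a\<in>S. \<kappa> a b = 0" using a(1) by (rule bexI[rotated]) (simp only: \<kappa>_def a(2), simp)
    qed
    then show ?thesis by (auto intro!: removable_analytic analytic_intros)
  next
    case good: False
    show ?thesis
    proof (cases "inj_on (\<lambda>a. exp_class (f a)) S")
      case False
      then obtain a a' where aa: "a \<in> S" "a' \<in> S" "a \<noteq> a'" "exp_class (f a) = exp_class (f a')"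
        unfolding inj_on_def by blast
      have "?B b = 0" for b
      proof (rule partial_eval_zero[OF rep])
        fix \<alpha> :: "nat \<Rightarrow> complex"
        assume \<alpha>: "\<And>a. a \<in> {1..l} \<Longrightarrow> f a \<noteq> 0 \<Longrightarrow> \<alpha> a = pinch_point (f a) b"
        show "eval_poly P (\<lambda>a. exp (- \<alpha> a)) (args b) = 0"
          using vanishes_same_class[OF P _ _ aa(3) fS[OF aa(1)] fS[OF aa(2)] aa(4), of \<alpha> b] \<alpha> aa(1,2)
          unfolding S_def by blast
      qed
      then show ?thesis by (auto intro!: removable_analytic analytic_intros)
    next
      case True
      have "card S \<le> card (UNIV :: bool set)" by (rule card_inj_on_le[OF True]) auto
      then have cS: "card S = 0 \<or> card S = 1 \<or> card S = 2" by auto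
      then show ?thesis
      proof (elim disjE)
        assume "card S = 0"
        then have "S = {}" using finS by simp
        then show ?thesis using B_an by (auto intro!: removable_analytic)
      next
        assume "card S = 1"
        then obtain a where S: "S = {a}" by (rule card_1_singletonE)
        have "removable base (\<lambda>b. (- (2 * pi * \<i>) * c (f a) (M ! (a - 1)) b) * (?B b / (b - base)))"
          by (intro removable_mult removable_divide removable_analytic B_an c_an vanish[OF rep]) (auto simp: S)
        then show ?thesis unfolding S \<kappa>_def by simp
      next
        assume "card S = 2"
        then obtain x y where xy: "S = {x, y}" "x \<noteq> y" by (auto simp: card_2_iff)
        \<comment> \<open>The indices are ordered, so that the corresponding entries of
          \<open>M\<close> increase.\<close>
        obtain a a' where S: "S = {a, a'}" "a < a'"
        proof (rule that[of "min x y" "max x y"])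
          show "S = {min x y, max x y}" using xy(1) by (auto simp: min_def max_def)
          show "min x y < max x y" using xy(2) by (auto simp: min_def max_def)
        qed
        have aS: "a \<in> S" "a' \<in> S" using S by auto
        have al: "a \<in> {1..l}" "a' \<in> {1..l}" "f a \<noteq> 0" "f a' \<noteq> 0" using aS unfolding S_def by auto
        have mm: "M ! (a - 1) < M ! (a' - 1)" using M(2)[OF al(1,2) S(2)] .
        have mr: "M ! (a - 1) \<in> {1..n}" "M ! (a' - 1) \<in> {1..n}" using M(1) al by auto
        have cls: "exp_class (f a) \<noteq> exp_class (f a')" by (rule inj_on_contraD[OF True _ aS]) (use S(2) in simp)
        have cancel: "(- K * (p / z)) * (- K * (q / z)) * (z * w) = ((- K * p) * (- K * q)) * (1 * (w / z))"
          "(- K * (p / z)) * (- K * (q / z)) * (- z * w) = ((- K * p) * (- K * q)) * (- 1 * (w / z))"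
          if "z \<noteq> 0" for K p q z w :: complex
          using that by (simp_all add: field_simps)
        have kk: "(\<Prod>a\<in>S. \<kappa> a b) = \<kappa> a b * \<kappa> a' b" for b using S by simp
        let ?ca = "c (f a) (M ! (a - 1))" and ?ca' = "c (f a') (M ! (a' - 1))"
        consider "f a = 2" "f a' = 3" | "f a = 3" "f a' = 2" | "f a = 2" "f a' = 1" | "f a = 1" "f a' = 2"
          using fS[OF aS(1)] fS[OF aS(2)] cls unfolding exp_class_def by auto
        then show ?thesis
        proof cases
          \<comment> \<open>A nonzero coefficient at the second point forces
            \<open>M ! (a - 1) \<ge> n - 1\<close>. The larger entry is then \<open>n\<close>, and
            its coefficient at the third point vanishes at \<open>base\<close>.\<close>
          case 1
          have "\<not> M ! (a - 1) < n - 1" using c(3)[OF mr(1)] good aS(1) 1(1) by auto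
          then have "M ! (a' - 1) = n" using mm mr(2) by auto
          then have z: "?ca' base = 0" using c(4) 1(2) by simp
          have eq: "(\<Prod>a\<in>S. \<kappa> a b) * ?B b =
              ((- (2 * pi * \<i>) * ?ca b) * (- (2 * pi * \<i>))) * ((?ca' b / (b - base)) * (?B b / (b - base)))" for b
            unfolding kk unfolding \<kappa>_def by (simp add: mult_ac)
          show ?thesis
            unfolding eq
            using vanish[OF rep] aS
            by (intro removable_mult removable_divide removable_analytic B_an c_an c(1) fS mr z analytic_on_mult analytic_on_const) auto
        next
          \<comment> \<open>The smaller entry is below \<open>n\<close>, so its coefficient at the
            first point is identically 0.\<close>
          case 4
          have "M ! (a - 1) < n" using mm mr(2) by auto
          then show ?thesis using c(2)[OF mr(1)] good aS(1) 4(1) by auto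
        next
          \<comment> \<open>Here
            \<open>b - 2 * pi * \<i> - \<beta> (n - 1) + pi * \<i> = b - base\<close>: the factor of
            the selected pair cancels one pole, and what remains still vanishes at
            \<open>base\<close>.\<close>
          case 2
          let ?E = "pairs l - {(a, a')}"
          have ins: "insert (a, a') ?E = pairs l" using al(1,2) S(2) unfolding pairs_def by auto
          obtain R' :: "'r set" and d' k' i' where rep': "tensor_rep P l ?E R' d' k' i'"
            using reps[of ?E] by blast
          let ?B' = "partial_eval A M l f R' d' k' i'"
          have B0: "?B b = (pinch_point (f a) b - pinch_point (f a') b + pi * \<i>) * ?B' b" for b
            by (rule partial_eval_factor[of P l a a' ?E, unfolded ins, OF rep rep' _ _ al])
              (simp_all add: finite_pairs)
          have B: "?B b = (b - base) * ?B' b" for b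
            unfolding B0[of b] pinch_point_def base_def using 2 by (simp add: algebra_simps)
          have zero: "?B' base = 0" using vanish[OF rep'] aS by blast
          have "removable base (\<lambda>b. ((- (2 * pi * \<i>) * ?ca b) * (- (2 * pi * \<i>) * ?ca' b)) * ((1 :: complex) * (?B' b / (b - base))))"
            by (intro removable_mult removable_divide removable_analytic zero partial_eval_analytic[OF rep' M(1) A]
                c(1) fS mr aS analytic_on_const)
          then show ?thesis
          proof (rule removable_cong)
            show "\<forall>\<^sub>F b in at base. (\<Prod>a\<in>S. \<kappa> a b) * ?B b =
              ((- (2 * pi * \<i>) * ?ca b) * (- (2 * pi * \<i>) * ?ca' b)) * ((1 :: complex) * (?B' b / (b - base)))"
              using eventually_neq_at_within[of base base UNIV]
            proof eventually_elim
              case (elim b)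
              then have "b - base \<noteq> 0" by simp
              then show ?case unfolding kk B unfolding \<kappa>_def by (rule cancel(1))
            qed
          qed
        next
          \<comment> \<open>The same cancellation, now with
            \<open>\<beta> (n - 1) - b + pi * \<i> = - (b - base)\<close>.\<close>
          case 3
          let ?E = "pairs l - {(a, a')}"
          have ins: "insert (a, a') ?E = pairs l" using al(1,2) S(2) unfolding pairs_def by auto
          obtain R' :: "'r set" and d' k' i' where rep': "tensor_rep P l ?E R' d' k' i'"
            using reps[of ?E] by blast
          let ?B' = "partial_eval A M l f R' d' k' i'"
          have B0: "?B b = (pinch_point (f a) b - pinch_point (f a') b + pi * \<i>) * ?B' b" for b
            by (rule partial_eval_factor[of P l a a' ?E, unfolded ins, OF rep rep' _ _ al])
              (simp_all add: finite_pairs)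
          have B: "?B b = - (b - base) * ?B' b" for b
            unfolding B0[of b] pinch_point_def base_def using 3 by (simp add: algebra_simps)
          have zero: "?B' base = 0" using vanish[OF rep'] aS by blast
          have "removable base (\<lambda>b. ((- (2 * pi * \<i>) * ?ca b) * (- (2 * pi * \<i>) * ?ca' b)) * (- (1 :: complex) * (?B' b / (b - base))))"
            by (intro removable_mult removable_divide removable_analytic zero partial_eval_analytic[OF rep' M(1) A]
                c(1) fS mr aS analytic_on_const)
          then show ?thesis
          proof (rule removable_cong)
            show "\<forall>\<^sub>F b in at base. (\<Prod>a\<in>S. \<kappa> a b) * ?B b =
              ((- (2 * pi * \<i>) * ?ca b) * (- (2 * pi * \<i>) * ?ca' b)) * (- (1 :: complex) * (?B' b / (b - base)))"
              using eventually_neq_at_within[of base base UNIV]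
            proof eventually_elim
              case (elim b)
              then have "b - base \<noteq> 0" by simp
              then show ?case unfolding kk B unfolding \<kappa>_def by (rule cancel(2))
            qed
          qed
        qed
      qed
    qed
  qed
  then show ?thesis using prodS unfolding \<kappa>_def by simp
qed

end

text \<open>A common point would be connected to itself in the complement of the curve.\<close>

lemma contour_disjoint_points:
  assumes "contour n \<beta> C"
  shows "lower_points n \<beta> \<inter> upper_points n \<beta> = {}"
proof (rule ccontr)
  assume "lower_points n \<beta> \<inter> upper_points n \<beta> \<noteq> {}"
  then obtain p where p: "p \<in> lower_points n \<beta>" "p \<in> upper_points n \<beta>" by blast
  have "p \<in> - range C" "\<not> connected_component (- range C) p p"
    using assms p unfolding contour_def separates_def by blast+
  then show False by simp
qed

section \<open>Regularity of the multiple integral at the collision\<close>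

context regular_pinching
begin

lemma I_M_removable:
  assumes P: "P \<in> wedge_H n l" and l: "l \<ge> 1" and rho: "rho_vanishes n l 1 P" "rho_vanishes n l (- 1) P"
    and M: "M \<in> indices n l" and con: "\<forall>\<^sub>F b in at base. contour n (\<beta>(n := b)) (C b)"
  shows "removable base (\<lambda>b. I_M n l P (C b) (\<beta>(n := b)) M)"
proof (cases "2 * l \<le> n + 1 \<or> (\<forall>X b. eval_poly P (X(1 := 0)) (args b) = 0)")
  case False
  then obtain X b0 where X: "eval_poly P (X(1 := 0)) (args b0) \<noteq> 0" by blast
  have slow: "n + 2 \<le> 2 * l" using False by simp
  \<comment> \<open>As this entire function of \<open>b\<close> is nonzero at \<open>b0\<close>, it
    is nonzero for all \<open>b\<close> close to but different from \<open>base\<close>, so the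
    divergence argument applies at each of them.\<close>
  have "(\<lambda>b. eval_poly P (X(1 := 0)) (args b)) holomorphic_on UNIV"
    by (rule eval_poly_update_holomorphic[OF wedge_HD(1)[OF P]]) (rule holomorphic_on_const args_holomorphic)+
  from eventually_nonzero_entire[OF this X] con
  have "\<forall>\<^sub>F b in at base. I_M n l P (C b) (\<beta>(n := b)) M = 0"
  proof eventually_elim
    case (elim b)
    show ?case
      by (rule I_M_eq_0_of_slow_decay[OF P l slow elim(2) M elim(1)[unfolded args_def]]) simp
  qed
  then show ?thesis by (rule removable_cong[OF removable_analytic[OF analytic_on_const]])
next
  case fast: True
  have M1: "M ! (a - 1) \<in> {1..n}" if "a \<in> {1..l}" for a
  proof -
    have "a - 1 < length M" using that M unfolding indices_def by auto
    then have "M ! (a - 1) \<in> set M" by (rule nth_mem)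
    then show ?thesis using M unfolding indices_def by blast
  qed
  have M2: "M ! (a - 1) < M ! (a' - 1)" if "a \<in> {1..l}" "a' \<in> {1..l}" "a < a'" for a a'
  proof (rule sorted_wrt_nth_less[of "(<)"])
    show "sorted_wrt (<) M" using M unfolding indices_def by simp
    show "a - 1 < a' - 1" "a' - 1 < length M" using that M unfolding indices_def by auto
  qed
  have reps: "\<exists>(R :: (nat \<times> ((nat + nat) \<Rightarrow>\<^sub>0 nat)) set) d k i. tensor_rep P l E R d k i" if "E \<subseteq> pairs l" for E
    by (rule tensor_rep_exists[OF P l fast that])
  obtain R :: "(nat \<times> ((nat + nat) \<Rightarrow>\<^sub>0 nat)) set" and d k i where rep: "tensor_rep P l (pairs l) R d k i"
    using reps[OF subset_refl] by blast
  have "\<exists>c. \<forall>m\<in>{1..n}. pinch_coeff 1 m (c m) \<and> (m < n \<longrightarrow> c m = (\<lambda>_. 0))"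
    using pinch_coeff_1 by (intro bchoice ballI)
  then obtain c1 where c1: "\<forall>m\<in>{1..n}. pinch_coeff 1 m (c1 m) \<and> (m < n \<longrightarrow> c1 m = (\<lambda>_. 0))" ..
  have "\<exists>c. \<forall>m\<in>{1..n}. pinch_coeff 2 m (c m) \<and> (m < n - 1 \<longrightarrow> c m = (\<lambda>_. 0))"
    using pinch_coeff_2 by (intro bchoice ballI)
  then obtain c2 where c2: "\<forall>m\<in>{1..n}. pinch_coeff 2 m (c2 m) \<and> (m < n - 1 \<longrightarrow> c2 m = (\<lambda>_. 0))" ..
  have "\<exists>c. \<forall>m\<in>{1..n}. pinch_coeff 3 m (c m) \<and> (m = n \<longrightarrow> c m base = 0)"
    using pinch_coeff_3 by (intro bchoice ballI)
  then obtain c3 where c3: "\<forall>m\<in>{1..n}. pinch_coeff 3 m (c3 m) \<and> (m = n \<longrightarrow> c3 m base = 0)" ..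
  define c where "c = (\<lambda>s m. if s = (1 :: nat) then c1 m else if s = 2 then c2 m else c3 m)"
  have c: "pinch_coeff s m (c s m)" if s: "s \<in> {1,2,3}" and m: "m \<in> {1..n}" for s m
  proof -
    consider (1) "s = 1" | (2) "s = 2" | (3) "s = 3" using s by blast
    then show ?thesis using m c1 c2 c3 unfolding c_def by cases auto
  qed
  have c_an: "c s m analytic_on {base}" if "s \<in> {1,2,3}" "m \<in> {1..n}" for s m
    using c[OF that] unfolding pinch_coeff_def by blast
  have cz1: "c 1 m = (\<lambda>_. 0)" if "m \<in> {1..n}" "m < n" for m using c1 that unfolding c_def by simp
  have cz2: "c 2 m = (\<lambda>_. 0)" if "m \<in> {1..n}" "m < n - 1" for m using c2 that unfolding c_def by simp
  have cz3: "c 3 n base = 0" using bspec[OF c3, of n] n2 unfolding c_def by simp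
  have "\<exists>A. (\<forall>m\<in>{1..n}. \<forall>k i. admissible n (l - 1) k i \<longrightarrow> A m k i analytic_on {base}) \<and>
    (\<forall>\<^sub>F b in at base. \<forall>C m k i. contour n (\<beta>(n := b)) C \<longrightarrow> m \<in> {1..n} \<longrightarrow> admissible n (l - 1) k i \<longrightarrow>
       integrable lborel (\<lambda>t. vector_derivative C (at t) * (weight n (\<beta>(n := b)) m (C t) * monom_exp k i (C t))) \<and>
       (LINT t|lborel. vector_derivative C (at t) * (weight n (\<beta>(n := b)) m (C t) * monom_exp k i (C t))) =
         A m k i b - 2 * pi * \<i> * (\<Sum>s\<in>{1,2,3}. c s m b / (b - base) * monom_exp k i (pinch_point s b)))"
    by (rule one_variable_integral) (rule c)
  then obtain A where A: "\<forall>m\<in>{1..n}. \<forall>k i. admissible n (l - 1) k i \<longrightarrow> A m k i analytic_on {base}"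
    and ev: "\<forall>\<^sub>F b in at base. \<forall>C m k i. contour n (\<beta>(n := b)) C \<longrightarrow> m \<in> {1..n} \<longrightarrow> admissible n (l - 1) k i \<longrightarrow>
       integrable lborel (\<lambda>t. vector_derivative C (at t) * (weight n (\<beta>(n := b)) m (C t) * monom_exp k i (C t))) \<and>
       (LINT t|lborel. vector_derivative C (at t) * (weight n (\<beta>(n := b)) m (C t) * monom_exp k i (C t))) =
         A m k i b - 2 * pi * \<i> * (\<Sum>s\<in>{1,2,3}. c s m b / (b - base) * monom_exp k i (pinch_point s b))"
    by (elim exE conjE)
  define \<kappa> where "\<kappa> = (\<lambda>b a s. if s \<noteq> 0 then - (2 * pi * \<i>) * (c s (M ! (a - 1)) b / (b - base)) else 1)"
  define \<tau> where "\<tau> = (\<lambda>b r a s. if s \<noteq> 0 then monom_exp (k r a) (i r a) (pinch_point s b)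
      else A (M ! (a - 1)) (k r a) (i r a) b)"
  have finR: "finite R" using rep unfolding tensor_rep_def by blast
  have adm: "admissible n (l - 1) (k r a) (i r a)" if "r \<in> R" "a \<in> {1..l}" for r a
    using rep that unfolding tensor_rep_def by blast
  \<comment> \<open>The choice 0 stands for the regular part. Every one-variable integral becomes a
    sum over four choices, and the product over the variables expands into a sum over functions
    \<open>f\<close>.\<close>
  have split: "A0 - K * (\<Sum>s\<in>{1,2,3 :: nat}. u s * w s) =
      (\<Sum>s\<in>{0,1,2,3}. (if s \<noteq> 0 then - K * u s else 1) * (if s \<noteq> 0 then w s else A0))"
    for A0 K :: complex and u w
    by (simp add: algebra_simps)
  have expand: "\<forall>\<^sub>F b in at base. I_M n l P (C b) (\<beta>(n := b)) M =
      (\<Sum>f\<in>{1..l} \<rightarrow>\<^sub>E {0,1,2,3}. (\<Prod>a=1..l. \<kappa> b a (f a)) * partial_eval A M l f R d k i b)"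
    using con ev
  proof eventually_elim
    case (elim b)
    have inj: "inj (C b)" using elim(1) unfolding contour_def by blast
    note one = elim(2)[rule_format, OF elim(1) M1 adm]
    let ?W = "\<lambda>r a. LINT t|lborel. vector_derivative (C b) (at t) *
       (weight n (\<beta>(n := b)) (M ! (a - 1)) (C b t) * monom_exp (k r a) (i r a) (C b t))"
    have "I_M n l P (C b) (\<beta>(n := b)) M = (\<Sum>r\<in>R. d r b * (\<Prod>a=1..l. ?W r a))"
    proof (rule I_M_tensor[OF inj finR])
      show "(\<Prod>(a, b)\<in>pairs l. \<alpha> a - \<alpha> b + pi * \<i>) * eval_poly P (\<lambda>a. exp (- \<alpha> a)) (\<lambda>j. exp ((\<beta>(n := b)) j)) =
         (\<Sum>r\<in>R. d r b * (\<Prod>a=1..l. monom_exp (k r a) (i r a) (\<alpha> a)))" for \<alpha>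
        by (rule tensor_repD[OF rep, unfolded args_def])
      fix r a assume "r \<in> R" "a \<in> {1..l}"
      then show "integrable lborel (\<lambda>t. vector_derivative (C b) (at t) *
          (weight n (\<beta>(n := b)) (M ! (a - 1)) (C b t) * monom_exp (k r a) (i r a) (C b t)))"
        by (intro one[THEN conjunct1])
    qed
    also have "\<dots> = (\<Sum>r\<in>R. d r b * (\<Prod>a=1..l. \<Sum>s\<in>{0,1,2,3}. \<kappa> b a s * \<tau> b r a s))"
    proof (intro sum.cong refl arg_cong2[of _ _ _ _ "(*)"] prod.cong)
      fix r a assume ra: "r \<in> R" "a \<in> {1..l}"
      show "?W r a = (\<Sum>s\<in>{0,1,2,3}. \<kappa> b a s * \<tau> b r a s)"
        unfolding one[OF ra(2) ra, THEN conjunct2] split \<kappa>_def \<tau>_def ..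
    qed
    also have "\<dots> = (\<Sum>r\<in>R. d r b * (\<Sum>f\<in>{1..l} \<rightarrow>\<^sub>E {0,1,2,3}. \<Prod>a=1..l. \<kappa> b a (f a) * \<tau> b r a (f a)))"
      by (intro sum.cong refl arg_cong2[of _ _ _ _ "(*)"] prod_sum_PiE) auto
    also have "\<dots> = (\<Sum>r\<in>R. \<Sum>f\<in>{1..l} \<rightarrow>\<^sub>E {0,1,2,3}. (\<Prod>a=1..l. \<kappa> b a (f a)) * (d r b * (\<Prod>a=1..l. \<tau> b r a (f a))))"
      by (simp only: sum_distrib_left prod.distrib mult.left_commute)
    also have "\<dots> = (\<Sum>f\<in>{1..l} \<rightarrow>\<^sub>E {0,1,2,3}. \<Sum>r\<in>R. (\<Prod>a=1..l. \<kappa> b a (f a)) * (d r b * (\<Prod>a=1..l. \<tau> b r a (f a))))"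
      by (rule sum.swap)
    also have "\<dots> = (\<Sum>f\<in>{1..l} \<rightarrow>\<^sub>E {0,1,2,3}. (\<Prod>a=1..l. \<kappa> b a (f a)) * partial_eval A M l f R d k i b)"
      unfolding partial_eval_def \<tau>_def sum_distrib_left ..
    finally show ?case .
  qed
  show ?thesis
  proof (rule removable_cong[OF removable_sum expand])
    fix f :: "nat \<Rightarrow> nat" assume f: "f \<in> {1..l} \<rightarrow>\<^sub>E {0,1,2,3}"
    show "removable base (\<lambda>b. (\<Prod>a=1..l. \<kappa> b a (f a)) * partial_eval A M l f R d k i b)"
      unfolding \<kappa>_def
    proof (rule removable_term[where P = P and M = M and A = A and c = c and R = R and d = d and k = k and i = i
          and l = l and f = f])
      show "f \<in> {1..l} \<rightarrow>\<^sub>E {0,1,2,3}" by (rule f)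
      fix E assume "E \<subseteq> pairs l"
      then show "\<exists>(R :: (nat \<times> ((nat + nat) \<Rightarrow>\<^sub>0 nat)) set) d k i. tensor_rep P l E R d k i" by (rule reps)
    qed (fact P rho M1 M2 A c_an cz1 cz2 cz3 rep)+
  qed
qed

end

theorem corollary1:
  fixes n l :: nat and P :: Xx_poly and \<beta> :: "nat \<Rightarrow> complex"
    and C :: "complex \<Rightarrow> real \<Rightarrow> complex"
  assumes "n \<ge> 2" and "l \<ge> 1"
    and "P \<in> wedge_H n l"
    and "rho_vanishes n l 1 P" and "rho_vanishes n l (-1) P"
    and "\<forall>j\<in>{1..<n - 1}. \<forall>k::int. \<beta> (n - 1) - \<beta> j \<noteq> 2 * of_int k * pi * \<i>"
    and "\<forall>\<^sub>F b in at (\<beta> (n - 1) + pi * \<i>). contour n (\<beta>(n := b)) (C b)"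
  shows "residue_tensor (\<lambda>b. psi n l P (C b) (\<beta>(n := b))) (\<beta> (n - 1) + pi * \<i>) = (\<lambda>_. 0)"
proof -
  \<comment> \<open>A contour for any nearby \<open>b\<close> already separates the points of the
    fixed parameters; with the hypothesis on even multiples this supplies the locale
    assumptions.\<close>
  obtain b where b: "contour n (\<beta>(n := b)) (C b)"
    using eventually_happens'[OF at_neq_bot assms(7)] by blast
  have sub: "(\<beta>(n := b)) j = \<beta> j" if "j \<in> {1..n - 1}" for j using that by auto
  have mono: "j \<in> {1..n}" if "j \<in> {1..n - 1}" for j using that by auto
  have lower: "\<beta> j - 2 * of_nat k * pi * \<i> \<in> lower_points n (\<beta>(n := b))" if "j \<in> {1..n - 1}" for j k
    using lower_pointsI[OF mono[OF that], of "\<beta>(n := b)" k] unfolding sub[OF that] .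
  have upper: "\<beta> j - pi * \<i> + 2 * of_nat k * pi * \<i> \<in> upper_points n (\<beta>(n := b))" if "j \<in> {1..n - 1}" for j k
    using upper_pointsI[OF mono[OF that], of "\<beta>(n := b)" k] unfolding sub[OF that] .
  have disj: "p \<notin> upper_points n (\<beta>(n := b))" if "p \<in> lower_points n (\<beta>(n := b))" for p
    using contour_disjoint_points[OF b] that by blast
  have generic: "\<beta> (n - 1) - \<beta> j \<noteq> of_int k * pi * \<i>" if j: "j \<in> {1..<n - 1}" for j and k :: int
  proof
    assume eq: "\<beta> (n - 1) - \<beta> j = of_int k * pi * \<i>"
    have j': "j \<in> {1..n - 1}" and n': "n - 1 \<in> {1..n - 1}" using j assms(1) by auto
    show False
    proof (cases "even k")
      case True
      then obtain q where "k = 2 * q" by (rule evenE)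
      then have "\<beta> (n - 1) - \<beta> j = 2 * of_int q * pi * \<i>" using eq by simp
      then show False using assms(6) j by blast
    next
      case False
      then obtain q where q: "k = 2 * q + 1" by (rule oddE)
      have eq': "\<beta> (n - 1) = \<beta> j + (2 * of_int q + 1) * pi * \<i>" using eq q by (simp add: algebra_simps)
      \<comment> \<open>An odd multiple would place a lower point of one parameter on an upper point
        of the other. The families extend in one direction only, so the sign decides which is which;
        for \<open>q = - 1\<close> the upper family of \<open>\<beta> j\<close>, which starts at
        \<open>\<beta> j - pi * \<i>\<close>, still reaches \<beta> (n - 1).\<close>
      show False
      proof (cases "q \<ge> - 1")
        case True
        then have "(of_nat (nat (q + 1)) :: complex) = of_int q + 1" by simp
        then have "\<beta> j - pi * \<i> + 2 * of_nat (nat (q + 1)) * pi * \<i> = \<beta> (n - 1) - 2 * of_nat 0 * pi * \<i>"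
          unfolding eq' by (simp add: algebra_simps)
        then show False using upper[OF j', of "nat (q + 1)"] disj[OF lower[OF n', of 0]] by metis
      next
        case False
        then have "(of_nat (nat (- q)) :: complex) = - of_int q" by simp
        then have "\<beta> (n - 1) - pi * \<i> + 2 * of_nat 0 * pi * \<i> = \<beta> j - 2 * of_nat (nat (- q)) * pi * \<i>"
          unfolding eq' by (simp add: algebra_simps)
        then show False using upper[OF n', of 0] disj[OF lower[OF j', of "nat (- q)"]] by metis
      qed
    qed
  qed
  have disjoint: "lower_points (n - 1) \<beta> \<inter> upper_points (n - 1) \<beta> = {}"
  proof (rule ccontr)
    assume "lower_points (n - 1) \<beta> \<inter> upper_points (n - 1) \<beta> \<noteq> {}"
    then obtain p where p: "p \<in> lower_points (n - 1) \<beta>" "p \<in> upper_points (n - 1) \<beta>" by blast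
    have "p \<in> lower_points n (\<beta>(n := b))" using p(1) by (rule lower_pointsE) (use lower in simp)
    moreover have "p \<in> upper_points n (\<beta>(n := b))" using p(2) by (rule upper_pointsE) (use upper in simp)
    ultimately show False using disj by blast
  qed
  interpret regular_pinching n \<beta>
    using assms(1) generic disjoint by unfold_locales
  have "residue (\<lambda>b. psi n l P (C b) (\<beta>(n := b)) es) base = 0" for es
    unfolding psi_def
    by (intro residue_removable removable_sum removable_mult removable_analytic[OF analytic_on_const]
        I_M_removable[OF assms(3,2,4,5)]) (simp_all only: base_def assms(7))
  then show ?thesis unfolding residue_tensor_def base_def by (intro ext)
qed

end
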